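(* Let $\mathcal W$ be a weak fundamental localizer. The class of $\mathcal W$-exact squares is the smallest class $\mathcal Q$ of squares (closed under isomorphism of squares) that is stable under horizontal composition, satisfies the local descent condition, contains all comma squares, and contains all commutative squares of the form $$\begin{array}{ccc} A&\xrightarrow{\,u\,}& B\\ \downarrow&&\downarrow\\ e&\to& e\end{array}$$ where $u$ is a $\mathcal W$-coaspherical functor between small categories. (That is: the class of $\mathcal W$-exact squares has all these properties, and is contained in every class of squares having all these properties.)
   Context: $\mathrm{Cat}$ is the (2-)category of small categories; $e$ is the terminal (one-object, one-arrow) category. For a functor $u:A\to B$ and an object $b$ of $B$: $A/b$ is the category of pairs $(a,g:u(a)\to b)$, a morphism $(a_1,g_1)\to(a_2,g_2)$ being an arrow $f:a_1\to a_2$ of $A$ with $g_2u(f)=g_1$; dually $b\backslash A$ is the category of pairs $(a,g:b\to u(a))$, a morphism being an arrow $f$ of $A$ with $u(f)g_1=g_2$. An object $b$ of $B$ is identified with the functor $b:e\to B$. A class $\mathcal W$ of arrows of $\mathrm{Cat}$ is weakly saturated if: identities are in $\mathcal W$; if two of the three arrows of a commutative triangle are in $\mathcal W$, so is the third; if $i:A'\to A$, $r:A\to A'$ satisfy $ri=1_{A'}$ and $ir\in\mathcal W$, then $r\in\mathcal W$. A weak fundamental localizer is a class $\mathcal W$ of arrows of $\mathrm{Cat}$ such that: $\mathcal W$ is weakly saturated; if $A$ has a terminal object, then $A\to e$ is in $\mathcal W$; if $u:A\to B$ is such that for every object $b$ of $B$ the induced functor $A/b\to B/b$ is in $\mathcal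 W$, then $u\in\mathcal W$. A small category $A$ is $\mathcal W$-aspherical if $A\to e$ is in $\mathcal W$. A functor $u:A\to B$ is $\mathcal W$-coaspherical if for every object $b$ of $B$ the functor $b\backslash A\to b\backslash B$ induced by $u$ is in $\mathcal W$ (equivalently, $b\backslash A$ is $\mathcal W$-aspherical). A square $\mathcal D$ consists of small categories $A,B,A',B'$, functors $v:A'\to A$ (top), $w:B'\to B$ (bottom), $u':A'\to B'$ (left), $u:A\to B$ (right), and a natural transformation $\alpha:uv\to wu'$. It is commutative if $\alpha$ is an identity. It is a comma square if the canonical functor $a'\mapsto (v(a'),u'(a'),\alpha_{a'})$ from $A'$ to the comma category $u\downarrow w$ (objects: triples $(a,b',g:u(a)\to w(b'))$; morphisms: pairs $(f,g')$ with $g_2u(f)=w(g')g_1$) is an isomorphism. An isomorphism of squares consists of isomorphisms of the four categories compatible with the four functors and the natural transformation. $\mathcal D$ is $\mathcal W$-exact if for all objects $a$ of $A$, $b'$ of $B'$ and every arrow $g:u(a)\to w(b')$ of $B$, the following category $A'_{(a,b',g)}$ is $\mathcal W$-aspherical: objects are triples $(a',f,g')$ with $a'\in\mathrm{Ob}\,A'$, $f:a\to v(a')$ in $A$, $g':u'(a')\to b'$ in $B'$ such that $w(g')\alpha_{a'}u(f)=g$; morphisms $(a'_1,f_1,g'_1)\to(a'_2,f_2,g'_2)$ are arrows $f':a'_1\to a'_2$ of $A'$ with $v(f')f_1=f_2$ and $g'_2u'(f')=g'_1$. Horizontal composition: given $\mathcal D$ and a square $\mathcal D'$ with top $v':A''\to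 A'$, bottom $w':B''\to B'$, left $u'':A''\to B''$, right $u'$, and 2-cell $\alpha':u'v'\to w'u''$, the composite $\mathcal D\circ_h\mathcal D'$ has top $vv'$, bottom $ww'$, left $u''$, right $u$ and 2-cell $(w\star\alpha')(\alpha\star v')$. Local descent condition for $\mathcal Q$: for every square $\mathcal D$ with top $v:A'\to A$, bottom $w:B'\to B$, left $u':A'\to B'$, right $u:A\to B$ and 2-cell $\alpha:uv\to wu'$, if for every object $b'$ of $B'$ the composite $\mathcal D\circ_h\mathcal D^{g}_{u',b'}$ is in $\mathcal Q$, then $\mathcal D$ is in $\mathcal Q$. Here $\mathcal D^{g}_{u',b'}$ is the comma square with top the forgetful functor $A'/b'\to A'$, left $A'/b'\to e$, bottom $b':e\to B'$, right $u'$, and 2-cell with component $g'$ at $(a',g')$. *)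

theory Defs
  imports Main "HOL-Library.FuncSet"
begin

section \<open>Universes and small categories\<close>

text \<open>
  Smallness is relative to a universe: a type \<open>'u\<close> with an ordered pairing and a notion of
  small set.  Every Grothendieck universe containing an infinite set is an instance (take for
  \<open>'u\<close> its elements, and for the small sets those subsets that are themselves elements);
  closure under power sets is not demanded.
\<close>

class universe =
  fixes small :: "'a set \<Rightarrow> bool"
    and pair :: "'a \<Rightarrow> 'a \<Rightarrow> 'a"
  assumes pair_inject: "pair x y = pair x' y' \<Longrightarrow> x = x' \<and> y = y'"
    and small_singleton: "small {x}"
    and small_subset: "small X \<Longrightarrow> Y \<subseteq> X \<Longrightarrow> small Y"
    and small_UN: "small I \<Longrightarrow> (\<And>i. i \<in> I \<Longrightarrow> small (F i)) \<Longrightarrow> small (\<Union>i\<in>I. F i)"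
    and small_infinite: "\<exists>X. infinite X \<and> small X"

definition pfst :: "'u::universe \<Rightarrow> 'u" where
  "pfst z = (THE x. \<exists>y. z = pair x y)"

definition psnd :: "'u::universe \<Rightarrow> 'u" where
  "psnd z = (THE y. \<exists>x. z = pair x y)"

text \<open>
  All structure maps are required to be extensional (equal to \<^const>\<open>undefined\<close> outside their
  domain), so that equality of records is equality of categories, functors and squares.
\<close>

record 'u cat =
  Ob :: "'u set"
  Ar :: "'u set"
  Dom :: "'u \<Rightarrow> 'u"
  Cod :: "'u \<Rightarrow> 'u"
  Idn :: "'u \<Rightarrow> 'u"
  Cmp :: "'u \<Rightarrow> 'u \<Rightarrow> 'u"

definition hom :: "'u cat \<Rightarrow> 'u \<Rightarrow> 'u \<Rightarrow> 'u set" where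
  "hom C a b = {f \<in> Ar C. Dom C f = a \<and> Cod C f = b}"

definition small_category :: "'u::universe cat \<Rightarrow> bool" where
  "small_category C \<longleftrightarrow>
     small (Ob C) \<and> small (Ar C) \<and>
     Dom C \<in> Ar C \<rightarrow>\<^sub>E Ob C \<and> Cod C \<in> Ar C \<rightarrow>\<^sub>E Ob C \<and> Idn C \<in> Ob C \<rightarrow>\<^sub>E Ar C \<and>
     (\<forall>a\<in>Ob C. Idn C a \<in> hom C a a) \<and>
     (\<forall>f\<in>Ar C. \<forall>g\<in>Ar C. Cod C f = Dom C g \<longrightarrow> Cmp C g f \<in> hom C (Dom C f) (Cod C g)) \<and>
     (\<forall>g f. \<not> (f \<in> Ar C \<and> g \<in> Ar C \<and> Cod C f = Dom C g) \<longrightarrow> Cmp C g f = undefined) \<and>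
     (\<forall>f\<in>Ar C. Cmp C f (Idn C (Dom C f)) = f \<and> Cmp C (Idn C (Cod C f)) f = f) \<and>
     (\<forall>f\<in>Ar C. \<forall>g\<in>Ar C. \<forall>h\<in>Ar C. Cod C f = Dom C g \<longrightarrow> Cod C g = Dom C h \<longrightarrow>
        Cmp C h (Cmp C g f) = Cmp C (Cmp C h g) f)"

definition has_terminal_object :: "'u cat \<Rightarrow> bool" where
  "has_terminal_object C \<longleftrightarrow> (\<exists>t\<in>Ob C. \<forall>a\<in>Ob C. \<exists>!f. f \<in> hom C a t)"


section \<open>Functors\<close>

record 'u cat_functor =
  Src :: "'u cat"
  Tgt :: "'u cat"
  FOb :: "'u \<Rightarrow> 'u"
  FAr :: "'u \<Rightarrow> 'u"

definition is_functor :: "'u::universe cat_functor \<Rightarrow> bool" where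
  "is_functor F \<longleftrightarrow>
     small_category (Src F) \<and> small_category (Tgt F) \<and>
     FOb F \<in> Ob (Src F) \<rightarrow>\<^sub>E Ob (Tgt F) \<and> FAr F \<in> Ar (Src F) \<rightarrow>\<^sub>E Ar (Tgt F) \<and>
     (\<forall>f\<in>Ar (Src F). FAr F f \<in> hom (Tgt F) (FOb F (Dom (Src F) f)) (FOb F (Cod (Src F) f))) \<and>
     (\<forall>a\<in>Ob (Src F). FAr F (Idn (Src F) a) = Idn (Tgt F) (FOb F a)) \<and>
     (\<forall>f\<in>Ar (Src F). \<forall>g\<in>Ar (Src F). Cod (Src F) f = Dom (Src F) g \<longrightarrow>
        FAr F (Cmp (Src F) g f) = Cmp (Tgt F) (FAr F g) (FAr F f))"

definition mk_functor ::
    "'u cat \<Rightarrow> 'u cat \<Rightarrow> ('u \<Rightarrow> 'u) \<Rightarrow> ('u \<Rightarrow> 'u) \<Rightarrow> 'u cat_functor" where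
  "mk_functor A B fo fa =
     \<lparr>Src = A, Tgt = B, FOb = restrict fo (Ob A), FAr = restrict fa (Ar A)\<rparr>"

definition id_functor :: "'u cat \<Rightarrow> 'u cat_functor" where
  "id_functor A = mk_functor A A (\<lambda>a. a) (\<lambda>f. f)"

definition comp_functor :: "'u cat_functor \<Rightarrow> 'u cat_functor \<Rightarrow> 'u cat_functor"
    (infixr \<open>\<circ>\<^sub>F\<close> 70) where
  "G \<circ>\<^sub>F F = mk_functor (Src F) (Tgt G) (\<lambda>a. FOb G (FOb F a)) (\<lambda>f. FAr G (FAr F f))"

definition is_iso_functor :: "'u::universe cat_functor \<Rightarrow> bool" where
  "is_iso_functor F \<longleftrightarrow> is_functor F \<and>
     (\<exists>G. is_functor G \<and> Src G = Tgt F \<and> Tgt G = Src F \<and>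
        G \<circ>\<^sub>F F = id_functor (Src F) \<and> F \<circ>\<^sub>F G = id_functor (Tgt F))"

text \<open>The terminal category on an arbitrarily chosen element, and functors to and from it.\<close>

definition pt :: "'u::universe" where
  "pt = undefined"

definition e_cat :: "'u::universe cat" where
  "e_cat = \<lparr>Ob = {pt}, Ar = {pt}, Dom = (\<lambda>_\<in>{pt}. pt), Cod = (\<lambda>_\<in>{pt}. pt),
     Idn = (\<lambda>_\<in>{pt}. pt), Cmp = (\<lambda>g f. if f = pt \<and> g = pt then pt else undefined)\<rparr>"

definition to_e :: "'u::universe cat \<Rightarrow> 'u cat_functor" where
  "to_e A = mk_functor A e_cat (\<lambda>_. pt) (\<lambda>_. pt)"

definition point :: "'u::universe cat \<Rightarrow> 'u \<Rightarrow> 'u cat_functor" where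
  "point B b = mk_functor e_cat B (\<lambda>_. b) (\<lambda>_. Idn B b)"


section \<open>Comma categories\<close>

text \<open>
  The category with object set \<open>X\<close> in which a morphism from \<open>x\<close> to \<open>y\<close> is an element \<open>f\<close> of
  \<open>H x y\<close>, with identities \<open>i x\<close> and composition \<open>c\<close>.  Since the sets \<open>H x y\<close> may overlap, such
  a morphism is encoded as the arrow \<open>pair (pair x y) f\<close>.
\<close>

definition hom_cat ::
    "'u set \<Rightarrow> ('u \<Rightarrow> 'u \<Rightarrow> 'u set) \<Rightarrow> ('u \<Rightarrow> 'u) \<Rightarrow> ('u \<Rightarrow> 'u \<Rightarrow> 'u) \<Rightarrow> 'u::universe cat" where
  "hom_cat X H i c =
     (let M = {pair (pair x y) f | x y f. x \<in> X \<and> y \<in> X \<and> f \<in> H x y};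
          s = (\<lambda>m. pfst (pfst m)); t = (\<lambda>m. psnd (pfst m))
      in \<lparr>Ob = X, Ar = M, Dom = restrict s M, Cod = restrict t M,
          Idn = (\<lambda>x\<in>X. pair (pair x x) (i x)),
          Cmp = (\<lambda>n m. if m \<in> M \<and> n \<in> M \<and> t m = s n
                        then pair (pair (s m) (t n)) (c (psnd n) (psnd m)) else undefined)\<rparr>)"

text \<open>The arrow part of a functor between two categories of the form \<^const>\<open>hom_cat\<close>.\<close>

definition hom_map :: "('u \<Rightarrow> 'u) \<Rightarrow> ('u \<Rightarrow> 'u) \<Rightarrow> 'u \<Rightarrow> 'u::universe" where
  "hom_map fo h m = pair (pair (fo (pfst (pfst m))) (fo (psnd (pfst m)))) (h (psnd m))"

text \<open>\<open>A/b\<close> for \<open>u : A \<rightarrow> B\<close>; its objects are the pairs \<open>(a, g : u(a) \<rightarrow> b)\<close>.\<close>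

definition over_cat :: "'u::universe cat_functor \<Rightarrow> 'u \<Rightarrow> 'u cat" where
  "over_cat u b = (let A = Src u; B = Tgt u in
     hom_cat {pair a g | a g. a \<in> Ob A \<and> g \<in> hom B (FOb u a) b}
       (\<lambda>x y. {f \<in> hom A (pfst x) (pfst y). Cmp B (psnd y) (FAr u f) = psnd x})
       (\<lambda>x. Idn A (pfst x)) (Cmp A))"

text \<open>\<open>b\A\<close> for \<open>u : A \<rightarrow> B\<close>; its objects are the pairs \<open>(a, g : b \<rightarrow> u(a))\<close>.\<close>

definition under_cat :: "'u::universe cat_functor \<Rightarrow> 'u \<Rightarrow> 'u cat" where
  "under_cat u b = (let A = Src u; B = Tgt u in
     hom_cat {pair a g | a g. a \<in> Ob A \<and> g \<in> hom B b (FOb u a)}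
       (\<lambda>x y. {f \<in> hom A (pfst x) (pfst y). Cmp B (FAr u f) (psnd x) = psnd y})
       (\<lambda>x. Idn A (pfst x)) (Cmp A))"

text \<open>The functors \<open>A/b \<rightarrow> B/b\<close> and \<open>b\A \<rightarrow> b\B\<close> induced by \<open>u : A \<rightarrow> B\<close>.\<close>

definition over_functor :: "'u::universe cat_functor \<Rightarrow> 'u \<Rightarrow> 'u cat_functor" where
  "over_functor u b = (let fo = (\<lambda>x. pair (FOb u (pfst x)) (psnd x)) in
     mk_functor (over_cat u b) (over_cat (id_functor (Tgt u)) b) fo (hom_map fo (FAr u)))"

definition under_functor :: "'u::universe cat_functor \<Rightarrow> 'u \<Rightarrow> 'u cat_functor" where
  "under_functor u b = (let fo = (\<lambda>x. pair (FOb u (pfst x)) (psnd x)) in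
     mk_functor (under_cat u b) (under_cat (id_functor (Tgt u)) b) fo (hom_map fo (FAr u)))"

text \<open>
  The comma category of \<open>u : A \<rightarrow> B\<close> and \<open>w : B' \<rightarrow> B\<close>: an object \<open>(a, b', g)\<close> is encoded as
  \<open>pair a (pair b' g)\<close>, a morphism \<open>(f, g')\<close> as \<open>pair f g'\<close>.
\<close>

definition comma_cat :: "'u::universe cat_functor \<Rightarrow> 'u cat_functor \<Rightarrow> 'u cat" where
  "comma_cat u w = (let A = Src u; B' = Src w; B = Tgt u in
     hom_cat
       {pair a (pair b' g) | a b' g. a \<in> Ob A \<and> b' \<in> Ob B' \<and> g \<in> hom B (FOb u a) (FOb w b')}
       (\<lambda>x y. {pair f g' | f g'.
           f \<in> hom A (pfst x) (pfst y) \<and> g' \<in> hom B' (pfst (psnd x)) (pfst (psnd y)) \<and>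
           Cmp B (psnd (psnd y)) (FAr u f) = Cmp B (FAr w g') (psnd (psnd x))})
       (\<lambda>x. pair (Idn A (pfst x)) (Idn B' (pfst (psnd x))))
       (\<lambda>n m. pair (Cmp A (pfst n) (pfst m)) (Cmp B' (psnd n) (psnd m))))"


section \<open>Weak fundamental localizers\<close>

definition weakly_saturated :: "'u::universe cat_functor set \<Rightarrow> bool" where
  "weakly_saturated W \<longleftrightarrow>
     (\<forall>A. small_category A \<longrightarrow> id_functor A \<in> W) \<and>
     (\<forall>F G. is_functor F \<longrightarrow> is_functor G \<longrightarrow> Tgt F = Src G \<longrightarrow>
        (F \<in> W \<and> G \<in> W \<longrightarrow> G \<circ>\<^sub>F F \<in> W) \<and>
        (F \<in> W \<and> G \<circ>\<^sub>F F \<in> W \<longrightarrow> G \<in> W) \<and>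
        (G \<in> W \<and> G \<circ>\<^sub>F F \<in> W \<longrightarrow> F \<in> W)) \<and>
     (\<forall>i r. is_functor i \<longrightarrow> is_functor r \<longrightarrow> Tgt i = Src r \<longrightarrow> Tgt r = Src i \<longrightarrow>
        r \<circ>\<^sub>F i = id_functor (Src i) \<longrightarrow> i \<circ>\<^sub>F r \<in> W \<longrightarrow> r \<in> W)"

definition weak_fundamental_localizer :: "'u::universe cat_functor set \<Rightarrow> bool" where
  "weak_fundamental_localizer W \<longleftrightarrow>
     W \<subseteq> Collect is_functor \<and>
     weakly_saturated W \<and>
     (\<forall>A. small_category A \<longrightarrow> has_terminal_object A \<longrightarrow> to_e A \<in> W) \<and>
     (\<forall>u. is_functor u \<longrightarrow> (\<forall>b\<in>Ob (Tgt u). over_functor u b \<in> W) \<longrightarrow> u \<in> W)"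

definition aspherical :: "'u::universe cat_functor set \<Rightarrow> 'u cat \<Rightarrow> bool" where
  "aspherical W A \<longleftrightarrow> small_category A \<and> to_e A \<in> W"

definition coaspherical :: "'u::universe cat_functor set \<Rightarrow> 'u cat_functor \<Rightarrow> bool" where
  "coaspherical W u \<longleftrightarrow> is_functor u \<and> (\<forall>b\<in>Ob (Tgt u). under_functor u b \<in> W)"


section \<open>Squares\<close>

text \<open>
  A square has top \<open>v : A' \<rightarrow> A\<close>, bottom \<open>w : B' \<rightarrow> B\<close>, left \<open>u' : A' \<rightarrow> B'\<close>, right
  \<open>u : A \<rightarrow> B\<close>, and a 2-cell \<open>uv \<rightarrow> wu'\<close> given by its components.
\<close>

record 'u square =
  Top :: "'u cat_functor"
  Bottom :: "'u cat_functor"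
  Left :: "'u cat_functor"
  Right :: "'u cat_functor"
  Cell :: "'u \<Rightarrow> 'u"

definition is_square :: "'u::universe square \<Rightarrow> bool" where
  "is_square D \<longleftrightarrow> (let v = Top D; w = Bottom D; u' = Left D; u = Right D; \<alpha> = Cell D in
     is_functor v \<and> is_functor w \<and> is_functor u' \<and> is_functor u \<and>
     Src u' = Src v \<and> Src u = Tgt v \<and> Tgt u' = Src w \<and> Tgt u = Tgt w \<and>
     \<alpha> \<in> extensional (Ob (Src v)) \<and>
     (\<forall>a'\<in>Ob (Src v). \<alpha> a' \<in> hom (Tgt u) (FOb u (FOb v a')) (FOb w (FOb u' a'))) \<and>
     (\<forall>f'\<in>Ar (Src v).
        Cmp (Tgt u) (\<alpha> (Cod (Src v) f')) (FAr u (FAr v f')) =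
        Cmp (Tgt u) (FAr w (FAr u' f')) (\<alpha> (Dom (Src v) f'))))"

definition commutative_square :: "'u::universe square \<Rightarrow> bool" where
  "commutative_square D \<longleftrightarrow> is_square D \<and>
     Right D \<circ>\<^sub>F Top D = Bottom D \<circ>\<^sub>F Left D \<and>
     (\<forall>a'\<in>Ob (Src (Top D)). Cell D a' = Idn (Tgt (Right D)) (FOb (Right D) (FOb (Top D) a')))"

definition comma_functor :: "'u::universe square \<Rightarrow> 'u cat_functor" where
  "comma_functor D =
     (let fo = (\<lambda>a'. pair (FOb (Top D) a') (pair (FOb (Left D) a') (Cell D a')));
          A' = Src (Top D)
      in mk_functor A' (comma_cat (Right D) (Bottom D)) fo
           (\<lambda>f'. pair (pair (fo (Dom A' f')) (fo (Cod A' f')))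
                   (pair (FAr (Top D) f') (FAr (Left D) f'))))"

definition comma_square :: "'u::universe square \<Rightarrow> bool" where
  "comma_square D \<longleftrightarrow> is_square D \<and> is_iso_functor (comma_functor D)"

definition iso_squares :: "'u::universe square \<Rightarrow> 'u square \<Rightarrow> bool" where
  "iso_squares D E \<longleftrightarrow> is_square D \<and> is_square E \<and>
     (\<exists>iA iB iA' iB'.
        is_iso_functor iA \<and> is_iso_functor iB \<and> is_iso_functor iA' \<and> is_iso_functor iB' \<and>
        Src iA = Src (Right D) \<and> Tgt iA = Src (Right E) \<and>
        Src iB = Tgt (Right D) \<and> Tgt iB = Tgt (Right E) \<and>
        Src iA' = Src (Left D) \<and> Tgt iA' = Src (Left E) \<and>
        Src iB' = Tgt (Left D) \<and> Tgt iB' = Tgt (Left E) \<and>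
        iA \<circ>\<^sub>F Top D = Top E \<circ>\<^sub>F iA' \<and>
        iB \<circ>\<^sub>F Bottom D = Bottom E \<circ>\<^sub>F iB' \<and>
        iB' \<circ>\<^sub>F Left D = Left E \<circ>\<^sub>F iA' \<and>
        iB \<circ>\<^sub>F Right D = Right E \<circ>\<^sub>F iA \<and>
        (\<forall>a'\<in>Ob (Src (Left D)). FAr iB (Cell D a') = Cell E (FOb iA' a')))"

text \<open>
  The category \<open>A'\<close> indexed by \<open>(a, b', g)\<close>; an object \<open>(a', f, g')\<close> is encoded as
  \<open>pair a' (pair f g')\<close>.
\<close>

definition exact_cat :: "'u::universe square \<Rightarrow> 'u \<Rightarrow> 'u \<Rightarrow> 'u \<Rightarrow> 'u cat" where
  "exact_cat D a b' g =
     (let v = Top D; w = Bottom D; u' = Left D; u = Right D; \<alpha> = Cell D;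
          A' = Src v; A = Src u; B' = Src w; B = Tgt u
      in hom_cat
           {pair a' (pair f g') | a' f g'.
              a' \<in> Ob A' \<and> f \<in> hom A a (FOb v a') \<and> g' \<in> hom B' (FOb u' a') b' \<and>
              Cmp B (FAr w g') (Cmp B (\<alpha> a') (FAr u f)) = g}
           (\<lambda>x y. {f' \<in> hom A' (pfst x) (pfst y).
              Cmp A (FAr v f') (pfst (psnd x)) = pfst (psnd y) \<and>
              Cmp B' (psnd (psnd y)) (FAr u' f') = psnd (psnd x)})
           (\<lambda>x. Idn A' (pfst x)) (Cmp A'))"

definition exact_square :: "'u::universe cat_functor set \<Rightarrow> 'u square \<Rightarrow> bool" where
  "exact_square W D \<longleftrightarrow> is_square D \<and>
     (\<forall>a\<in>Ob (Src (Right D)). \<forall>b'\<in>Ob (Src (Bottom D)).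
        \<forall>g\<in>hom (Tgt (Right D)) (FOb (Right D) a) (FOb (Bottom D) b').
          aspherical W (exact_cat D a b' g))"

definition hcomp :: "'u::universe square \<Rightarrow> 'u square \<Rightarrow> 'u square" (infixr \<open>\<circ>\<^sub>h\<close> 70) where
  "D \<circ>\<^sub>h D' =
     \<lparr>Top = Top D \<circ>\<^sub>F Top D', Bottom = Bottom D \<circ>\<^sub>F Bottom D', Left = Left D', Right = Right D,
      Cell = (\<lambda>a\<in>Ob (Src (Top D')).
        Cmp (Tgt (Right D)) (FAr (Bottom D) (Cell D' a)) (Cell D (FOb (Top D') a)))\<rparr>"

text \<open>The comma square with right side \<open>u : A \<rightarrow> B\<close> and bottom side an object \<open>b\<close> of \<open>B\<close>.\<close>

definition over_square :: "'u::universe cat_functor \<Rightarrow> 'u \<Rightarrow> 'u square" where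
  "over_square u b =
     \<lparr>Top = mk_functor (over_cat u b) (Src u) pfst psnd, Bottom = point (Tgt u) b,
      Left = to_e (over_cat u b), Right = u, Cell = restrict psnd (Ob (over_cat u b))\<rparr>"


section \<open>Classes of squares\<close>

definition iso_closed :: "'u::universe square set \<Rightarrow> bool" where
  "iso_closed Q \<longleftrightarrow> (\<forall>D E. D \<in> Q \<longrightarrow> iso_squares D E \<longrightarrow> E \<in> Q)"

definition hcomp_stable :: "'u::universe square set \<Rightarrow> bool" where
  "hcomp_stable Q \<longleftrightarrow> (\<forall>D\<in>Q. \<forall>D'\<in>Q. Right D' = Left D \<longrightarrow> D \<circ>\<^sub>h D' \<in> Q)"

definition local_descent :: "'u::universe square set \<Rightarrow> bool" where
  "local_descent Q \<longleftrightarrow>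
     (\<forall>D. is_square D \<longrightarrow>
        (\<forall>b'\<in>Ob (Tgt (Left D)). D \<circ>\<^sub>h over_square (Left D) b' \<in> Q) \<longrightarrow> D \<in> Q)"

definition contains_comma_squares :: "'u::universe square set \<Rightarrow> bool" where
  "contains_comma_squares Q \<longleftrightarrow> (\<forall>D. comma_square D \<longrightarrow> D \<in> Q)"

definition contains_coaspherical_squares ::
    "'u::universe cat_functor set \<Rightarrow> 'u square set \<Rightarrow> bool" where
  "contains_coaspherical_squares W Q \<longleftrightarrow>
     (\<forall>D. commutative_square D \<longrightarrow> coaspherical W (Top D) \<longrightarrow>
        Left D = to_e (Src (Top D)) \<longrightarrow> Right D = to_e (Tgt (Top D)) \<longrightarrow>
        Bottom D = id_functor e_cat \<longrightarrow> D \<in> Q)"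

definition admissible_class ::
    "'u::universe cat_functor set \<Rightarrow> 'u square set \<Rightarrow> bool" where
  "admissible_class W Q \<longleftrightarrow>
     Q \<subseteq> Collect is_square \<and> iso_closed Q \<and> hcomp_stable Q \<and> local_descent Q \<and>
     contains_comma_squares Q \<and> contains_coaspherical_squares W Q"

end

theory Submission
  imports Defs
begin

text \<open>
  The axioms on a weak fundamental localizer concern slices \<open>A/b\<close>, whereas exactness is about
  coslices.  They are related by the category of triples \<open>(b, a, g : b \<rightarrow> u(a))\<close>, contravariant in
  \<open>b\<close>: it is opfibred over \<open>A\<close> with aspherical fibres and over the opposite of \<open>B\<close> with fibres
  \<open>b\A\<close>.  So if the latter are aspherical, \<open>A\<close> is aspherical if and only if the opposite of
  \<open>B\<close> is, and comparing with the identity of \<open>B\<close>, if and only if \<open>B\<close> is.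

  For a composite of \<open>D\<close> and \<open>D'\<close>, the indexing category at \<open>(a, b'', g)\<close> maps to that of \<open>D\<close> at
  \<open>(a, w'(b''), g)\<close> with the indexing categories of \<open>D'\<close> as coslices.  Hence composing with an
  exact \<open>D'\<close> does not change asphericity, which gives stability and, with \<open>D'\<close> a slice square,
  local descent.  In the indexing category of a comma square the objects whose last component is an
  identity form a reflective subcategory with an initial object.

  For minimality, local descent reduces to squares with \<open>B' = e\<close>.  Such a square is the composite
  of the slice square of \<open>u\<close> over \<open>w(e)\<close> with the square on the induced functor from \<open>A'\<close> into the
  slice, and its exactness says precisely that this functor is coaspherical.
\<close>

text \<open>The axioms speak of slices and terminal objects, and duality of \<open>W\<close> is not
  among them; initial objects, right adjoints and coslices therefore each need an argument of their
  own. The fibre of an opfibration is reflective in the corresponding slice, hence aspherical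
  together with it; for a fibration the comparison is with coslices instead. This dictates the
  variance of the triples (b, a, g): with b covariant they would be fibred over B, and the fibres
  could be compared only with further coslices, which is circular. Reversing b keeps the fibres and
  makes the projection an opfibration, at the price of an opposite base. Membership in
  \<open>W\<close> is translated early into equivalences between asphericity of source and target,
  by two of three in triangles over e. After that, only pointwise adjunctions, full and faithful
  functors that are surjective on objects, and the slice and coslice criteria are used to compare
  categories, so most isomorphisms of indexing categories need no inverse functor.\<close>

lemma pair_eq_iff [simp]: "pair x y = pair x' y' \<longleftrightarrow> x = x' \<and> y = (y'::'u::universe)"
  using pair_inject by blast

lemma pfst_pair [simp]: "pfst (pair x y) = (x::'u::universe)"
  unfolding pfst_def by (rule the_equality) auto

lemma psnd_pair [simp]: "psnd (pair x y) = (y::'u::universe)"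
  unfolding psnd_def by (rule the_equality) auto

text \<open>Replacement is obtained as a union of singletons, and products then as unions of images:
  the universe has no separate clause for either.\<close>

lemma small_image: "small X \<Longrightarrow> small (f ` X)" for f :: "'u \<Rightarrow> 'u::universe"
  using small_UN[of X "\<lambda>x. {f x}"] by (simp add: small_singleton UNION_singleton_eq_range)

lemma small_pairs:
  fixes X Y :: "'u::universe set"
  assumes "small X" "small Y"
  shows "small {pair x y | x y. x \<in> X \<and> y \<in> Y}"
proof -
  have "small (\<Union>x\<in>X. pair x ` Y)"
    using assms by (intro small_UN small_image)
  then show ?thesis
    by (rule small_subset) auto
qed

section \<open>Composition in a small category in terms of hom-sets\<close>

lemma homI: "f \<in> Ar C \<Longrightarrow> f \<in> hom C (Dom C f) (Cod C f)"
  by (simp add: hom_def)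

lemma hom_Ar: "f \<in> hom C a b \<Longrightarrow> f \<in> Ar C"
  by (simp add: hom_def)

context
  fixes C :: "'u::universe cat"
  assumes C: "small_category C"
begin

lemma hom_Ob:
  assumes "f \<in> hom C a b" shows "a \<in> Ob C" "b \<in> Ob C"
  using C assms unfolding small_category_def hom_def by auto

lemma Dom_Ob [simp]: "f \<in> Ar C \<Longrightarrow> Dom C f \<in> Ob C"
  and Cod_Ob [simp]: "f \<in> Ar C \<Longrightarrow> Cod C f \<in> Ob C"
  using C unfolding small_category_def by auto

lemma Idn_hom [simp]: "a \<in> Ob C \<Longrightarrow> Idn C a \<in> hom C a a"
  using C unfolding small_category_def by auto

lemma Cmp_hom: "f \<in> hom C a b \<Longrightarrow> g \<in> hom C b c \<Longrightarrow> Cmp C g f \<in> hom C a c"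
  using C unfolding small_category_def hom_def by auto

lemma Cmp_Idn_right: "f \<in> hom C a b \<Longrightarrow> Cmp C f (Idn C a) = f"
  using C unfolding small_category_def hom_def by auto

lemma Cmp_Idn_left: "f \<in> hom C a b \<Longrightarrow> Cmp C (Idn C b) f = f"
  using C unfolding small_category_def hom_def by auto

lemma Cmp_assoc:
  "f \<in> hom C a b \<Longrightarrow> g \<in> hom C b c \<Longrightarrow> h \<in> hom C c d \<Longrightarrow>
    Cmp C h (Cmp C g f) = Cmp C (Cmp C h g) f"
  using C unfolding small_category_def hom_def by simp

lemma small_Ob: "small (Ob C)" and small_Ar: "small (Ar C)"
  using C unfolding small_category_def by auto

end

section \<open>Categories given by tagged hom-sets\<close>

lemma Ob_hom_cat [simp]: "Ob (hom_cat X H i c) = X"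
  by (simp add: hom_cat_def Let_def)

lemma Ar_hom_cat:
  "Ar (hom_cat X H i c) = {pair (pair x y) f | x y f. x \<in> X \<and> y \<in> X \<and> f \<in> H x y}"
  by (simp add: hom_cat_def Let_def)

lemma Dom_hom_cat [simp]:
  "x \<in> X \<Longrightarrow> y \<in> X \<Longrightarrow> f \<in> H x y \<Longrightarrow> Dom (hom_cat X H i c) (pair (pair x y) f) = x"
  and Cod_hom_cat [simp]:
  "x \<in> X \<Longrightarrow> y \<in> X \<Longrightarrow> f \<in> H x y \<Longrightarrow> Cod (hom_cat X H i c) (pair (pair x y) f) = y"
  by (simp_all add: hom_cat_def Let_def)

lemma hom_hom_cat:
  "hom (hom_cat X H i c) x y = {m. x \<in> X \<and> y \<in> X \<and> (\<exists>f\<in>H x y. m = pair (pair x y) f)}"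
  by (auto simp: hom_def hom_cat_def Let_def)

lemma Idn_hom_cat [simp]: "x \<in> X \<Longrightarrow> Idn (hom_cat X H i c) x = pair (pair x x) (i x)"
  by (simp add: hom_cat_def Let_def)

lemma Cmp_hom_cat [simp]:
  assumes "x \<in> X" "y \<in> X" "z \<in> X" "f \<in> H x y" "g \<in> H y z"
  shows "Cmp (hom_cat X H i c) (pair (pair y z) g) (pair (pair x y) f) = pair (pair x z) (c g f)"
  using assms by (simp add: hom_cat_def Let_def)

text \<open>The tags supply the endpoints, so \<open>M\<close> only has to bound the raw data: the
  arrows are pairs over \<open>X\<close>, \<open>X\<close> and \<open>M\<close>, and such pairs form
  a small set. The remaining hypotheses are the category laws for untagged data.\<close>

lemma hom_cat_small_category:
  fixes X :: "'u::universe set"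
  assumes X: "small X" and M: "small M"
    and H: "\<And>x y. x \<in> X \<Longrightarrow> y \<in> X \<Longrightarrow> H x y \<subseteq> M"
    and i: "\<And>x. x \<in> X \<Longrightarrow> i x \<in> H x x"
    and c: "\<And>x y z f g. x \<in> X \<Longrightarrow> y \<in> X \<Longrightarrow> z \<in> X \<Longrightarrow> f \<in> H x y \<Longrightarrow> g \<in> H y z \<Longrightarrow> c g f \<in> H x z"
    and r: "\<And>x y f. x \<in> X \<Longrightarrow> y \<in> X \<Longrightarrow> f \<in> H x y \<Longrightarrow> c f (i x) = f"
    and l: "\<And>x y f. x \<in> X \<Longrightarrow> y \<in> X \<Longrightarrow> f \<in> H x y \<Longrightarrow> c (i y) f = f"
    and a: "\<And>x y z t f g h. x \<in> X \<Longrightarrow> y \<in> X \<Longrightarrow> z \<in> X \<Longrightarrow> t \<in> X \<Longrightarrow>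
      f \<in> H x y \<Longrightarrow> g \<in> H y z \<Longrightarrow> h \<in> H z t \<Longrightarrow> c h (c g f) = c (c h g) f"
  shows "small_category (hom_cat X H i c)"
proof -
  let ?C = "hom_cat X H i c"
  have "small {pair p f | p f. p \<in> {pair x y | x y. x \<in> X \<and> y \<in> X} \<and> f \<in> M}"
    by (intro small_pairs X M)
  then have sAr: "small (Ar ?C)"
    unfolding Ar_hom_cat by (rule small_subset) (blast dest: subsetD[OF H])
  have ext: "Dom ?C \<in> extensional (Ar ?C)" "Cod ?C \<in> extensional (Ar ?C)"
      "Idn ?C \<in> extensional (Ob ?C)"
    by (simp_all add: hom_cat_def Let_def)
  have cu: "Cmp ?C g f = undefined"
    if "\<not> (f \<in> Ar ?C \<and> g \<in> Ar ?C \<and> Cod ?C f = Dom ?C g)" for g f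
    using that by (auto simp: hom_cat_def Let_def)
  have ArE: "\<exists>x y h. x \<in> X \<and> y \<in> X \<and> h \<in> H x y \<and> f = pair (pair x y) h" if "f \<in> Ar ?C" for f
    using that by (auto simp: Ar_hom_cat)
  show ?thesis
    unfolding small_category_def
  proof (intro conjI ballI allI impI)
    show "Dom ?C \<in> Ar ?C \<rightarrow>\<^sub>E Ob ?C" "Cod ?C \<in> Ar ?C \<rightarrow>\<^sub>E Ob ?C"
      using ext by (auto simp: PiE_def Ar_hom_cat)
    show "Idn ?C \<in> Ob ?C \<rightarrow>\<^sub>E Ar ?C"
      using ext i by (auto simp: PiE_def Ar_hom_cat)
    show "Idn ?C a \<in> hom ?C a a" if "a \<in> Ob ?C" for a
      using that i by (auto simp: hom_hom_cat)
  next
    fix f g assume f: "f \<in> Ar ?C" and g: "g \<in> Ar ?C" and fg: "Cod ?C f = Dom ?C g"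
    from ArE[OF f] obtain x y h where 1: "x \<in> X" "y \<in> X" "h \<in> H x y" "f = pair (pair x y) h"
      by blast
    from ArE[OF g] obtain y' z k where
      2: "y' \<in> X" "z \<in> X" "k \<in> H y' z" "g = pair (pair y' z) k"
      by blast
    with 1 fg have [simp]: "y' = y" by simp
    show "Cmp ?C g f \<in> hom ?C (Dom ?C f) (Cod ?C g)"
      using 1 2 c[of x y z h k] by (simp add: hom_hom_cat)
    fix h' assume h: "h' \<in> Ar ?C" and gh: "Cod ?C g = Dom ?C h'"
    from ArE[OF h] obtain z' t l where
      3: "z' \<in> X" "t \<in> X" "l \<in> H z' t" "h' = pair (pair z' t) l"
      by blast
    with 2 gh have [simp]: "z' = z" by simp
    show "Cmp ?C h' (Cmp ?C g f) = Cmp ?C (Cmp ?C h' g) f"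
      using 1 2 3 a[of x y z t h k l] c[of x y z h k] c[of y z t k l] by simp
  next
    fix f assume f: "f \<in> Ar ?C"
    from ArE[OF f] obtain x y h where *: "x \<in> X" "y \<in> X" "h \<in> H x y" "f = pair (pair x y) h"
      by blast
    show "Cmp ?C f (Idn ?C (Dom ?C f)) = f"
      using * i[of x] r[of x y h] by simp
    show "Cmp ?C (Idn ?C (Cod ?C f)) f = f"
      using * i[of y] l[of x y h] by simp
  qed (use X sAr cu in auto)
qed

text \<open>Unit laws and associativity are inherited from \<open>C\<close>, leaving only closure of
  \<open>H\<close> under identities and composition. Slices, coslices, indexing categories and full
  subcategories have this shape, with \<open>p\<close> the object part of the forgetful functor;
  categories whose morphisms are pairs do not.\<close>

lemma hom_cat_over_small_category:
  fixes X :: "'u::universe set"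
  assumes C: "small_category C" and X: "small X"
    and p: "\<And>x. x \<in> X \<Longrightarrow> p x \<in> Ob C"
    and H: "\<And>x y. x \<in> X \<Longrightarrow> y \<in> X \<Longrightarrow> H x y \<subseteq> hom C (p x) (p y)"
    and i: "\<And>x. x \<in> X \<Longrightarrow> Idn C (p x) \<in> H x x"
    and c: "\<And>x y z f g. x \<in> X \<Longrightarrow> y \<in> X \<Longrightarrow> z \<in> X \<Longrightarrow> f \<in> H x y \<Longrightarrow> g \<in> H y z \<Longrightarrow>
      Cmp C g f \<in> H x z"
  shows "small_category (hom_cat X H (\<lambda>x. Idn C (p x)) (Cmp C))"
proof (rule hom_cat_small_category[OF X small_Ar[OF C]])
  show "H x y \<subseteq> Ar C" if "x \<in> X" "y \<in> X" for x y
    using H[OF that] by (auto simp: hom_def)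
  show "Cmp C f (Idn C (p x)) = f" if "x \<in> X" "y \<in> X" "f \<in> H x y" for x y f
    using H that by (intro Cmp_Idn_right[OF C]) auto
  show "Cmp C (Idn C (p y)) f = f" if "x \<in> X" "y \<in> X" "f \<in> H x y" for x y f
    using H that by (intro Cmp_Idn_left[OF C]) auto
  show "Cmp C h (Cmp C g f) = Cmp C (Cmp C h g) f"
    if "x \<in> X" "y \<in> X" "z \<in> X" "t \<in> X" "f \<in> H x y" "g \<in> H y z" "h \<in> H z t"
    for x y z t f g h
    using H[OF that(1,2)] H[OF that(2,3)] H[OF that(3,4)] that
    by (intro Cmp_assoc[OF C, of f "p x" "p y" g "p z" h "p t"]) auto
qed (use i c in auto)

section \<open>Functors and their composition\<close>

lemma mk_functor_sel [simp]:
  "Src (mk_functor A B fo fa) = A" "Tgt (mk_functor A B fo fa) = B"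
  "a \<in> Ob A \<Longrightarrow> FOb (mk_functor A B fo fa) a = fo a"
  "f \<in> Ar A \<Longrightarrow> FAr (mk_functor A B fo fa) f = fa f"
  by (simp_all add: mk_functor_def)

lemma FAr_mk_hom [simp]: "f \<in> hom A a b \<Longrightarrow> FAr (mk_functor A B fo fa) f = fa f"
  by (simp add: hom_Ar)

text \<open>\<open>mk_functor\<close> restricts both maps, which settles the extensionality clauses
  of \<open>is_functor\<close>; what remains is the behaviour on hom-sets.\<close>

lemma is_functor_mkI:
  fixes A :: "'u::universe cat"
  assumes A: "small_category A" and B: "small_category B"
    and fo: "\<And>a. a \<in> Ob A \<Longrightarrow> fo a \<in> Ob B"
    and fa: "\<And>a b f. a \<in> Ob A \<Longrightarrow> b \<in> Ob A \<Longrightarrow> f \<in> hom A a b \<Longrightarrow> fa f \<in> hom B (fo a) (fo b)"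
    and i: "\<And>a. a \<in> Ob A \<Longrightarrow> fa (Idn A a) = Idn B (fo a)"
    and c: "\<And>a b c f g. a \<in> Ob A \<Longrightarrow> b \<in> Ob A \<Longrightarrow> c \<in> Ob A \<Longrightarrow> f \<in> hom A a b \<Longrightarrow> g \<in> hom A b c \<Longrightarrow>
      fa (Cmp A g f) = Cmp B (fa g) (fa f)"
  shows "is_functor (mk_functor A B fo fa)"
proof -
  have fa': "fa f \<in> hom B (fo (Dom A f)) (fo (Cod A f))" if "f \<in> Ar A" for f
    using that A by (intro fa) (auto simp: homI)
  have c': "fa (Cmp A g f) = Cmp B (fa g) (fa f)" "Cmp A g f \<in> Ar A"
    if "f \<in> Ar A" "g \<in> Ar A" "Cod A f = Dom A g" for f g
  proof -
    have *: "f \<in> hom A (Dom A f) (Cod A f)" "g \<in> hom A (Cod A f) (Cod A g)"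
      using that by (auto simp: hom_def)
    show "fa (Cmp A g f) = Cmp B (fa g) (fa f)"
      by (rule c[OF _ _ _ *]) (use A that in auto)
    show "Cmp A g f \<in> Ar A"
      using Cmp_hom[OF A *] by (rule hom_Ar)
  qed
  show ?thesis
    unfolding is_functor_def
    using A B fo fa' hom_Ar[OF fa'] i c' hom_Ar[OF Idn_hom[OF A]]
    by (auto simp: mk_functor_def PiE_def)
qed

context
  fixes F :: "'u::universe cat_functor"
  assumes F: "is_functor F"
begin

lemma Src_small [simp]: "small_category (Src F)" and Tgt_small [simp]: "small_category (Tgt F)"
  using F by (auto simp: is_functor_def)

lemma FOb_Ob [simp]: "a \<in> Ob (Src F) \<Longrightarrow> FOb F a \<in> Ob (Tgt F)"
  using F by (auto simp: is_functor_def)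

lemma FAr_hom: "f \<in> hom (Src F) a b \<Longrightarrow> FAr F f \<in> hom (Tgt F) (FOb F a) (FOb F b)"
  using F unfolding is_functor_def hom_def by blast

lemma FAr_Idn: "a \<in> Ob (Src F) \<Longrightarrow> FAr F (Idn (Src F) a) = Idn (Tgt F) (FOb F a)"
  using F by (auto simp: is_functor_def)

lemma FAr_Cmp: "f \<in> hom (Src F) a b \<Longrightarrow> g \<in> hom (Src F) b c \<Longrightarrow>
    FAr F (Cmp (Src F) g f) = Cmp (Tgt F) (FAr F g) (FAr F f)"
  using F by (auto simp: is_functor_def hom_def)

lemma FOb_ext: "a \<notin> Ob (Src F) \<Longrightarrow> FOb F a = undefined"
  and FAr_ext: "f \<notin> Ar (Src F) \<Longrightarrow> FAr F f = undefined"
  using F unfolding is_functor_def by (auto intro: PiE_arb)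

end

text \<open>Both functors take the value \<open>undefined\<close> off their domains, so agreement on
  the source gives equality of records.\<close>

lemma functor_eqI:
  fixes F G :: "'u::universe cat_functor"
  assumes "is_functor F" "is_functor G" "Src F = Src G" "Tgt F = Tgt G"
    and o: "\<And>a. a \<in> Ob (Src G) \<Longrightarrow> FOb F a = FOb G a"
    and a: "\<And>f. f \<in> Ar (Src G) \<Longrightarrow> FAr F f = FAr G f"
  shows "F = G"
proof -
  have "FOb F = FOb G" "FAr F = FAr G"
    by (rule ext, metis assms FOb_ext, rule ext, metis assms FAr_ext)
  with assms show ?thesis by simp
qed

lemma comp_functor_sel [simp]:
  "Src (G \<circ>\<^sub>F F) = Src F" "Tgt (G \<circ>\<^sub>F F) = Tgt G"
  "a \<in> Ob (Src F) \<Longrightarrow> FOb (G \<circ>\<^sub>F F) a = FOb G (FOb F a)"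
  "f \<in> Ar (Src F) \<Longrightarrow> FAr (G \<circ>\<^sub>F F) f = FAr G (FAr F f)"
  by (simp_all add: comp_functor_def)

lemma comp_is_functor:
  fixes F G :: "'u::universe cat_functor"
  assumes "is_functor F" "is_functor G" "Tgt F = Src G"
  shows "is_functor (G \<circ>\<^sub>F F)"
  unfolding comp_functor_def
proof (rule is_functor_mkI)
  fix a b c f g
  assume fg: "f \<in> hom (Src F) a b" "g \<in> hom (Src F) b c"
  have *: "FAr F f \<in> hom (Src G) (FOb F a) (FOb F b)" "FAr F g \<in> hom (Src G) (FOb F b) (FOb F c)"
    using fg FAr_hom[OF assms(1)] assms(3) by auto
  show "FAr G (FAr F (Cmp (Src F) g f)) = Cmp (Tgt G) (FAr G (FAr F g)) (FAr G (FAr F f))"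
    using FAr_Cmp[OF assms(1) fg] FAr_Cmp[OF assms(2) *] assms(3) by simp
next
  fix a b f assume "f \<in> hom (Src F) a b"
  then show "FAr G (FAr F f) \<in> hom (Tgt G) (FOb G (FOb F a)) (FOb G (FOb F b))"
    using FAr_hom[OF assms(1)] assms(3) by (intro FAr_hom[OF assms(2)]) auto
next
  fix a assume a: "a \<in> Ob (Src F)"
  then have Fa: "FOb F a \<in> Ob (Src G)"
    using FOb_Ob[OF assms(1)] assms(3) by simp
  then show "FOb G (FOb F a) \<in> Ob (Tgt G)"
    using assms(2) by simp
  show "FAr G (FAr F (Idn (Src F) a)) = Idn (Tgt G) (FOb G (FOb F a))"
    using FAr_Idn[OF assms(1) a] FAr_Idn[OF assms(2) Fa] assms(3) by simp
qed (use assms in auto)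

lemma Cmp_hom_cat_hom:
  assumes "pair (pair x y) f \<in> hom (hom_cat X H i c) x y"
    and "pair (pair y z) g \<in> hom (hom_cat X H i c) y z"
  shows "Cmp (hom_cat X H i c) (pair (pair y z) g) (pair (pair x y) f) = pair (pair x z) (c g f)"
  using assms by (intro Cmp_hom_cat) (auto simp: hom_hom_cat)

text \<open>Between fixed objects of a \<open>hom_cat\<close> all arrows carry the same tag
  \<open>p\<close>, so universal properties can be checked on the untagged data.\<close>

lemma ex1_pair_conv:
  fixes p :: "'u::universe"
  shows "(\<exists>!m. \<exists>f. m = pair p f \<and> Q f) \<longleftrightarrow> (\<exists>!f. Q f)"
proof
  assume "\<exists>!m. \<exists>f. m = pair p f \<and> Q f"
  then obtain m where m: "\<exists>f. m = pair p f \<and> Q f" "\<And>n. \<exists>f. n = pair p f \<and> Q f \<Longrightarrow> n = m"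
    by (elim ex1E) blast
  then obtain f where f: "m = pair p f" "Q f" by blast
  have "g = f" if "Q g" for g
    using m(2)[of "pair p g"] that f by simp
  with f show "\<exists>!f. Q f" by blast
next
  assume "\<exists>!f. Q f"
  then obtain f where f: "Q f" "\<And>g. Q g \<Longrightarrow> g = f" by (elim ex1E) blast
  show "\<exists>!m. \<exists>f. m = pair p f \<and> Q f"
    by (rule ex1I[of _ "pair p f"]) (use f in blast)+
qed

lemma hom_map_pair [simp]:
  "hom_map fo h (pair (pair x y) f) = pair (pair (fo x) (fo y)) (h f)"
  by (simp add: hom_map_def)

section \<open>The terminal category and identity functors\<close>

lemma hom_e_cat [simp]: "hom e_cat a b = (if a = pt \<and> b = pt then {pt} else {})"
  by (auto simp: hom_def e_cat_def)

lemma e_cat_sel [simp]: "Ob e_cat = {pt}" "Ar e_cat = {pt}" "Idn e_cat pt = pt" "Cmp e_cat pt pt = pt"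
    "Dom e_cat pt = pt" "Cod e_cat pt = pt"
  by (auto simp: e_cat_def)

lemma small_category_e_cat [simp]: "small_category (e_cat :: 'u::universe cat)"
  unfolding small_category_def by (auto simp: e_cat_def hom_def small_singleton)

lemma to_e_sel [simp]: "Src (to_e A) = A" "Tgt (to_e A) = e_cat"
    "a \<in> Ob A \<Longrightarrow> FOb (to_e A) a = pt" "f \<in> Ar A \<Longrightarrow> FAr (to_e A) f = pt"
    "f \<in> hom A x y \<Longrightarrow> FAr (to_e A) f = pt"
  by (simp_all add: to_e_def)

lemma to_e_is_functor [simp]: "small_category A \<Longrightarrow> is_functor (to_e A)"
  unfolding to_e_def by (rule is_functor_mkI) auto

text \<open>\<open>pt\<close> is the only value open to an object or an arrow. Equations between
  composites ending in \<open>e_cat\<close> thereby reduce to a comparison of sources.\<close>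

lemma to_e_unique:
  assumes "is_functor F" "Tgt F = e_cat"
  shows "F = to_e (Src F)"
proof (rule functor_eqI)
  show "FOb F a = FOb (to_e (Src F)) a" if "a \<in> Ob (Src (to_e (Src F)))" for a
    using that FOb_Ob[OF assms(1)] assms(2) by simp
  show "FAr F f = FAr (to_e (Src F)) f" if "f \<in> Ar (Src (to_e (Src F)))" for f
    using that hom_Ar[OF FAr_hom[OF assms(1) homI]] assms(2) by simp
qed (use assms in auto)

lemma id_functor_sel [simp]: "Src (id_functor A) = A" "Tgt (id_functor A) = A"
    "a \<in> Ob A \<Longrightarrow> FOb (id_functor A) a = a" "f \<in> Ar A \<Longrightarrow> FAr (id_functor A) f = f"
    "f \<in> hom A x y \<Longrightarrow> FAr (id_functor A) f = f"
  by (simp_all add: id_functor_def)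

lemma id_is_functor [simp]: "small_category A \<Longrightarrow> is_functor (id_functor A)"
  unfolding id_functor_def by (rule is_functor_mkI) auto

section \<open>Slices\<close>

lemma Ob_over_cat:
  "Ob (over_cat u b) = {pair a g | a g. a \<in> Ob (Src u) \<and> g \<in> hom (Tgt u) (FOb u a) b}"
  by (simp add: over_cat_def Let_def)

lemma hom_over_cat:
  "hom (over_cat u b) x y = {m. x \<in> Ob (over_cat u b) \<and> y \<in> Ob (over_cat u b) \<and>
    (\<exists>f. m = pair (pair x y) f \<and> f \<in> hom (Src u) (pfst x) (pfst y) \<and>
      Cmp (Tgt u) (psnd y) (FAr u f) = psnd x)}"
  by (auto simp: over_cat_def Let_def hom_hom_cat)

lemma Idn_over_cat:
  "x \<in> Ob (over_cat u b) \<Longrightarrow> Idn (over_cat u b) x = pair (pair x x) (Idn (Src u) (pfst x))"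
  by (simp add: over_cat_def Let_def)

lemma Cmp_over_cat:
  "pair (pair x y) f \<in> hom (over_cat u b) x y \<Longrightarrow> pair (pair y z) g \<in> hom (over_cat u b) y z \<Longrightarrow>
    Cmp (over_cat u b) (pair (pair y z) g) (pair (pair x y) f) = pair (pair x z) (Cmp (Src u) g f)"
  unfolding over_cat_def Let_def by (rule Cmp_hom_cat_hom)

lemma small_category_over_cat [simp]:
  assumes u: "is_functor u"
  shows "small_category (over_cat u b)"
  unfolding over_cat_def Let_def
proof (rule hom_cat_over_small_category)
  let ?X = "{pair a g | a g. a \<in> Ob (Src u) \<and> g \<in> hom (Tgt u) (FOb u a) b}"
  show "small ?X"
    by (rule small_subset[OF small_pairs[OF small_Ob[of "Src u"] small_Ar[of "Tgt u"]]])
      (use u in \<open>auto simp: hom_def\<close>)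
  fix x y z f g
  assume x: "x \<in> ?X" and y: "y \<in> ?X" and z: "z \<in> ?X"
  from x have x2: "psnd x \<in> hom (Tgt u) (FOb u (pfst x)) b" "pfst x \<in> Ob (Src u)" by auto
  show "Idn (Src u) (pfst x) \<in>
      {f \<in> hom (Src u) (pfst x) (pfst x). Cmp (Tgt u) (psnd x) (FAr u f) = psnd x}"
    using x2 u by (simp add: FAr_Idn Cmp_Idn_right[OF Tgt_small[OF u]])
  assume "f \<in> {f \<in> hom (Src u) (pfst x) (pfst y). Cmp (Tgt u) (psnd y) (FAr u f) = psnd x}"
  then have f: "f \<in> hom (Src u) (pfst x) (pfst y)" "Cmp (Tgt u) (psnd y) (FAr u f) = psnd x" by auto
  assume "g \<in> {f \<in> hom (Src u) (pfst y) (pfst z). Cmp (Tgt u) (psnd z) (FAr u f) = psnd y}"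
  then have g: "g \<in> hom (Src u) (pfst y) (pfst z)" "Cmp (Tgt u) (psnd z) (FAr u g) = psnd y" by auto
  have z2: "psnd z \<in> hom (Tgt u) (FOb u (pfst z)) b" using z by auto
  show "Cmp (Src u) g f \<in>
      {f \<in> hom (Src u) (pfst x) (pfst z). Cmp (Tgt u) (psnd z) (FAr u f) = psnd x}"
    using f g FAr_Cmp[OF u f(1) g(1)] Cmp_hom[OF Src_small[OF u] f(1) g(1)]
      Cmp_assoc[OF Tgt_small[OF u] FAr_hom[OF u f(1)] FAr_hom[OF u g(1)] z2]
    by simp
qed (use u in auto)

lemma Ob_under_cat:
  "Ob (under_cat u b) = {pair a g | a g. a \<in> Ob (Src u) \<and> g \<in> hom (Tgt u) b (FOb u a)}"
  by (simp add: under_cat_def Let_def)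

lemma hom_under_cat:
  "hom (under_cat u b) x y = {m. x \<in> Ob (under_cat u b) \<and> y \<in> Ob (under_cat u b) \<and>
    (\<exists>f. m = pair (pair x y) f \<and> f \<in> hom (Src u) (pfst x) (pfst y) \<and>
      Cmp (Tgt u) (FAr u f) (psnd x) = psnd y)}"
  by (auto simp: under_cat_def Let_def hom_hom_cat)

lemma Idn_under_cat:
  "x \<in> Ob (under_cat u b) \<Longrightarrow> Idn (under_cat u b) x = pair (pair x x) (Idn (Src u) (pfst x))"
  by (simp add: under_cat_def Let_def)

lemma Cmp_under_cat:
  "pair (pair x y) f \<in> hom (under_cat u b) x y \<Longrightarrow> pair (pair y z) g \<in> hom (under_cat u b) y z \<Longrightarrow>
    Cmp (under_cat u b) (pair (pair y z) g) (pair (pair x y) f) = pair (pair x z) (Cmp (Src u) g f)"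
  unfolding under_cat_def Let_def by (rule Cmp_hom_cat_hom)

lemma small_category_under_cat [simp]:
  assumes u: "is_functor u"
  shows "small_category (under_cat u b)"
  unfolding under_cat_def Let_def
proof (rule hom_cat_over_small_category)
  let ?X = "{pair a g | a g. a \<in> Ob (Src u) \<and> g \<in> hom (Tgt u) b (FOb u a)}"
  show "small ?X"
    by (rule small_subset[OF small_pairs[OF small_Ob[of "Src u"] small_Ar[of "Tgt u"]]])
      (use u in \<open>auto simp: hom_def\<close>)
  fix x y z f g
  assume x: "x \<in> ?X" and y: "y \<in> ?X" and z: "z \<in> ?X"
  from x have x2: "psnd x \<in> hom (Tgt u) b (FOb u (pfst x))" "pfst x \<in> Ob (Src u)" by auto
  show "Idn (Src u) (pfst x) \<in>
      {f \<in> hom (Src u) (pfst x) (pfst x). Cmp (Tgt u) (FAr u f) (psnd x) = psnd x}"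
    using x2 u by (simp add: FAr_Idn Cmp_Idn_left[OF Tgt_small[OF u]])
  assume "f \<in> {f \<in> hom (Src u) (pfst x) (pfst y). Cmp (Tgt u) (FAr u f) (psnd x) = psnd y}"
  then have f: "f \<in> hom (Src u) (pfst x) (pfst y)" "Cmp (Tgt u) (FAr u f) (psnd x) = psnd y" by auto
  assume "g \<in> {f \<in> hom (Src u) (pfst y) (pfst z). Cmp (Tgt u) (FAr u f) (psnd y) = psnd z}"
  then have g: "g \<in> hom (Src u) (pfst y) (pfst z)" "Cmp (Tgt u) (FAr u g) (psnd y) = psnd z" by auto
  show "Cmp (Src u) g f \<in>
      {f \<in> hom (Src u) (pfst x) (pfst z). Cmp (Tgt u) (FAr u f) (psnd x) = psnd z}"
    using f g FAr_Cmp[OF u f(1) g(1)] Cmp_hom[OF Src_small[OF u] f(1) g(1)]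
      Cmp_assoc[OF Tgt_small[OF u] x2(1) FAr_hom[OF u f(1)] FAr_hom[OF u g(1)]]
    by simp
qed (use u in auto)

lemma over_functor_is_functor:
  assumes u: "is_functor u"
  shows "is_functor (over_functor u b)"
  unfolding over_functor_def Let_def
proof (rule is_functor_mkI)
  let ?fo = "\<lambda>x. pair (FOb u (pfst x)) (psnd x)" and ?B = "over_cat (id_functor (Tgt u)) b"
  show o: "?fo x \<in> Ob ?B" if "x \<in> Ob (over_cat u b)" for x
    using that u by (auto simp: Ob_over_cat)
  show h: "hom_map ?fo (FAr u) m \<in> hom ?B (?fo x) (?fo y)" if "m \<in> hom (over_cat u b) x y" for x y m
    using that u o[of x] o[of y] by (auto simp: hom_over_cat dest!: FAr_hom[OF u])
  show "hom_map ?fo (FAr u) (Idn (over_cat u b) x) = Idn ?B (?fo x)" if "x \<in> Ob (over_cat u b)" for x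
    using that o[OF that] u by (auto simp: Idn_over_cat Ob_over_cat FAr_Idn)
  fix x y z f g assume f: "f \<in> hom (over_cat u b) x y" and g: "g \<in> hom (over_cat u b) y z"
  obtain f' where f': "f = pair (pair x y) f'" "f' \<in> hom (Src u) (pfst x) (pfst y)"
    using f by (auto simp: hom_over_cat)
  obtain g' where g': "g = pair (pair y z) g'" "g' \<in> hom (Src u) (pfst y) (pfst z)"
    using g by (auto simp: hom_over_cat)
  show "hom_map ?fo (FAr u) (Cmp (over_cat u b) g f) =
      Cmp ?B (hom_map ?fo (FAr u) g) (hom_map ?fo (FAr u) f)"
    using f g h[OF f] h[OF g] by (simp add: f' g' Cmp_over_cat FAr_Cmp[OF u f'(2) g'(2)])
qed (use u in auto)

lemma under_functor_is_functor:
  assumes u: "is_functor u"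
  shows "is_functor (under_functor u b)"
  unfolding under_functor_def Let_def
proof (rule is_functor_mkI)
  let ?fo = "\<lambda>x. pair (FOb u (pfst x)) (psnd x)" and ?B = "under_cat (id_functor (Tgt u)) b"
  show o: "?fo x \<in> Ob ?B" if "x \<in> Ob (under_cat u b)" for x
    using that u by (auto simp: Ob_under_cat)
  show h: "hom_map ?fo (FAr u) m \<in> hom ?B (?fo x) (?fo y)" if "m \<in> hom (under_cat u b) x y" for x y m
    using that u o[of x] o[of y] by (auto simp: hom_under_cat dest!: FAr_hom[OF u])
  show "hom_map ?fo (FAr u) (Idn (under_cat u b) x) = Idn ?B (?fo x)" if "x \<in> Ob (under_cat u b)" for x
    using that o[OF that] u by (auto simp: Idn_under_cat Ob_under_cat FAr_Idn)
  fix x y z f g assume f: "f \<in> hom (under_cat u b) x y" and g: "g \<in> hom (under_cat u b) y z"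
  obtain f' where f': "f = pair (pair x y) f'" "f' \<in> hom (Src u) (pfst x) (pfst y)"
    using f by (auto simp: hom_under_cat)
  obtain g' where g': "g = pair (pair y z) g'" "g' \<in> hom (Src u) (pfst y) (pfst z)"
    using g by (auto simp: hom_under_cat)
  show "hom_map ?fo (FAr u) (Cmp (under_cat u b) g f) =
      Cmp ?B (hom_map ?fo (FAr u) g) (hom_map ?fo (FAr u) f)"
    using f g h[OF f] h[OF g] by (simp add: f' g' Cmp_under_cat FAr_Cmp[OF u f'(2) g'(2)])
qed (use u in auto)

lemma over_functor_sel [simp]:
  "Src (over_functor u b) = over_cat u b"
  "Tgt (over_functor u b) = over_cat (id_functor (Tgt u)) b"
  by (simp_all add: over_functor_def Let_def)

lemma under_functor_sel [simp]:
  "Src (under_functor u b) = under_cat u b"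
  "Tgt (under_functor u b) = under_cat (id_functor (Tgt u)) b"
  by (simp_all add: under_functor_def Let_def)

text \<open>A terminal object of the slice is a universal arrow from \<open>u\<close> to
  \<open>b\<close>, that is, the value at \<open>b\<close> of a right adjoint together with its
  counit.\<close>

lemma has_terminal_over_catI:
  assumes u: "is_functor u" and a: "a \<in> Ob (Src u)" and e: "e \<in> hom (Tgt u) (FOb u a) b"
    and U: "\<And>a' g. a' \<in> Ob (Src u) \<Longrightarrow> g \<in> hom (Tgt u) (FOb u a') b \<Longrightarrow>
      \<exists>!f. f \<in> hom (Src u) a' a \<and> Cmp (Tgt u) e (FAr u f) = g"
  shows "has_terminal_object (over_cat u b)"
  unfolding has_terminal_object_def
proof (intro bexI ballI)
  show t: "pair a e \<in> Ob (over_cat u b)"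
    using a e by (simp add: Ob_over_cat)
  fix x assume x: "x \<in> Ob (over_cat u b)"
  then obtain a' g where [simp]: "x = pair a' g" and *: "a' \<in> Ob (Src u)" "g \<in> hom (Tgt u) (FOb u a') b"
    by (auto simp: Ob_over_cat)
  have "f \<in> hom (over_cat u b) x (pair a e) \<longleftrightarrow>
      (\<exists>h. f = pair (pair x (pair a e)) h \<and> h \<in> hom (Src u) a' a \<and> Cmp (Tgt u) e (FAr u h) = g)" for f
    using x t by (simp add: hom_over_cat)
  then show "\<exists>!f. f \<in> hom (over_cat u b) x (pair a e)"
    using U[OF *] by (simp only: ex1_pair_conv)
qed

section \<open>Aspherical categories\<close>

context
  fixes W :: "'u::universe cat_functor set"
  assumes W: "weak_fundamental_localizer W"
begin

lemma two_of_three: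
  assumes "is_functor F" "is_functor G" "Tgt F = Src G"
  shows comp_mem: "F \<in> W \<Longrightarrow> G \<in> W \<Longrightarrow> G \<circ>\<^sub>F F \<in> W"
    and cancel_right_mem: "F \<in> W \<Longrightarrow> G \<circ>\<^sub>F F \<in> W \<Longrightarrow> G \<in> W"
    and cancel_left_mem: "G \<in> W \<Longrightarrow> G \<circ>\<^sub>F F \<in> W \<Longrightarrow> F \<in> W"
  using W assms unfolding weak_fundamental_localizer_def weakly_saturated_def by blast+

lemma aspherical_if_terminal:
  "small_category A \<Longrightarrow> has_terminal_object A \<Longrightarrow> aspherical W A"
  using W unfolding weak_fundamental_localizer_def aspherical_def by blast

lemma to_e_comp: "is_functor F \<Longrightarrow> to_e (Tgt F) \<circ>\<^sub>F F = to_e (Src F)"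
  using to_e_unique[of "to_e (Tgt F) \<circ>\<^sub>F F"] comp_is_functor[of F "to_e (Tgt F)"] by simp

text \<open>Two of three in the triangle formed by \<open>F\<close> and the two functors to
  \<open>e_cat\<close>, which commutes by \<open>to_e_comp\<close>.\<close>

lemma aspherical_iff_if_mem:
  assumes F: "is_functor F" "F \<in> W"
  shows "aspherical W (Src F) \<longleftrightarrow> aspherical W (Tgt F)"
  using two_of_three[of F "to_e (Tgt F)"] F to_e_comp[OF F(1)] by (auto simp: aspherical_def)

lemma mem_if_aspherical:
  assumes F: "is_functor F" and "aspherical W (Src F)" "aspherical W (Tgt F)"
  shows "F \<in> W"
  using two_of_three[of F "to_e (Tgt F)"] assms to_e_comp[OF F(1)] by (auto simp: aspherical_def)

text \<open>The slice of an identity functor over \<open>b\<close> has the terminal object given by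
  the identity of \<open>b\<close>. The induced functor between slices thus has an aspherical
  target, and an aspherical source puts it in \<open>W\<close>.\<close>

lemma mem_if_over_cat_aspherical:
  assumes u: "is_functor u" and A: "\<And>b. b \<in> Ob (Tgt u) \<Longrightarrow> aspherical W (over_cat u b)"
  shows "u \<in> W"
proof -
  have "over_functor u b \<in> W" if b: "b \<in> Ob (Tgt u)" for b
  proof (rule mem_if_aspherical)
    show "aspherical W (Tgt (over_functor u b))"
      unfolding over_functor_sel
    proof (intro aspherical_if_terminal has_terminal_over_catI[where a = b and e = "Idn (Tgt u) b"])
      fix a' g
      assume "a' \<in> Ob (Src (id_functor (Tgt u)))"
        "g \<in> hom (Tgt (id_functor (Tgt u))) (FOb (id_functor (Tgt u)) a') b"
      then have g: "g \<in> hom (Tgt u) a' b" by simp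
      with u show "\<exists>!f. f \<in> hom (Src (id_functor (Tgt u))) a' b \<and>
          Cmp (Tgt (id_functor (Tgt u))) (Idn (Tgt u) b) (FAr (id_functor (Tgt u)) f) = g"
        by (auto simp: Cmp_Idn_left intro!: ex1I[of _ g])
    qed (use u b in auto)
  qed (use A b in \<open>auto simp: over_functor_is_functor[OF u]\<close>)
  then show ?thesis
    using W u unfolding weak_fundamental_localizer_def by blast
qed

lemma aspherical_iff_over_cat:
  assumes "is_functor u" "\<And>b. b \<in> Ob (Tgt u) \<Longrightarrow> aspherical W (over_cat u b)"
  shows "aspherical W (Src u) \<longleftrightarrow> aspherical W (Tgt u)"
  using assms mem_if_over_cat_aspherical aspherical_iff_if_mem by blast

text \<open>\<open>U\<close> gives a right adjoint of \<open>u\<close> pointwise, and each of its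
  counits is a terminal object of a slice. The pointwise form spares callers the functoriality of
  that adjoint.\<close>

lemma aspherical_iff_left_adjoint:
  assumes u: "is_functor u"
    and U: "\<And>b. b \<in> Ob (Tgt u) \<Longrightarrow> \<exists>a\<in>Ob (Src u). \<exists>e\<in>hom (Tgt u) (FOb u a) b.
      \<forall>a'\<in>Ob (Src u). \<forall>g\<in>hom (Tgt u) (FOb u a') b.
        \<exists>!f. f \<in> hom (Src u) a' a \<and> Cmp (Tgt u) e (FAr u f) = g"
  shows "aspherical W (Src u) \<longleftrightarrow> aspherical W (Tgt u)"
proof (rule aspherical_iff_over_cat[OF u])
  fix b assume "b \<in> Ob (Tgt u)"
  from U[OF this] obtain a e where a: "a \<in> Ob (Src u)" and e: "e \<in> hom (Tgt u) (FOb u a) b" and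
    *: "\<And>a' g. a' \<in> Ob (Src u) \<Longrightarrow> g \<in> hom (Tgt u) (FOb u a') b \<Longrightarrow>
      \<exists>!f. f \<in> hom (Src u) a' a \<and> Cmp (Tgt u) e (FAr u f) = g"
    by blast
  show "aspherical W (over_cat u b)"
    by (rule aspherical_if_terminal[OF _ has_terminal_over_catI[OF u a e *]]) (use u in simp_all)
qed

text \<open>Here the universal arrows are initial objects of coslices, to which the axioms do not
  apply directly. So the left adjoint is built as a functor \<open>?L\<close> and the preceding
  criterion is applied to it, with source and target exchanged.\<close>

lemma aspherical_iff_right_adjoint:
  assumes u: "is_functor u"
    and U: "\<And>b. b \<in> Ob (Tgt u) \<Longrightarrow> \<exists>a\<in>Ob (Src u). \<exists>e\<in>hom (Tgt u) b (FOb u a).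
      \<forall>a'\<in>Ob (Src u). \<forall>g\<in>hom (Tgt u) b (FOb u a').
        \<exists>!f. f \<in> hom (Src u) a a' \<and> Cmp (Tgt u) (FAr u f) e = g"
  shows "aspherical W (Src u) \<longleftrightarrow> aspherical W (Tgt u)"
proof -
  let ?A = "Src u" and ?B = "Tgt u"
  have A: "small_category ?A" and B: "small_category ?B" using u by auto
  have "\<forall>b\<in>Ob ?B. \<exists>a. \<exists>e. a \<in> Ob ?A \<and> e \<in> hom ?B b (FOb u a) \<and>
      (\<forall>a'\<in>Ob ?A. \<forall>g\<in>hom ?B b (FOb u a'). \<exists>!f. f \<in> hom ?A a a' \<and> Cmp ?B (FAr u f) e = g)"
    using U by blast
  then obtain r \<eta> where
    r: "\<And>b. b \<in> Ob ?B \<Longrightarrow> r b \<in> Ob ?A" and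
    \<eta>: "\<And>b. b \<in> Ob ?B \<Longrightarrow> \<eta> b \<in> hom ?B b (FOb u (r b))" and
    ex: "\<And>b a' g. b \<in> Ob ?B \<Longrightarrow> a' \<in> Ob ?A \<Longrightarrow> g \<in> hom ?B b (FOb u a') \<Longrightarrow>
      \<exists>!f. f \<in> hom ?A (r b) a' \<and> Cmp ?B (FAr u f) (\<eta> b) = g"
    by metis
  \<comment> \<open>The transpose of \<open>g\<close> along the adjunction; \<eta> is the
    unit.\<close>
  define \<phi> where "\<phi> b a g = (THE f. f \<in> hom ?A (r b) a \<and> Cmp ?B (FAr u f) (\<eta> b) = g)" for b a g
  have \<phi>: "\<phi> b a g \<in> hom ?A (r b) a" "Cmp ?B (FAr u (\<phi> b a g)) (\<eta> b) = g"
    if "b \<in> Ob ?B" "a \<in> Ob ?A" "g \<in> hom ?B b (FOb u a)" for b a g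
    using theI'[OF ex[OF that]] unfolding \<phi>_def by auto
  have uniq: "f = f'"
    if "b \<in> Ob ?B" "a \<in> Ob ?A" "f \<in> hom ?A (r b) a" "f' \<in> hom ?A (r b) a"
      "Cmp ?B (FAr u f) (\<eta> b) = Cmp ?B (FAr u f') (\<eta> b)" for b a f f'
    using ex[OF that(1,2) Cmp_hom[OF B \<eta>[OF that(1)] FAr_hom[OF u that(3)]]] that(3-5) by metis
  \<comment> \<open>The arrow part of the left adjoint: the transpose of the unit after
    \<open>f\<close>. Uniqueness of transposes will make it functorial.\<close>
  define l where "l f = \<phi> (Dom ?B f) (r (Cod ?B f)) (Cmp ?B (\<eta> (Cod ?B f)) f)" for f
  have l: "l f \<in> hom ?A (r b) (r c)" "Cmp ?B (FAr u (l f)) (\<eta> b) = Cmp ?B (\<eta> c) f"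
    if f: "f \<in> hom ?B b c" for f b c
  proof -
    have bc: "b \<in> Ob ?B" "c \<in> Ob ?B" using hom_Ob[OF B f] by auto
    have [simp]: "Dom ?B f = b" "Cod ?B f = c" using f by (auto simp: hom_def)
    show "l f \<in> hom ?A (r b) (r c)" "Cmp ?B (FAr u (l f)) (\<eta> b) = Cmp ?B (\<eta> c) f"
      using \<phi>[OF bc(1) r[OF bc(2)] Cmp_hom[OF B f \<eta>[OF bc(2)]]] by (auto simp: l_def)
  qed
  let ?L = "mk_functor ?B ?A r l"
  have L: "is_functor ?L"
  proof (rule is_functor_mkI)
    fix b assume b: "b \<in> Ob ?B"
    show "l (Idn ?B b) = Idn ?A (r b)"
    proof (rule uniq[OF b r[OF b] l(1)[OF Idn_hom[OF B b]] Idn_hom[OF A r[OF b]]])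
      show "Cmp ?B (FAr u (l (Idn ?B b))) (\<eta> b) = Cmp ?B (FAr u (Idn ?A (r b))) (\<eta> b)"
        unfolding l(2)[OF Idn_hom[OF B b]] FAr_Idn[OF u r[OF b]]
        by (simp only: Cmp_Idn_left[OF B \<eta>[OF b]] Cmp_Idn_right[OF B \<eta>[OF b]])
    qed
next
    fix b c d f g assume o: "b \<in> Ob ?B" "c \<in> Ob ?B" "d \<in> Ob ?B"
      and f: "f \<in> hom ?B b c" and g: "g \<in> hom ?B c d"
    note gf = Cmp_hom[OF B f g]
    note lgf = Cmp_hom[OF A l(1)[OF f] l(1)[OF g]]
    show "l (Cmp ?B g f) = Cmp ?A (l g) (l f)"
    proof (rule uniq[OF o(1) r[OF o(3)] l(1)[OF gf] lgf])
      have "Cmp ?B (FAr u (Cmp ?A (l g) (l f))) (\<eta> b) =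
          Cmp ?B (FAr u (l g)) (Cmp ?B (FAr u (l f)) (\<eta> b))"
        unfolding FAr_Cmp[OF u l(1)[OF f] l(1)[OF g]]
        by (rule Cmp_assoc[OF B \<eta>[OF o(1)] FAr_hom[OF u l(1)[OF f]] FAr_hom[OF u l(1)[OF g]], symmetric])
      also have "\<dots> = Cmp ?B (Cmp ?B (FAr u (l g)) (\<eta> c)) f"
        unfolding l(2)[OF f]
        by (rule Cmp_assoc[OF B f \<eta>[OF o(2)] FAr_hom[OF u l(1)[OF g]]])
      also have "\<dots> = Cmp ?B (FAr u (l (Cmp ?B g f))) (\<eta> b)"
        unfolding l(2)[OF g] l(2)[OF gf]
        by (rule Cmp_assoc[OF B f g \<eta>[OF o(3)], symmetric])
      finally show "Cmp ?B (FAr u (l (Cmp ?B g f))) (\<eta> b) =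
          Cmp ?B (FAr u (Cmp ?A (l g) (l f))) (\<eta> b)" by simp
    qed
  qed (use A B r l in auto)
  have "aspherical W (Src ?L) \<longleftrightarrow> aspherical W (Tgt ?L)"
  proof (rule aspherical_iff_left_adjoint[OF L])
    fix a assume "a \<in> Ob (Tgt ?L)"
    then have a: "a \<in> Ob ?A" by simp
    then have ua: "FOb u a \<in> Ob ?B" using u by simp
    \<comment> \<open>The counit at \<open>a\<close>, as the transpose of the identity of
      u(a).\<close>
    let ?e = "\<phi> (FOb u a) a (Idn ?B (FOb u a))"
    note e = \<phi>[OF ua a Idn_hom[OF B ua]]
    \<comment> \<open>The counit after \<open>l f\<close> is the transpose of \<open>f\<close>; this
      follows from the triangle identity \<open>e(2)\<close>.\<close>
    have key: "Cmp ?B (FAr u (Cmp ?A ?e (l f))) (\<eta> b) = f" "Cmp ?A ?e (l f) \<in> hom ?A (r b) a"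
      if f: "f \<in> hom ?B b (FOb u a)" for f b
    proof -
      have b: "b \<in> Ob ?B" using hom_Ob[OF B f] by auto
      show "Cmp ?A ?e (l f) \<in> hom ?A (r b) a"
        by (rule Cmp_hom[OF A l(1)[OF f] e(1)])
      have "Cmp ?B (FAr u (Cmp ?A ?e (l f))) (\<eta> b) = Cmp ?B (FAr u ?e) (Cmp ?B (FAr u (l f)) (\<eta> b))"
        unfolding FAr_Cmp[OF u l(1)[OF f] e(1)]
        by (rule Cmp_assoc[OF B \<eta>[OF b] FAr_hom[OF u l(1)[OF f]] FAr_hom[OF u e(1)], symmetric])
      also have "\<dots> = Cmp ?B (Cmp ?B (FAr u ?e) (\<eta> (FOb u a))) f"
        unfolding l(2)[OF f] by (rule Cmp_assoc[OF B f \<eta>[OF ua] FAr_hom[OF u e(1)]])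
      also have "\<dots> = f" unfolding e(2) by (rule Cmp_Idn_left[OF B f])
      finally show "Cmp ?B (FAr u (Cmp ?A ?e (l f))) (\<eta> b) = f" .
    qed
    have "\<exists>!f. f \<in> hom ?B b (FOb u a) \<and> Cmp ?A ?e (FAr ?L f) = g"
      if b: "b \<in> Ob ?B" and g: "g \<in> hom ?A (r b) a" for b g
    \<comment> \<open>The inverse of transposition: apply \<open>u\<close> and precompose with the
      unit.\<close>
    proof (rule ex1I[of _ "Cmp ?B (FAr u g) (\<eta> b)"])
      have h: "Cmp ?B (FAr u g) (\<eta> b) \<in> hom ?B b (FOb u a)"
        by (rule Cmp_hom[OF B \<eta>[OF b] FAr_hom[OF u g]])
      have "Cmp ?A ?e (l (Cmp ?B (FAr u g) (\<eta> b))) = g"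
        by (rule uniq[OF b a key(2)[OF h] g key(1)[OF h]])
      then show "Cmp ?B (FAr u g) (\<eta> b) \<in> hom ?B b (FOb u a) \<and>
          Cmp ?A ?e (FAr ?L (Cmp ?B (FAr u g) (\<eta> b))) = g"
        using h by simp
      show "f = Cmp ?B (FAr u g) (\<eta> b)"
        if "f \<in> hom ?B b (FOb u a) \<and> Cmp ?A ?e (FAr ?L f) = g" for f
        using that key(1)[of f b] by auto
    qed
    note * = this
    show "\<exists>b\<in>Ob (Src ?L). \<exists>e\<in>hom (Tgt ?L) (FOb ?L b) a.
        \<forall>b'\<in>Ob (Src ?L). \<forall>g\<in>hom (Tgt ?L) (FOb ?L b') a.
          \<exists>!f. f \<in> hom (Src ?L) b' b \<and> Cmp (Tgt ?L) e (FAr ?L f) = g"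
      by (rule bexI[of _ "FOb u a"], rule bexI[of _ ?e]) (use * ua e(1) in simp_all)
  qed
  then show ?thesis by simp
qed

text \<open>Surjectivity on objects allows an identity as counit, and full faithfulness is then its
  universal property. Reindexing isomorphisms are handled through this criterion.\<close>

lemma aspherical_iff_equivalence:
  assumes u: "is_functor u"
    and o: "\<And>b. b \<in> Ob (Tgt u) \<Longrightarrow> \<exists>a\<in>Ob (Src u). FOb u a = b"
    and f: "\<And>a a' g. a \<in> Ob (Src u) \<Longrightarrow> a' \<in> Ob (Src u) \<Longrightarrow> g \<in> hom (Tgt u) (FOb u a) (FOb u a') \<Longrightarrow>
      \<exists>!f. f \<in> hom (Src u) a a' \<and> FAr u f = g"
  shows "aspherical W (Src u) \<longleftrightarrow> aspherical W (Tgt u)"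
proof (rule aspherical_iff_left_adjoint[OF u])
  fix b assume "b \<in> Ob (Tgt u)"
  with o obtain a where a: "a \<in> Ob (Src u)" and [simp]: "FOb u a = b" by blast
  have B: "small_category (Tgt u)" using u by simp
  have "\<exists>!f. f \<in> hom (Src u) a' a \<and> Cmp (Tgt u) (Idn (Tgt u) b) (FAr u f) = g"
    if "a' \<in> Ob (Src u)" "g \<in> hom (Tgt u) (FOb u a') b" for a' g
  proof -
    have "Cmp (Tgt u) (Idn (Tgt u) b) (FAr u f) = FAr u f" if "f \<in> hom (Src u) a' a" for f
      using FAr_hom[OF u that] by (simp add: Cmp_Idn_left[OF B])
    then show ?thesis
      using f[OF that(1) a, of g] that(2) by (metis \<open>FOb u a = b\<close>)
  qed
  note * = this
  show "\<exists>a\<in>Ob (Src u). \<exists>e\<in>hom (Tgt u) (FOb u a) b.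
      \<forall>a'\<in>Ob (Src u). \<forall>g\<in>hom (Tgt u) (FOb u a') b.
        \<exists>!f. f \<in> hom (Src u) a' a \<and> Cmp (Tgt u) e (FAr u f) = g"
    by (rule bexI[of _ a], rule bexI[of _ "Idn (Tgt u) b"])
      (use B a * \<open>b \<in> Ob (Tgt u)\<close> in simp_all)
qed

text \<open>The functor from \<open>e_cat\<close> that picks out an initial object is left adjoint
  to the functor to \<open>e_cat\<close>.\<close>

lemma aspherical_if_initial:
  assumes C: "small_category C" and c: "c \<in> Ob C" and i: "\<And>a. a \<in> Ob C \<Longrightarrow> \<exists>!f. f \<in> hom C c a"
  shows "aspherical W C"
proof -
  have u: "is_functor (point C c)"
    unfolding point_def
    by (rule is_functor_mkI) (use C c in \<open>auto simp: Cmp_Idn_left[OF C Idn_hom[OF C]]\<close>)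
  have [simp]: "Src (point C c) = e_cat" "Tgt (point C c) = C" "FOb (point C c) pt = c"
      "FAr (point C c) pt = Idn C c"
    by (simp_all add: point_def)
  have "aspherical W (Src (point C c)) \<longleftrightarrow> aspherical W (Tgt (point C c))"
  proof (rule aspherical_iff_left_adjoint[OF u])
    fix b assume "b \<in> Ob (Tgt (point C c))"
    then have "\<exists>!f. f \<in> hom C c b" using i by simp
    then obtain e where "hom C c b = {e}" by (elim ex1E) blast
    note * = this
    show "\<exists>a\<in>Ob (Src (point C c)). \<exists>e\<in>hom (Tgt (point C c)) (FOb (point C c) a) b.
        \<forall>a'\<in>Ob (Src (point C c)). \<forall>g\<in>hom (Tgt (point C c)) (FOb (point C c) a') b.
          \<exists>!f. f \<in> hom (Src (point C c)) a' a \<and>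
            Cmp (Tgt (point C c)) e (FAr (point C c) f) = g"
      by (rule bexI[where x = pt], rule bexI[where x = e])
        (use c * Cmp_Idn_right[OF C, of e c b] in auto)
  qed
  moreover have "aspherical W (e_cat :: 'u cat)"
    by (rule aspherical_if_terminal) (auto simp: has_terminal_object_def)
  ultimately show ?thesis by simp
qed

text \<open>The inclusion of a reflective full subcategory is a right adjoint. The subcategory is
  given by its set \<open>R\<close> of objects; its arrows are those of \<open>C\<close> tagged once
  more, and \<open>psnd\<close> is the inclusion.\<close>

lemma aspherical_if_reflective_initial:
  assumes C: "small_category C" and R: "R \<subseteq> Ob C"
    and refl: "\<And>x. x \<in> Ob C \<Longrightarrow> \<exists>r\<in>R. \<exists>e\<in>hom C x r. \<forall>y\<in>R. \<forall>g\<in>hom C x y.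
      \<exists>!h. h \<in> hom C r y \<and> Cmp C h e = g"
    and c: "c \<in> R" and i: "\<And>y. y \<in> R \<Longrightarrow> \<exists>!f. f \<in> hom C c y"
  shows "aspherical W C"
proof -
  let ?F = "hom_cat R (hom C) (Idn C) (Cmp C)"
  have F: "small_category ?F"
    by (rule hom_cat_over_small_category[OF C, where p = "\<lambda>x. x"])
      (use R small_subset[OF small_Ob[OF C] R] Cmp_hom[OF C] in \<open>auto simp: subset_iff C\<close>)
  let ?i = "mk_functor ?F C (\<lambda>x. x) psnd"
  have i': "is_functor ?i"
    by (rule is_functor_mkI) (use C F R in \<open>auto simp: hom_hom_cat\<close>)
  have "aspherical W ?F"
  proof (rule aspherical_if_initial[OF F])
    show "\<exists>!f. f \<in> hom ?F c y" if y: "y \<in> Ob ?F" for y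
    proof -
      have "f \<in> hom ?F c y \<longleftrightarrow> (\<exists>h. f = pair (pair c y) h \<and> h \<in> hom C c y)" for f
        using y c by (auto simp: hom_hom_cat)
      then show ?thesis using i[of y] y by (simp only: ex1_pair_conv Ob_hom_cat)
    qed
  qed (use c in simp)
  moreover have "aspherical W (Src ?i) \<longleftrightarrow> aspherical W (Tgt ?i)"
  proof (rule aspherical_iff_right_adjoint[OF i'])
    fix x assume "x \<in> Ob (Tgt ?i)"
    then obtain r e where r: "r \<in> R" and e: "e \<in> hom C x r" and
      U: "\<And>y g. y \<in> R \<Longrightarrow> g \<in> hom C x y \<Longrightarrow> \<exists>!h. h \<in> hom C r y \<and> Cmp C h e = g"
      using refl[of x] by auto
    have "\<exists>!f. f \<in> hom ?F r y \<and> Cmp C (FAr ?i f) e = g" if y: "y \<in> R" and g: "g \<in> hom C x y" for y g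
    proof -
      have "f \<in> hom ?F r y \<and> Cmp C (FAr ?i f) e = g \<longleftrightarrow>
          (\<exists>h. f = pair (pair r y) h \<and> h \<in> hom C r y \<and> Cmp C h e = g)" for f
        using r y FAr_mk_hom[of f ?F r y] by (auto simp: hom_hom_cat)
      then show ?thesis using U[OF y g] by (simp only: ex1_pair_conv)
    qed
    note * = this
    show "\<exists>a\<in>Ob (Src ?i). \<exists>e\<in>hom (Tgt ?i) x (FOb ?i a).
        \<forall>a'\<in>Ob (Src ?i). \<forall>g\<in>hom (Tgt ?i) x (FOb ?i a').
          \<exists>!f. f \<in> hom (Src ?i) a a' \<and> Cmp (Tgt ?i) (FAr ?i f) e = g"
      by (rule bexI[of _ r], rule bexI[of _ e]) (use * r e in simp_all)
  qed
  ultimately show ?thesis by simp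
qed

lemma aspherical_under_cat_id:
  assumes B: "small_category B" and b: "b \<in> Ob B"
  shows "aspherical W (under_cat (id_functor B) b)"
proof (rule aspherical_if_initial)
  show c: "pair b (Idn B b) \<in> Ob (under_cat (id_functor B) b)"
    using B b by (simp add: Ob_under_cat)
  fix x assume x: "x \<in> Ob (under_cat (id_functor B) b)"
  then obtain a g where [simp]: "x = pair a g" and g: "g \<in> hom B b a"
    by (auto simp: Ob_under_cat)
  show "\<exists>!f. f \<in> hom (under_cat (id_functor B) b) (pair b (Idn B b)) x"
    by (rule ex1I[of _ "pair (pair (pair b (Idn B b)) x) g"])
      (use c x g in \<open>auto simp: hom_under_cat Cmp_Idn_right[OF B]\<close>)
qed (use B in simp)

text \<open>The coslice of the identity has an initial object, hence is aspherical, and two of three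
  applies to the induced functor between coslices.\<close>

lemma coaspherical_iff:
  "coaspherical W u \<longleftrightarrow> is_functor u \<and> (\<forall>b\<in>Ob (Tgt u). aspherical W (under_cat u b))"
proof (cases "is_functor u")
  case True
  have "under_functor u b \<in> W \<longleftrightarrow> aspherical W (under_cat u b)" if "b \<in> Ob (Tgt u)" for b
    using aspherical_iff_if_mem[OF under_functor_is_functor[OF True, of b]]
      mem_if_aspherical[OF under_functor_is_functor[OF True, of b]]
      aspherical_under_cat_id[OF Tgt_small[OF True] that] by auto
  with True show ?thesis by (simp add: coaspherical_def)
qed (simp add: coaspherical_def)

end

section \<open>Coaspherical functors\<close>

text \<open>Each arrow is kept but tagged with its new endpoints. This is the \<open>hom_cat\<close>
  format of the other categories, so \<open>hom_map\<close> can serve for functors into the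
  opposite.\<close>

definition op_cat :: "'u::universe cat \<Rightarrow> 'u cat" where
  "op_cat C = hom_cat (Ob C) (\<lambda>x y. hom C y x) (Idn C) (\<lambda>g f. Cmp C f g)"

lemma Ob_op_cat [simp]: "Ob (op_cat C) = Ob C"
  by (simp add: op_cat_def)

lemma hom_op_cat:
  "hom (op_cat C) x y = {m. x \<in> Ob C \<and> y \<in> Ob C \<and> (\<exists>f. m = pair (pair x y) f \<and> f \<in> hom C y x)}"
  by (auto simp: op_cat_def hom_hom_cat)

lemma Idn_op_cat: "x \<in> Ob C \<Longrightarrow> Idn (op_cat C) x = pair (pair x x) (Idn C x)"
  by (simp add: op_cat_def)

lemma Cmp_op_cat:
  assumes C: "small_category C" and f: "f \<in> hom C y x" and g: "g \<in> hom C z y"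
  shows "Cmp (op_cat C) (pair (pair y z) g) (pair (pair x y) f) = pair (pair x z) (Cmp C f g)"
  using hom_Ob[OF C f] hom_Ob[OF C g] f g unfolding op_cat_def by simp

lemma small_category_op_cat [simp]:
  assumes C: "small_category C"
  shows "small_category (op_cat C)"
  unfolding op_cat_def
proof (rule hom_cat_small_category[OF small_Ob[OF C] small_Ar[OF C]])
  show "Cmp C (Cmp C f g) h = Cmp C f (Cmp C g h)"
    if "f \<in> hom C y x" "g \<in> hom C z y" "h \<in> hom C t z" for x y z t f g h
    using Cmp_assoc[OF C that(3,2,1)] by simp
  show "hom C y x \<subseteq> Ar C" for x y by (auto simp: hom_def)
qed (use C Cmp_hom[OF C] Cmp_Idn_left[OF C] Cmp_Idn_right[OF C] in auto)

text \<open>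
  The category of triples \<open>(b, a, g : b \<rightarrow> u(a))\<close>, contravariant in \<open>b\<close> and covariant in \<open>a\<close>.  Both
  projections, to \<open>A\<close> and to the opposite of \<open>B\<close>, are opfibrations; their fibres are the opposite of
  \<open>B/u(a)\<close>, respectively \<open>b\A\<close>.
\<close>

definition twisted_cat :: "'u::universe cat_functor \<Rightarrow> 'u cat" where
  "twisted_cat u = (let A = Src u; B = Tgt u in
     hom_cat {pair b (pair a g) | b a g. a \<in> Ob A \<and> g \<in> hom B b (FOb u a)}
       (\<lambda>x y. {pair p q | p q. p \<in> hom B (pfst y) (pfst x) \<and>
          q \<in> hom A (pfst (psnd x)) (pfst (psnd y)) \<and>
          Cmp B (FAr u q) (Cmp B (psnd (psnd x)) p) = psnd (psnd y)})
       (\<lambda>x. pair (Idn B (pfst x)) (Idn A (pfst (psnd x))))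
       (\<lambda>n m. pair (Cmp B (pfst m) (pfst n)) (Cmp A (psnd n) (psnd m))))"

lemma Ob_twisted_cat:
  "Ob (twisted_cat u) =
    {pair b (pair a g) | b a g. a \<in> Ob (Src u) \<and> g \<in> hom (Tgt u) b (FOb u a)}"
  by (simp add: twisted_cat_def Let_def)

lemma hom_twisted_cat:
  "hom (twisted_cat u) x y = {m. x \<in> Ob (twisted_cat u) \<and> y \<in> Ob (twisted_cat u) \<and>
    (\<exists>p q. m = pair (pair x y) (pair p q) \<and> p \<in> hom (Tgt u) (pfst y) (pfst x) \<and>
      q \<in> hom (Src u) (pfst (psnd x)) (pfst (psnd y)) \<and>
      Cmp (Tgt u) (FAr u q) (Cmp (Tgt u) (psnd (psnd x)) p) = psnd (psnd y))}"
  by (auto simp: twisted_cat_def Let_def hom_hom_cat)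

lemma Idn_twisted_cat:
  "x \<in> Ob (twisted_cat u) \<Longrightarrow> Idn (twisted_cat u) x =
    pair (pair x x) (pair (Idn (Tgt u) (pfst x)) (Idn (Src u) (pfst (psnd x))))"
  by (simp add: twisted_cat_def Let_def)

lemma Cmp_twisted_cat:
  assumes "pair (pair x y) (pair p q) \<in> hom (twisted_cat u) x y"
    and "pair (pair y z) (pair p' q') \<in> hom (twisted_cat u) y z"
  shows "Cmp (twisted_cat u) (pair (pair y z) (pair p' q')) (pair (pair x y) (pair p q)) =
    pair (pair x z) (pair (Cmp (Tgt u) p p') (Cmp (Src u) q' q))"
  using Cmp_hom_cat_hom[OF assms[unfolded twisted_cat_def Let_def]]
  by (simp add: twisted_cat_def Let_def)

lemma small_category_twisted_cat [simp]:
  assumes u: "is_functor u"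
  shows "small_category (twisted_cat u)"
  unfolding twisted_cat_def Let_def
proof (rule hom_cat_small_category)
  let ?A = "Src u" and ?B = "Tgt u"
  have A: "small_category ?A" and B: "small_category ?B" using u by auto
  let ?X = "{pair b (pair a g) | b a g. a \<in> Ob ?A \<and> g \<in> hom ?B b (FOb u a)}"
  let ?H = "\<lambda>x y. {pair p q | p q. p \<in> hom ?B (pfst y) (pfst x) \<and>
          q \<in> hom ?A (pfst (psnd x)) (pfst (psnd y)) \<and>
          Cmp ?B (FAr u q) (Cmp ?B (psnd (psnd x)) p) = psnd (psnd y)}"
  show "small ?X"
    by (rule small_subset[OF small_pairs[OF small_Ob[OF B] small_pairs[OF small_Ob[OF A] small_Ar[OF B]]]])
      (use hom_Ob(1)[OF B] in \<open>auto simp: hom_Ar\<close>)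
  show "small {pair p q | p q. p \<in> Ar ?B \<and> q \<in> Ar ?A}"
    by (rule small_pairs[OF small_Ar[OF B] small_Ar[OF A]])
  show "?H x y \<subseteq> {pair p q | p q. p \<in> Ar ?B \<and> q \<in> Ar ?A}" for x y
    by (auto simp: hom_def)
  show "pair (Idn ?B (pfst x)) (Idn ?A (pfst (psnd x))) \<in> ?H x x" if x: "x \<in> ?X" for x
  proof -
    from x obtain b a g where [simp]: "x = pair b (pair a g)" and
      a: "a \<in> Ob ?A" and g: "g \<in> hom ?B b (FOb u a)" by auto
    show ?thesis
      using a hom_Ob(1)[OF B g] A B
      by (simp add: FAr_Idn[OF u] Cmp_Idn_right[OF B g] Cmp_Idn_left[OF B g])
  qed
  fix x y z m n assume x: "x \<in> ?X" and m: "m \<in> ?H x y"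
  from m obtain p q where [simp]: "m = pair p q" and p: "p \<in> hom ?B (pfst y) (pfst x)" and
      q: "q \<in> hom ?A (pfst (psnd x)) (pfst (psnd y))" and
      pq: "Cmp ?B (FAr u q) (Cmp ?B (psnd (psnd x)) p) = psnd (psnd y)"
    by blast
  show "pair (Cmp ?B (pfst (pair (Idn ?B (pfst x)) (Idn ?A (pfst (psnd x))))) (pfst m))
     (Cmp ?A (psnd m) (psnd (pair (Idn ?B (pfst x)) (Idn ?A (pfst (psnd x)))))) = m"
    using Cmp_Idn_left[OF B p] Cmp_Idn_right[OF A q] by simp
  show "pair (Cmp ?B (pfst m) (pfst (pair (Idn ?B (pfst y)) (Idn ?A (pfst (psnd y))))))
     (Cmp ?A (psnd (pair (Idn ?B (pfst y)) (Idn ?A (pfst (psnd y))))) (psnd m)) = m"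
    using Cmp_Idn_right[OF B p] Cmp_Idn_left[OF A q] by simp
  assume n: "n \<in> ?H y z"
  from n obtain p' q' where [simp]: "n = pair p' q'" and p': "p' \<in> hom ?B (pfst z) (pfst y)" and
      q': "q' \<in> hom ?A (pfst (psnd y)) (pfst (psnd z))" and
      pq': "Cmp ?B (FAr u q') (Cmp ?B (psnd (psnd y)) p') = psnd (psnd z)"
    by blast
  have x2: "psnd (psnd x) \<in> hom ?B (pfst x) (FOb u (pfst (psnd x)))" using x by auto
  \<comment> \<open>Regrouped so that the equation \<open>pq\<close> of the inner morphism can be
    used first and \<open>pq'\<close> after it.\<close>
  have "Cmp ?B (FAr u (Cmp ?A q' q)) (Cmp ?B (psnd (psnd x)) (Cmp ?B p p')) =
      Cmp ?B (FAr u q') (Cmp ?B (FAr u q) (Cmp ?B (Cmp ?B (psnd (psnd x)) p) p'))"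
    unfolding FAr_Cmp[OF u q q'] Cmp_assoc[OF B p' p x2]
    by (rule Cmp_assoc[OF B Cmp_hom[OF B p' Cmp_hom[OF B p x2]] FAr_hom[OF u q] FAr_hom[OF u q'], symmetric])
  also have "\<dots> = psnd (psnd z)"
    unfolding Cmp_assoc[OF B p' Cmp_hom[OF B p x2] FAr_hom[OF u q]] pq pq' ..
  finally show "pair (Cmp ?B (pfst m) (pfst n)) (Cmp ?A (psnd n) (psnd m)) \<in> ?H x z"
    using Cmp_hom[OF B p' p] Cmp_hom[OF A q q'] by simp
  fix t k assume "k \<in> ?H z t"
  then obtain p'' q'' where [simp]: "k = pair p'' q''" and p'': "p'' \<in> hom ?B (pfst t) (pfst z)" and
      q'': "q'' \<in> hom ?A (pfst (psnd z)) (pfst (psnd t))"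
    by blast
  show "pair (Cmp ?B (pfst (pair (Cmp ?B (pfst m) (pfst n)) (Cmp ?A (psnd n) (psnd m)))) (pfst k))
         (Cmp ?A (psnd k) (psnd (pair (Cmp ?B (pfst m) (pfst n)) (Cmp ?A (psnd n) (psnd m))))) =
        pair (Cmp ?B (pfst m) (pfst (pair (Cmp ?B (pfst n) (pfst k)) (Cmp ?A (psnd k) (psnd n)))))
         (Cmp ?A (psnd (pair (Cmp ?B (pfst n) (pfst k)) (Cmp ?A (psnd k) (psnd n)))) (psnd m))"
    using Cmp_assoc[OF B p'' p' p] Cmp_assoc[OF A q q' q''] by simp
qed

section \<open>The two projections of the twisted category and their slices\<close>

definition twisted_tgt :: "'u::universe cat_functor \<Rightarrow> 'u cat_functor" where
  "twisted_tgt u = mk_functor (twisted_cat u) (Src u) (\<lambda>x. pfst (psnd x)) (\<lambda>m. psnd (psnd m))"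

definition twisted_src :: "'u::universe cat_functor \<Rightarrow> 'u cat_functor" where
  "twisted_src u = mk_functor (twisted_cat u) (op_cat (Tgt u)) pfst (hom_map pfst pfst)"

lemma twisted_tgt_sel [simp]:
  "Src (twisted_tgt u) = twisted_cat u" "Tgt (twisted_tgt u) = Src u"
  "x \<in> Ob (twisted_cat u) \<Longrightarrow> FOb (twisted_tgt u) x = pfst (psnd x)"
  "m \<in> hom (twisted_cat u) x y \<Longrightarrow> FAr (twisted_tgt u) m = psnd (psnd m)"
  by (simp_all add: twisted_tgt_def)

lemma twisted_src_sel [simp]:
  "Src (twisted_src u) = twisted_cat u" "Tgt (twisted_src u) = op_cat (Tgt u)"
  "x \<in> Ob (twisted_cat u) \<Longrightarrow> FOb (twisted_src u) x = pfst x"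
  "m \<in> hom (twisted_cat u) x y \<Longrightarrow> FAr (twisted_src u) m = hom_map pfst pfst m"
  by (simp_all add: twisted_src_def)

lemma twisted_homE:
  assumes "m \<in> hom (twisted_cat u) x y"
  obtains p q where "m = pair (pair x y) (pair p q)" "p \<in> hom (Tgt u) (pfst y) (pfst x)"
    "q \<in> hom (Src u) (pfst (psnd x)) (pfst (psnd y))"
  using assms by (auto simp: hom_twisted_cat)

lemma twisted_tgt_is_functor:
  assumes u: "is_functor u"
  shows "is_functor (twisted_tgt u)"
  unfolding twisted_tgt_def
proof (rule is_functor_mkI)
  fix x y z f g assume f: "f \<in> hom (twisted_cat u) x y" and g: "g \<in> hom (twisted_cat u) y z"
  from f obtain p q where [simp]: "f = pair (pair x y) (pair p q)" by (rule twisted_homE)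
  from g obtain p' q' where [simp]: "g = pair (pair y z) (pair p' q')" by (rule twisted_homE)
  show "psnd (psnd (Cmp (twisted_cat u) g f)) = Cmp (Src u) (psnd (psnd g)) (psnd (psnd f))"
    using f g by (simp add: Cmp_twisted_cat)
qed (use u in \<open>auto simp: Ob_twisted_cat Idn_twisted_cat elim!: twisted_homE\<close>)

lemma twisted_src_is_functor:
  assumes u: "is_functor u"
  shows "is_functor (twisted_src u)"
  unfolding twisted_src_def
proof (rule is_functor_mkI)
  have B: "small_category (Tgt u)" using u by simp
  show "hom_map pfst pfst f \<in> hom (op_cat (Tgt u)) (pfst x) (pfst y)"
    if "f \<in> hom (twisted_cat u) x y" for f x y
    using that hom_Ob[OF B] by (auto simp: hom_op_cat elim!: twisted_homE)
  show "hom_map pfst pfst (Idn (twisted_cat u) x) = Idn (op_cat (Tgt u)) (pfst x)"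
    if "x \<in> Ob (twisted_cat u)" for x
  proof -
    have "pfst x \<in> Ob (Tgt u)" using that hom_Ob[OF B] by (auto simp: Ob_twisted_cat)
    then show ?thesis using that by (simp add: Idn_twisted_cat Idn_op_cat)
  qed
  fix x y z f g assume f: "f \<in> hom (twisted_cat u) x y" and g: "g \<in> hom (twisted_cat u) y z"
  from f obtain p q where [simp]: "f = pair (pair x y) (pair p q)" and
    p: "p \<in> hom (Tgt u) (pfst y) (pfst x)" by (rule twisted_homE)
  from g obtain p' q' where [simp]: "g = pair (pair y z) (pair p' q')" and
    p': "p' \<in> hom (Tgt u) (pfst z) (pfst y)" by (rule twisted_homE)
  show "hom_map pfst pfst (Cmp (twisted_cat u) g f) =
      Cmp (op_cat (Tgt u)) (hom_map pfst pfst g) (hom_map pfst pfst f)"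
    using f g by (simp add: Cmp_twisted_cat Cmp_op_cat[OF B p p'])
qed (use u hom_Ob[OF Tgt_small[OF u]] in \<open>auto simp: Ob_twisted_cat\<close>)

lemma Ob_over_twisted_tgt [simp]:
  "pair (pair b (pair a' g)) h \<in> Ob (over_cat (twisted_tgt u) a) \<longleftrightarrow>
    a' \<in> Ob (Src u) \<and> g \<in> hom (Tgt u) b (FOb u a') \<and> h \<in> hom (Src u) a' a"
proof -
  let ?x = "pair b (pair a' g)"
  have "?x \<in> Ob (twisted_cat u) \<Longrightarrow> pair ?x h \<in> Ob (over_cat (twisted_tgt u) a) \<longleftrightarrow>
      h \<in> hom (Src u) a' a"
    by (simp add: Ob_over_cat)
  moreover have "pair ?x h \<in> Ob (over_cat (twisted_tgt u) a) \<Longrightarrow> ?x \<in> Ob (twisted_cat u)"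
    by (auto simp: Ob_over_cat)
  moreover have "?x \<in> Ob (twisted_cat u) \<longleftrightarrow> a' \<in> Ob (Src u) \<and> g \<in> hom (Tgt u) b (FOb u a')"
    by (simp add: Ob_twisted_cat)
  ultimately show ?thesis by blast
qed

lemma over_twisted_tgtE:
  assumes "x \<in> Ob (over_cat (twisted_tgt u) a)"
  obtains b a' g h where "x = pair (pair b (pair a' g)) h" "a' \<in> Ob (Src u)"
    "g \<in> hom (Tgt u) b (FOb u a')" "h \<in> hom (Src u) a' a"
proof -
  from assms obtain y h where "x = pair y h" "y \<in> Ob (twisted_cat u)"
    by (auto simp: Ob_over_cat)
  then obtain b a' g where "x = pair (pair b (pair a' g)) h"
    by (auto simp: Ob_twisted_cat)
  with assms that show ?thesis by simp
qed

text \<open>A slice morphism is a tagged arrow whose raw part is again tagged. The double encoding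
  is opened here once, so that later computations see only the components \<open>p\<close> and
  \<open>q\<close>.\<close>

lemma hom_over_twisted_tgt:
  "hom (over_cat (twisted_tgt u) a) x y = {m.
    x \<in> Ob (over_cat (twisted_tgt u) a) \<and> y \<in> Ob (over_cat (twisted_tgt u) a) \<and>
    (\<exists>p q. m = pair (pair x y) (pair (pair (pfst x) (pfst y)) (pair p q)) \<and>
      pair (pair (pfst x) (pfst y)) (pair p q) \<in> hom (twisted_cat u) (pfst x) (pfst y) \<and>
      Cmp (Src u) (psnd y) q = psnd x)}"
proof -
  have "(\<exists>f. m = pair p f \<and> f \<in> hom (twisted_cat u) x y \<and> Q (FAr (twisted_tgt u) f)) \<longleftrightarrow>
    (\<exists>k q. m = pair p (pair (pair x y) (pair k q)) \<and>
      pair (pair x y) (pair k q) \<in> hom (twisted_cat u) x y \<and> Q q)" for m p x y Q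
  proof
    assume "\<exists>f. m = pair p f \<and> f \<in> hom (twisted_cat u) x y \<and> Q (FAr (twisted_tgt u) f)"
    then obtain f where f: "m = pair p f" "f \<in> hom (twisted_cat u) x y" "Q (FAr (twisted_tgt u) f)"
      by blast
    from f(2) obtain k q where "f = pair (pair x y) (pair k q)" by (rule twisted_homE)
    with f show "\<exists>k q. m = pair p (pair (pair x y) (pair k q)) \<and>
        pair (pair x y) (pair k q) \<in> hom (twisted_cat u) x y \<and> Q q" by auto
  next
    assume "\<exists>k q. m = pair p (pair (pair x y) (pair k q)) \<and>
        pair (pair x y) (pair k q) \<in> hom (twisted_cat u) x y \<and> Q q"
    then obtain k q where f: "m = pair p (pair (pair x y) (pair k q))"
        "pair (pair x y) (pair k q) \<in> hom (twisted_cat u) x y" "Q q" by blast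
    then show "\<exists>f. m = pair p f \<and> f \<in> hom (twisted_cat u) x y \<and> Q (FAr (twisted_tgt u) f)"
      by (intro exI[of _ "pair (pair x y) (pair k q)"]) simp
  qed
  from this[of _ "pair x y" "pfst x" "pfst y" "\<lambda>f. Cmp (Src u) (psnd y) f = psnd x"]
  show ?thesis
    unfolding hom_over_cat twisted_tgt_sel by simp
qed

lemma Cmp_over_twisted_tgt:
  assumes m: "pair (pair x y) (pair (pair (pfst x) (pfst y)) (pair p q)) \<in> hom (over_cat (twisted_tgt u) a) x y"
    (is "?m \<in> _")
    and n: "pair (pair y z) (pair (pair (pfst y) (pfst z)) (pair p' q')) \<in> hom (over_cat (twisted_tgt u) a) y z"
    (is "?n \<in> _")
  shows "Cmp (over_cat (twisted_tgt u) a) ?n ?m =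
    pair (pair x z) (pair (pair (pfst x) (pfst z)) (pair (Cmp (Tgt u) p p') (Cmp (Src u) q' q)))"
proof -
  have "pair (pair (pfst x) (pfst y)) (pair p q) \<in> hom (twisted_cat u) (pfst x) (pfst y)"
      "pair (pair (pfst y) (pfst z)) (pair p' q') \<in> hom (twisted_cat u) (pfst y) (pfst z)"
    using m n by (auto simp: hom_over_cat)
  then show ?thesis
    using Cmp_over_cat[OF m n] by (simp add: Cmp_twisted_cat)
qed

lemma Ob_over_twisted_src [simp]:
  "pair (pair b' (pair a g)) h \<in> Ob (over_cat (twisted_src u) b) \<longleftrightarrow>
    a \<in> Ob (Src u) \<and> g \<in> hom (Tgt u) b' (FOb u a) \<and> h \<in> hom (op_cat (Tgt u)) b' b"
proof -
  let ?x = "pair b' (pair a g)"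
  have "?x \<in> Ob (twisted_cat u) \<Longrightarrow> pair ?x h \<in> Ob (over_cat (twisted_src u) b) \<longleftrightarrow>
      h \<in> hom (op_cat (Tgt u)) b' b"
    by (simp add: Ob_over_cat)
  moreover have "pair ?x h \<in> Ob (over_cat (twisted_src u) b) \<Longrightarrow> ?x \<in> Ob (twisted_cat u)"
    by (auto simp: Ob_over_cat)
  moreover have "?x \<in> Ob (twisted_cat u) \<longleftrightarrow> a \<in> Ob (Src u) \<and> g \<in> hom (Tgt u) b' (FOb u a)"
    by (simp add: Ob_twisted_cat)
  ultimately show ?thesis by blast
qed

lemma over_twisted_srcE:
  assumes "x \<in> Ob (over_cat (twisted_src u) b)"
  obtains b' a g k where "x = pair (pair b' (pair a g)) (pair (pair b' b) k)" "a \<in> Ob (Src u)"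
    "g \<in> hom (Tgt u) b' (FOb u a)" "k \<in> hom (Tgt u) b b'"
proof -
  from assms obtain y h where "x = pair y h" "y \<in> Ob (twisted_cat u)"
    by (auto simp: Ob_over_cat)
  then obtain b' a g where x: "x = pair (pair b' (pair a g)) h"
    by (auto simp: Ob_twisted_cat)
  with assms obtain k where "h = pair (pair b' b) k" "k \<in> hom (Tgt u) b b'"
    by (auto simp: hom_op_cat)
  with x assms that show ?thesis by simp
qed

text \<open>The same unfolding for the other projection. The slice condition now lies in the
  opposite category, which is why \<open>p\<close> enters it with a tag.\<close>

lemma hom_over_twisted_src:
  "hom (over_cat (twisted_src u) b) x y = {m.
    x \<in> Ob (over_cat (twisted_src u) b) \<and> y \<in> Ob (over_cat (twisted_src u) b) \<and>
    (\<exists>p q. m = pair (pair x y) (pair (pair (pfst x) (pfst y)) (pair p q)) \<and>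
      pair (pair (pfst x) (pfst y)) (pair p q) \<in> hom (twisted_cat u) (pfst x) (pfst y) \<and>
      Cmp (op_cat (Tgt u)) (psnd y) (pair (pair (pfst (pfst x)) (pfst (pfst y))) p) = psnd x)}"
proof -
  have "(\<exists>f. m = pair p f \<and> f \<in> hom (twisted_cat u) x y \<and> Q (FAr (twisted_src u) f)) \<longleftrightarrow>
    (\<exists>k q. m = pair p (pair (pair x y) (pair k q)) \<and>
      pair (pair x y) (pair k q) \<in> hom (twisted_cat u) x y \<and> Q (pair (pair (pfst x) (pfst y)) k))"
    for m p x y Q
  proof
    assume "\<exists>f. m = pair p f \<and> f \<in> hom (twisted_cat u) x y \<and> Q (FAr (twisted_src u) f)"
    then obtain f where f: "m = pair p f" "f \<in> hom (twisted_cat u) x y" "Q (FAr (twisted_src u) f)"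
      by blast
    from f(2) obtain k q where "f = pair (pair x y) (pair k q)" by (rule twisted_homE)
    with f show "\<exists>k q. m = pair p (pair (pair x y) (pair k q)) \<and>
        pair (pair x y) (pair k q) \<in> hom (twisted_cat u) x y \<and> Q (pair (pair (pfst x) (pfst y)) k)" by auto
  next
    assume "\<exists>k q. m = pair p (pair (pair x y) (pair k q)) \<and>
        pair (pair x y) (pair k q) \<in> hom (twisted_cat u) x y \<and> Q (pair (pair (pfst x) (pfst y)) k)"
    then obtain k q where f: "m = pair p (pair (pair x y) (pair k q))"
        "pair (pair x y) (pair k q) \<in> hom (twisted_cat u) x y" "Q (pair (pair (pfst x) (pfst y)) k)" by blast
    then show "\<exists>f. m = pair p f \<and> f \<in> hom (twisted_cat u) x y \<and> Q (FAr (twisted_src u) f)"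
      by (intro exI[of _ "pair (pair x y) (pair k q)"]) simp
  qed
  from this[of _ "pair x y" "pfst x" "pfst y" "\<lambda>f. Cmp (op_cat (Tgt u)) (psnd y) f = psnd x"]
  show ?thesis
    unfolding hom_over_cat twisted_src_sel by simp
qed

lemma Cmp_over_twisted_src:
  assumes m: "pair (pair x y) (pair (pair (pfst x) (pfst y)) (pair p q)) \<in> hom (over_cat (twisted_src u) b) x y"
    (is "?m \<in> _")
    and n: "pair (pair y z) (pair (pair (pfst y) (pfst z)) (pair p' q')) \<in> hom (over_cat (twisted_src u) b) y z"
    (is "?n \<in> _")
  shows "Cmp (over_cat (twisted_src u) b) ?n ?m =
    pair (pair x z) (pair (pair (pfst x) (pfst z)) (pair (Cmp (Tgt u) p p') (Cmp (Src u) q' q)))"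
proof -
  have "pair (pair (pfst x) (pfst y)) (pair p q) \<in> hom (twisted_cat u) (pfst x) (pfst y)"
      "pair (pair (pfst y) (pfst z)) (pair p' q') \<in> hom (twisted_cat u) (pfst y) (pfst z)"
    using m n by (auto simp: hom_over_cat)
  then show ?thesis
    using Cmp_over_cat[OF m n] by (simp add: Cmp_twisted_cat)
qed

section \<open>Asphericity of source and target of a functor with aspherical coslices\<close>

context
  fixes W :: "'u::universe cat_functor set"
  assumes W: "weak_fundamental_localizer W"
begin

text \<open>Objects are chains g : b -> u(a'), h : a' -> a. Pushing forward along \<open>h\<close>
  reflects them onto the fibre \<open>R\<close>, where \<open>h\<close> is an identity. That fibre
  is the opposite of the slice of the target over u(a), so the terminal object of this slice becomes
  an initial one.\<close>

lemma over_twisted_tgt_aspherical: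
  assumes u: "is_functor u" and a: "a \<in> Ob (Src u)"
  shows "aspherical W (over_cat (twisted_tgt u) a)"
proof -
  let ?A = "Src u" and ?B = "Tgt u" and ?C = "over_cat (twisted_tgt u) a"
  have A: "small_category ?A" and B: "small_category ?B" using u by auto
  have ua: "FOb u a \<in> Ob ?B" using u a by simp
  define R where "R = {pair (pair b (pair a g)) (Idn ?A a) | b g. g \<in> hom ?B b (FOb u a)}"
  show ?thesis
  proof (rule aspherical_if_reflective_initial[OF W])
    show "small_category ?C"
      using twisted_tgt_is_functor[OF u] by simp
    show R: "R \<subseteq> Ob ?C"
      using a Idn_hom[OF A a] by (auto simp: R_def)
    fix x assume x: "x \<in> Ob ?C"
    then obtain b a' g h where x': "x = pair (pair b (pair a' g)) h" and
      a': "a' \<in> Ob ?A" and g: "g \<in> hom ?B b (FOb u a')" and h: "h \<in> hom ?A a' a"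
      by (rule over_twisted_tgtE)
    note uh = FAr_hom[OF u h]
    note hg = Cmp_hom[OF B g uh]
    have b: "b \<in> Ob ?B" using hom_Ob[OF B g] by simp
    \<comment> \<open>The pushforward of \<open>x\<close> along \<open>h\<close>: \<open>a'\<close>
      is replaced by \<open>a\<close> and \<open>g\<close> by u(h) g, with \<open>b\<close>
      unchanged.\<close>
    let ?r = "pair (pair b (pair a (Cmp ?B (FAr u h) g))) (Idn ?A a)"
    let ?\<eta> = "pair (pair x ?r) (pair (pair (pfst x) (pfst ?r)) (pair (Idn ?B b) h))"
    have r: "?r \<in> R" using hg by (auto simp: R_def)
    then have rC: "?r \<in> Ob ?C" using R by blast
    have \<eta>: "?\<eta> \<in> hom ?C x ?r"
      using x rC a a' g h hg b B Cmp_Idn_right[OF B g] Cmp_Idn_left[OF A h]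
      by (simp add: x' hom_over_twisted_tgt hom_twisted_cat Ob_twisted_cat)
    have "\<exists>!k. k \<in> hom ?C ?r y \<and> Cmp ?C k ?\<eta> = m" if y: "y \<in> R" and m: "m \<in> hom ?C x y" for y m
    proof -
      from y obtain c g' where y': "y = pair (pair c (pair a g')) (Idn ?A a)" and
        g': "g' \<in> hom ?B c (FOb u a)" by (auto simp: R_def)
      from m obtain p q where m': "m = pair (pair x y) (pair (pair (pfst x) (pfst y)) (pair p q))" and
        p: "p \<in> hom ?B c b" and q: "q \<in> hom ?A a' a" and
        pq: "Cmp ?B (FAr u q) (Cmp ?B g p) = g'" and "Cmp ?A (Idn ?A a) q = h"
        by (auto simp: x' y' hom_over_twisted_tgt hom_twisted_cat)
      \<comment> \<open>The last component of \<open>y\<close> is an identity, so the slice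
        condition determines the component of \<open>m\<close> in \<open>?A\<close>.\<close>
      then have qh: "q = h" using Cmp_Idn_left[OF A q] by simp
      have eq: "Cmp ?B (FAr u (Idn ?A a)) (Cmp ?B (Cmp ?B (FAr u h) g) p) = g'"
        using pq[unfolded qh] Cmp_assoc[OF B p g uh] Cmp_Idn_left[OF B Cmp_hom[OF B p hg]]
        by (simp add: FAr_Idn[OF u a])
      have homs: "k \<in> hom ?C ?r y \<longleftrightarrow> (\<exists>p' q'. k = pair (pair ?r y)
          (pair (pair (pfst ?r) (pfst y)) (pair p' q')) \<and> p' \<in> hom ?B c b \<and> q' = Idn ?A a \<and>
          Cmp ?B (FAr u q') (Cmp ?B (Cmp ?B (FAr u h) g) p') = g')" for k
      proof -
        have "Cmp ?A (Idn ?A a) q' = Idn ?A a \<longleftrightarrow> q' = Idn ?A a" if "q' \<in> hom ?A a a" for q'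
          using Cmp_Idn_left[OF A that] by simp
        then show ?thesis
          using rC y R hg g' a Idn_hom[OF A a]
          by (auto simp: y' hom_over_twisted_tgt hom_twisted_cat Ob_twisted_cat)
      qed
      have cmp: "Cmp ?C (pair (pair ?r y) (pair (pair (pfst ?r) (pfst y)) (pair p' (Idn ?A a)))) ?\<eta> =
          pair (pair x y) (pair (pair (pfst x) (pfst y)) (pair p' h))"
        if k: "pair (pair ?r y) (pair (pair (pfst ?r) (pfst y)) (pair p' (Idn ?A a))) \<in> hom ?C ?r y" for p'
      proof -
        have "p' \<in> hom ?B c b" using k unfolding homs by simp
        then show ?thesis
          unfolding Cmp_over_twisted_tgt[OF \<eta> k] using Cmp_Idn_left[OF B] Cmp_Idn_left[OF A h] by simp
      qed
      let ?k = "pair (pair ?r y) (pair (pair (pfst ?r) (pfst y)) (pair p (Idn ?A a)))"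
      have k: "?k \<in> hom ?C ?r y" unfolding homs using p eq by simp
      show ?thesis
      proof (rule ex1I[of _ ?k])
        show "?k \<in> hom ?C ?r y \<and> Cmp ?C ?k ?\<eta> = m"
          using k cmp[OF k] by (simp add: m' qh)
        fix k' assume k': "k' \<in> hom ?C ?r y \<and> Cmp ?C k' ?\<eta> = m"
        then obtain p' where *: "k' = pair (pair ?r y) (pair (pair (pfst ?r) (pfst y)) (pair p' (Idn ?A a)))"
          unfolding homs by blast
        with k' cmp[of p'] show "k' = ?k" by (simp add: m')
      qed
    qed
    with r \<eta> show "\<exists>r\<in>R. \<exists>e\<in>hom ?C x r. \<forall>y\<in>R. \<forall>g\<in>hom ?C x y.
        \<exists>!h. h \<in> hom ?C r y \<and> Cmp ?C h e = g" by blast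
  next
    \<comment> \<open>The identity of u(a): terminal in the slice over u(a), initial once
      \<open>b\<close> is contravariant.\<close>
    let ?c = "pair (pair (FOb u a) (pair a (Idn ?B (FOb u a)))) (Idn ?A a)"
    show c: "?c \<in> R" using Idn_hom[OF B ua] by (auto simp: R_def)
    fix y assume y: "y \<in> R"
    then obtain b g where y': "y = pair (pair b (pair a g)) (Idn ?A a)" and g: "g \<in> hom ?B b (FOb u a)"
      by (auto simp: R_def)
    have "k \<in> hom ?C ?c y \<longleftrightarrow>
        k = pair (pair ?c y) (pair (pair (pfst ?c) (pfst y)) (pair g (Idn ?A a)))" for k
    proof -
      have "Cmp ?A (Idn ?A a) q' = Idn ?A a \<longleftrightarrow> q' = Idn ?A a" if "q' \<in> hom ?A a a" for q'
        using Cmp_Idn_left[OF A that] by simp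
      moreover have "Cmp ?B (FAr u (Idn ?A a)) (Cmp ?B (Idn ?B (FOb u a)) p) = p"
        if "p \<in> hom ?B b (FOb u a)" for p
        using Cmp_Idn_left[OF B that] by (simp add: FAr_Idn[OF u a])
      ultimately show ?thesis
        using a g Idn_hom[OF B ua] Idn_hom[OF A a]
        by (auto simp: y' hom_over_twisted_tgt hom_twisted_cat Ob_twisted_cat)
    qed
    then show "\<exists>!k. k \<in> hom ?C ?c y" by simp
  qed
qed

text \<open>The coslice under \<open>b\<close> is the fibre, included in the slice with an identity
  as last component. Precomposition with an arrow b -> b' is the pushforward, so this inclusion is a
  right adjoint. Nothing is assumed about the fibre itself, hence an equivalence.\<close>

lemma over_twisted_src_aspherical_iff:
  assumes u: "is_functor u" and b: "b \<in> Ob (Tgt u)"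
  shows "aspherical W (over_cat (twisted_src u) b) \<longleftrightarrow> aspherical W (under_cat u b)"
proof -
  let ?A = "Src u" and ?B = "Tgt u" and ?C = "over_cat (twisted_src u) b" and ?F = "under_cat u b"
  have A: "small_category ?A" and B: "small_category ?B" using u by auto
  have C: "small_category ?C" using twisted_src_is_functor[OF u] by simp
  let ?I = "Idn ?B b"
  note 1 = Idn_hom[OF B b]
  \<comment> \<open>The fibre inclusion; \<open>pair (pair b b) ?I\<close> is the identity of
    \<open>b\<close> in the opposite category.\<close>
  define fo where "fo x = pair (pair b x) (pair (pair b b) ?I)" for x
  define fa where
    "fa m = pair (pair (fo (pfst (pfst m))) (fo (psnd (pfst m)))) (hom_map (pair b) (pair ?I) m)" for m
  have [simp]: "pfst (fo x) = pair b x" "psnd (fo x) = pair (pair b b) ?I" for x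
    by (simp_all add: fo_def)
  have fa_pair [simp]: "fa (pair (pair x y) f) =
      pair (pair (fo x) (fo y)) (pair (pair (pfst (fo x)) (pfst (fo y))) (pair ?I f))" for x y f
    by (simp add: fa_def)
  have fo: "fo x \<in> Ob ?C" if "x \<in> Ob ?F" for x
    using that b B by (auto simp: fo_def Ob_under_cat hom_op_cat)
  have fa: "fa m \<in> hom ?C (fo x) (fo y)" if m: "m \<in> hom ?F x y" for m x y
  proof -
    from m obtain f where m': "m = pair (pair x y) f" and f: "f \<in> hom ?A (pfst x) (pfst y)" and
      fe: "Cmp ?B (FAr u f) (psnd x) = psnd y" and x: "x \<in> Ob ?F" and y: "y \<in> Ob ?F"
      by (auto simp: hom_under_cat)
    obtain a g where [simp]: "x = pair a g" and g: "g \<in> hom ?B b (FOb u a)" and a: "a \<in> Ob ?A"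
      using x by (auto simp: Ob_under_cat)
    obtain a' g' where [simp]: "y = pair a' g'" and g': "g' \<in> hom ?B b (FOb u a')" and a': "a' \<in> Ob ?A"
      using y by (auto simp: Ob_under_cat)
    have "pair (pair (pfst (fo x)) (pfst (fo y))) (pair ?I f) \<in> hom (twisted_cat u) (pfst (fo x)) (pfst (fo y))"
      using f fe g a g' a' 1 by (simp add: hom_twisted_cat Ob_twisted_cat Cmp_Idn_right[OF B g])
    then show ?thesis
      using fo[OF x] fo[OF y] Cmp_op_cat[OF B 1 1] Cmp_Idn_left[OF B 1]
      by (auto simp: hom_over_twisted_src m')
  qed
  let ?i = "mk_functor ?F ?C fo fa"
  have i: "is_functor ?i"
  proof (rule is_functor_mkI)
    fix x assume x: "x \<in> Ob ?F"
    obtain a g where x': "x = pair a g" and a: "a \<in> Ob ?A"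
      using x by (auto simp: Ob_under_cat)
    have "pair b x \<in> Ob (twisted_cat u)"
      using x by (auto simp: Ob_under_cat Ob_twisted_cat)
    then show "fa (Idn ?F x) = Idn ?C (fo x)"
      using fo[OF x] x by (simp add: Idn_under_cat Idn_over_cat Idn_twisted_cat)
  next
    fix x y z f g assume f: "f \<in> hom ?F x y" and g: "g \<in> hom ?F y z"
    from f obtain f' where [simp]: "f = pair (pair x y) f'" by (auto simp: hom_under_cat)
    from g obtain g' where [simp]: "g = pair (pair y z) g'" by (auto simp: hom_under_cat)
    show "fa (Cmp ?F g f) = Cmp ?C (fa g) (fa f)"
      using Cmp_over_twisted_src[OF fa[OF f, simplified \<open>f = _\<close> fa_pair] fa[OF g, simplified \<open>g = _\<close> fa_pair]]
        Cmp_under_cat[of x y f' u b z g'] f g Cmp_Idn_left[OF B 1] by simp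
  qed (use u C fo fa in auto)
  have "aspherical W (Src ?i) \<longleftrightarrow> aspherical W (Tgt ?i)"
  proof (rule aspherical_iff_right_adjoint[OF W i])
    fix x assume "x \<in> Ob (Tgt ?i)"
    then have x: "x \<in> Ob ?C" by simp
    then obtain b' a g h where x': "x = pair (pair b' (pair a g)) (pair (pair b' b) h)" and
      a: "a \<in> Ob ?A" and g: "g \<in> hom ?B b' (FOb u a)" and h: "h \<in> hom ?B b b'"
      by (rule over_twisted_srcE)
    note gh = Cmp_hom[OF B h g]
    \<comment> \<open>The pushforward of \<open>x\<close> into the fibre over \<open>b\<close>, by
      composing \<open>g\<close> with \<open>h\<close>.\<close>
    let ?r = "pair a (Cmp ?B g h)"
    have r: "?r \<in> Ob ?F" using a gh by (simp add: Ob_under_cat)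
    note fr = fo[OF r]
    let ?\<eta> = "pair (pair x (fo ?r)) (pair (pair (pfst x) (pfst (fo ?r))) (pair h (Idn ?A a)))"
    have \<eta>: "?\<eta> \<in> hom ?C x (fo ?r)"
      using x fr a g h gh A Cmp_op_cat[OF B h 1] Cmp_Idn_right[OF B h] Cmp_Idn_left[OF B gh]
      by (simp add: x' hom_over_twisted_src hom_twisted_cat Ob_twisted_cat FAr_Idn[OF u])
    have "\<exists>!k. k \<in> hom ?F ?r y \<and> Cmp ?C (FAr ?i k) ?\<eta> = m"
      if y: "y \<in> Ob ?F" and m: "m \<in> hom ?C x (fo y)" for y m
    proof -
      from y obtain c g' where y': "y = pair c g'" and c: "c \<in> Ob ?A" and
        g': "g' \<in> hom ?B b (FOb u c)" by (auto simp: Ob_under_cat)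
      from m obtain p q where m': "m = pair (pair x (fo y)) (pair (pair (pfst x) (pfst (fo y))) (pair p q))" and
        p: "p \<in> hom ?B b b'" and q: "q \<in> hom ?A a c" and
        pq: "Cmp ?B (FAr u q) (Cmp ?B g p) = g'" and
        ph: "Cmp (op_cat ?B) (pair (pair b b) ?I) (pair (pair b' b) p) = pair (pair b' b) h"
        by (auto simp: x' y' hom_over_twisted_src hom_twisted_cat)
      \<comment> \<open>A morphism into the fibre has the identity of \<open>b\<close> on its target
        side, so the slice condition leaves no choice for \<open>p\<close>.\<close>
      from ph have [simp]: "p = h"
        using Cmp_op_cat[OF B p 1] Cmp_Idn_right[OF B p] by simp
      have homs: "k \<in> hom ?F ?r y \<longleftrightarrow> (\<exists>f. k = pair (pair ?r y) f \<and> f \<in> hom ?A a c \<and>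
          Cmp ?B (FAr u f) (Cmp ?B g h) = g')" for k
        using r y by (auto simp: hom_under_cat y')
      have cmp: "Cmp ?C (FAr ?i (pair (pair ?r y) f)) ?\<eta> =
          pair (pair x (fo y)) (pair (pair (pfst x) (pfst (fo y))) (pair h f))"
        if k: "pair (pair ?r y) f \<in> hom ?F ?r y" for f
      proof -
        have f: "f \<in> hom ?A a c" using k unfolding homs by simp
        show ?thesis
          using Cmp_over_twisted_src[OF \<eta> fa[OF k, simplified fa_pair]] FAr_mk_hom[OF k]
            Cmp_Idn_right[OF B h] Cmp_Idn_right[OF A f] by simp
      qed
      show ?thesis
      proof (rule ex1I[of _ "pair (pair ?r y) q"])
        have k: "pair (pair ?r y) q \<in> hom ?F ?r y"
          using q pq by (simp add: homs)
        then show "pair (pair ?r y) q \<in> hom ?F ?r y \<and> Cmp ?C (FAr ?i (pair (pair ?r y) q)) ?\<eta> = m"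
          using cmp[OF k] by (simp add: m')
        fix k' assume k': "k' \<in> hom ?F ?r y \<and> Cmp ?C (FAr ?i k') ?\<eta> = m"
        then obtain f where *: "k' = pair (pair ?r y) f"
          unfolding homs by blast
        with k' have "Cmp ?C (FAr ?i (pair (pair ?r y) f)) ?\<eta> = m" by simp
        with k' * cmp[of f] show "k' = pair (pair ?r y) q" by (simp add: m')
      qed
    qed
    note * = this
    show "\<exists>a\<in>Ob (Src ?i). \<exists>e\<in>hom (Tgt ?i) x (FOb ?i a).
        \<forall>a'\<in>Ob (Src ?i). \<forall>g\<in>hom (Tgt ?i) x (FOb ?i a').
          \<exists>!f. f \<in> hom (Src ?i) a a' \<and> Cmp (Tgt ?i) (FAr ?i f) e = g"
      by (rule bexI[of _ ?r], rule bexI[of _ ?\<eta>]) (use * r \<eta> in simp_all)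
  qed
  then show ?thesis by simp
qed

text \<open>The slice criterion applies to both legs of the span from the twisted category to the
  source of \<open>u\<close> and to the opposite of its target.\<close>

lemma aspherical_iff_op_if_under_cat:
  assumes u: "is_functor u" and A: "\<And>b. b \<in> Ob (Tgt u) \<Longrightarrow> aspherical W (under_cat u b)"
  shows "aspherical W (Src u) \<longleftrightarrow> aspherical W (op_cat (Tgt u))"
  using aspherical_iff_over_cat[OF W twisted_tgt_is_functor[OF u]]
    aspherical_iff_over_cat[OF W twisted_src_is_functor[OF u]]
    over_twisted_tgt_aspherical[OF u] over_twisted_src_aspherical_iff[OF u] A
  by simp

text \<open>The coslice counterpart of \<open>aspherical_iff_over_cat\<close>. The identity functor
  has aspherical coslices too and relates the target of \<open>u\<close> to the same opposite
  category, which cancels.\<close>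

lemma aspherical_iff_under_cat:
  assumes u: "is_functor u" and A: "\<And>b. b \<in> Ob (Tgt u) \<Longrightarrow> aspherical W (under_cat u b)"
  shows "aspherical W (Src u) \<longleftrightarrow> aspherical W (Tgt u)"
  using aspherical_iff_op_if_under_cat[OF u A]
    aspherical_iff_op_if_under_cat[of "id_functor (Tgt u)"] aspherical_under_cat_id[OF W] u
  by simp

end

section \<open>Exact squares\<close>

lemma FAr_comp_hom [simp]: "f \<in> hom (Src F) a b \<Longrightarrow> FAr (G \<circ>\<^sub>F F) f = FAr G (FAr F f)"
  by (simp add: hom_Ar)

context
  fixes D :: "'u::universe square"
  assumes D: "is_square D"
begin

lemma square_functors [simp]:
  "is_functor (Top D)" "is_functor (Bottom D)" "is_functor (Left D)" "is_functor (Right D)"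
  using D by (auto simp: is_square_def Let_def)

lemma square_cats [simp]:
  "Src (Left D) = Src (Top D)" "Tgt (Top D) = Src (Right D)"
  "Tgt (Left D) = Src (Bottom D)" "Tgt (Bottom D) = Tgt (Right D)"
  using D by (auto simp: is_square_def Let_def)

lemma square_small_categories [simp]:
  "small_category (Src (Top D))" "small_category (Src (Bottom D))"
  "small_category (Src (Right D))" "small_category (Tgt (Right D))"
  using D by (auto simp: is_square_def Let_def)

lemma Top_hom: "f \<in> hom (Src (Top D)) a b \<Longrightarrow>
    FAr (Top D) f \<in> hom (Src (Right D)) (FOb (Top D) a) (FOb (Top D) b)"
  using FAr_hom[OF square_functors(1)] by simp

lemma Bottom_hom: "f \<in> hom (Src (Bottom D)) a b \<Longrightarrow>
    FAr (Bottom D) f \<in> hom (Tgt (Right D)) (FOb (Bottom D) a) (FOb (Bottom D) b)"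
  using FAr_hom[OF square_functors(2)] by simp

lemma Left_hom: "f \<in> hom (Src (Top D)) a b \<Longrightarrow>
    FAr (Left D) f \<in> hom (Src (Bottom D)) (FOb (Left D) a) (FOb (Left D) b)"
  using FAr_hom[OF square_functors(3)] by simp

lemmas Right_hom = FAr_hom[OF square_functors(4)]

lemma Top_Ob: "a \<in> Ob (Src (Top D)) \<Longrightarrow> FOb (Top D) a \<in> Ob (Src (Right D))"
  and Bottom_Ob: "b \<in> Ob (Src (Bottom D)) \<Longrightarrow> FOb (Bottom D) b \<in> Ob (Tgt (Right D))"
  and Left_Ob: "a \<in> Ob (Src (Top D)) \<Longrightarrow> FOb (Left D) a \<in> Ob (Src (Bottom D))"
  using FOb_Ob[OF square_functors(1)] FOb_Ob[OF square_functors(2)] FOb_Ob[OF square_functors(3)]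
  by simp_all

lemma Top_Idn: "a \<in> Ob (Src (Top D)) \<Longrightarrow>
    FAr (Top D) (Idn (Src (Top D)) a) = Idn (Src (Right D)) (FOb (Top D) a)"
  and Left_Idn: "a \<in> Ob (Src (Top D)) \<Longrightarrow>
    FAr (Left D) (Idn (Src (Top D)) a) = Idn (Src (Bottom D)) (FOb (Left D) a)"
  and Bottom_Idn: "b \<in> Ob (Src (Bottom D)) \<Longrightarrow>
    FAr (Bottom D) (Idn (Src (Bottom D)) b) = Idn (Tgt (Right D)) (FOb (Bottom D) b)"
  using FAr_Idn[OF square_functors(1)] FAr_Idn[OF square_functors(2)] FAr_Idn[OF square_functors(3)]
  by simp_all

lemma Top_Cmp: "f \<in> hom (Src (Top D)) a b \<Longrightarrow> g \<in> hom (Src (Top D)) b c \<Longrightarrow>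
    FAr (Top D) (Cmp (Src (Top D)) g f) = Cmp (Src (Right D)) (FAr (Top D) g) (FAr (Top D) f)"
  using FAr_Cmp[OF square_functors(1)] by simp

lemma Left_Cmp: "f \<in> hom (Src (Top D)) a b \<Longrightarrow> g \<in> hom (Src (Top D)) b c \<Longrightarrow>
    FAr (Left D) (Cmp (Src (Top D)) g f) = Cmp (Src (Bottom D)) (FAr (Left D) g) (FAr (Left D) f)"
  using FAr_Cmp[OF square_functors(3)] by simp

lemma Bottom_Cmp: "f \<in> hom (Src (Bottom D)) a b \<Longrightarrow> g \<in> hom (Src (Bottom D)) b c \<Longrightarrow>
    FAr (Bottom D) (Cmp (Src (Bottom D)) g f) = Cmp (Tgt (Right D)) (FAr (Bottom D) g) (FAr (Bottom D) f)"
  using FAr_Cmp[OF square_functors(2)] by simp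

lemmas Right_Cmp = FAr_Cmp[OF square_functors(4)]
lemmas Right_Idn = FAr_Idn[OF square_functors(4)]

lemma Cell_hom: "a \<in> Ob (Src (Top D)) \<Longrightarrow>
    Cell D a \<in> hom (Tgt (Right D)) (FOb (Right D) (FOb (Top D) a)) (FOb (Bottom D) (FOb (Left D) a))"
  using D by (simp add: is_square_def Let_def)

lemma Cell_natural:
  assumes "f \<in> hom (Src (Top D)) a b"
  shows "Cmp (Tgt (Right D)) (Cell D b) (FAr (Right D) (FAr (Top D) f)) =
    Cmp (Tgt (Right D)) (FAr (Bottom D) (FAr (Left D) f)) (Cell D a)"
  using D assms unfolding is_square_def Let_def hom_def by auto

lemma Cell_ext: "Cell D \<in> extensional (Ob (Src (Top D)))"
  using D by (simp add: is_square_def Let_def)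

end

section \<open>The indexing categories of a square\<close>

lemma Ob_exact_cat:
  "Ob (exact_cat D a b g) = {pair a' (pair f g') | a' f g'. a' \<in> Ob (Src (Top D)) \<and>
     f \<in> hom (Src (Right D)) a (FOb (Top D) a') \<and> g' \<in> hom (Src (Bottom D)) (FOb (Left D) a') b \<and>
     Cmp (Tgt (Right D)) (FAr (Bottom D) g') (Cmp (Tgt (Right D)) (Cell D a') (FAr (Right D) f)) = g}"
  by (simp add: exact_cat_def Let_def)

lemma exact_catE:
  assumes "x \<in> Ob (exact_cat D a b g)"
  obtains a' f g' where "x = pair a' (pair f g')" "a' \<in> Ob (Src (Top D))"
    "f \<in> hom (Src (Right D)) a (FOb (Top D) a')" "g' \<in> hom (Src (Bottom D)) (FOb (Left D) a') b"
    "Cmp (Tgt (Right D)) (FAr (Bottom D) g') (Cmp (Tgt (Right D)) (Cell D a') (FAr (Right D) f)) = g"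
  using assms by (auto simp: Ob_exact_cat)

lemma hom_exact_cat:
  "hom (exact_cat D a b g) x y = {m. x \<in> Ob (exact_cat D a b g) \<and> y \<in> Ob (exact_cat D a b g) \<and>
    (\<exists>f. m = pair (pair x y) f \<and> f \<in> hom (Src (Top D)) (pfst x) (pfst y) \<and>
      Cmp (Src (Right D)) (FAr (Top D) f) (pfst (psnd x)) = pfst (psnd y) \<and>
      Cmp (Src (Bottom D)) (psnd (psnd y)) (FAr (Left D) f) = psnd (psnd x))}"
  by (auto simp: exact_cat_def Let_def hom_hom_cat)

lemma exact_homE:
  assumes "m \<in> hom (exact_cat D a b g) x y"
  obtains f where "m = pair (pair x y) f" "f \<in> hom (Src (Top D)) (pfst x) (pfst y)"
    "Cmp (Src (Right D)) (FAr (Top D) f) (pfst (psnd x)) = pfst (psnd y)"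
    "Cmp (Src (Bottom D)) (psnd (psnd y)) (FAr (Left D) f) = psnd (psnd x)"
    "x \<in> Ob (exact_cat D a b g)" "y \<in> Ob (exact_cat D a b g)"
  using assms by (auto simp: hom_exact_cat)

lemma Idn_exact_cat:
  "x \<in> Ob (exact_cat D a b g) \<Longrightarrow>
    Idn (exact_cat D a b g) x = pair (pair x x) (Idn (Src (Top D)) (pfst x))"
  by (simp add: exact_cat_def Let_def)

lemma Cmp_exact_cat:
  "pair (pair x y) f \<in> hom (exact_cat D a b g) x y \<Longrightarrow>
    pair (pair y z) f' \<in> hom (exact_cat D a b g) y z \<Longrightarrow>
    Cmp (exact_cat D a b g) (pair (pair y z) f') (pair (pair x y) f) =
      pair (pair x z) (Cmp (Src (Top D)) f' f)"
  unfolding exact_cat_def Let_def by (rule Cmp_hom_cat_hom)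

lemma small_category_exact_cat [simp]:
  assumes D: "is_square D"
  shows "small_category (exact_cat D a b g)"
  unfolding exact_cat_def Let_def
proof (rule hom_cat_over_small_category)
  let ?A' = "Src (Top D)" and ?A = "Src (Right D)" and ?B' = "Src (Bottom D)" and ?B = "Tgt (Right D)"
  note [simp] = square_functors[OF D] square_cats[OF D] square_small_categories[OF D]
  note cats = square_small_categories[OF D]
  let ?X = "{pair a' (pair f g') | a' f g'. a' \<in> Ob ?A' \<and>
     f \<in> hom ?A a (FOb (Top D) a') \<and> g' \<in> hom ?B' (FOb (Left D) a') b \<and>
     Cmp ?B (FAr (Bottom D) g') (Cmp ?B (Cell D a') (FAr (Right D) f)) = g}"
  let ?H = "\<lambda>x y. {f \<in> hom ?A' (pfst x) (pfst y).
      Cmp ?A (FAr (Top D) f) (pfst (psnd x)) = pfst (psnd y) \<and>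
      Cmp ?B' (psnd (psnd y)) (FAr (Left D) f) = psnd (psnd x)}"
  show "small ?X"
    by (rule small_subset[OF small_pairs[OF small_Ob[of ?A'] small_pairs[OF small_Ar[of ?A] small_Ar[of ?B']]]])
      (auto simp: hom_Ar)
  fix x y z f f' assume x: "x \<in> ?X" and z: "z \<in> ?X"
  from x have x': "pfst x \<in> Ob ?A'" "pfst (psnd x) \<in> hom ?A a (FOb (Top D) (pfst x))"
    "psnd (psnd x) \<in> hom ?B' (FOb (Left D) (pfst x)) b" by auto
  show "Idn ?A' (pfst x) \<in> ?H x x"
    using x' Cmp_Idn_left[OF cats(3) x'(2)] Cmp_Idn_right[OF cats(2) x'(3)]
    by (simp add: Top_Idn[OF D] Left_Idn[OF D])
  have z': "psnd (psnd z) \<in> hom ?B' (FOb (Left D) (pfst z)) b" using z by auto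
  assume "f \<in> ?H x y" "f' \<in> ?H y z"
  then have f: "f \<in> hom ?A' (pfst x) (pfst y)"
      "Cmp ?A (FAr (Top D) f) (pfst (psnd x)) = pfst (psnd y)"
      "Cmp ?B' (psnd (psnd y)) (FAr (Left D) f) = psnd (psnd x)" and
    f': "f' \<in> hom ?A' (pfst y) (pfst z)"
      "Cmp ?A (FAr (Top D) f') (pfst (psnd y)) = pfst (psnd z)"
      "Cmp ?B' (psnd (psnd z)) (FAr (Left D) f') = psnd (psnd y)"
    by auto
  show "Cmp ?A' f' f \<in> ?H x z"
    using f(2,3) f'(2,3) Cmp_hom[OF cats(1) f(1) f'(1)]
      Cmp_assoc[OF cats(3) x'(2) Top_hom[OF D f(1)] Top_hom[OF D f'(1)]]
      Cmp_assoc[OF cats(2) Left_hom[OF D f(1)] Left_hom[OF D f'(1)] z']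
    by (simp add: Top_Cmp[OF D f(1) f'(1)] Left_Cmp[OF D f(1) f'(1)])
qed (use D square_small_categories[OF D] in auto)

section \<open>Horizontal composition and the comparison of indexing categories\<close>

context
  fixes D D' :: "'u::universe square"
  assumes D: "is_square D" and D': "is_square D'" and R: "Right D' = Left D"
begin

lemma hcomp_sel [simp]:
  "Top (D \<circ>\<^sub>h D') = Top D \<circ>\<^sub>F Top D'" "Bottom (D \<circ>\<^sub>h D') = Bottom D \<circ>\<^sub>F Bottom D'"
  "Left (D \<circ>\<^sub>h D') = Left D'" "Right (D \<circ>\<^sub>h D') = Right D"
  "x \<in> Ob (Src (Top D')) \<Longrightarrow> Cell (D \<circ>\<^sub>h D') x =
     Cmp (Tgt (Right D)) (FAr (Bottom D) (Cell D' x)) (Cell D (FOb (Top D') x))"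
  by (simp_all add: hcomp_def)

lemma hcomp_cats:
  "Tgt (Top D') = Src (Top D)" "Tgt (Bottom D') = Src (Bottom D)"
  using R square_cats[OF D] square_cats[OF D'] by auto

lemma hcomp_Cell'_hom: "x \<in> Ob (Src (Top D')) \<Longrightarrow>
    Cell D' x \<in> hom (Src (Bottom D)) (FOb (Left D) (FOb (Top D') x)) (FOb (Bottom D') (FOb (Left D') x))"
  using Cell_hom[OF D'] square_cats[OF D] by (simp add: R)

lemma hcomp_Cell_hom: "x \<in> Ob (Src (Top D')) \<Longrightarrow>
    Cell D (FOb (Top D') x) \<in> hom (Tgt (Right D)) (FOb (Right D) (FOb (Top D) (FOb (Top D') x)))
      (FOb (Bottom D) (FOb (Left D) (FOb (Top D') x)))"
  using Cell_hom[OF D] Top_Ob[OF D'] square_cats[OF D] by (simp add: R)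

lemma hcomp_Top'_hom: "f \<in> hom (Src (Top D')) x y \<Longrightarrow>
    FAr (Top D') f \<in> hom (Src (Top D)) (FOb (Top D') x) (FOb (Top D') y)"
  using Top_hom[OF D'] square_cats[OF D] by (simp add: R)

lemma hcomp_Bottom'_hom: "f \<in> hom (Src (Bottom D')) x y \<Longrightarrow>
    FAr (Bottom D') f \<in> hom (Src (Bottom D)) (FOb (Bottom D') x) (FOb (Bottom D') y)"
  using Bottom_hom[OF D'] square_cats[OF D] by (simp add: R)

lemma hcomp_is_square: "is_square (D \<circ>\<^sub>h D')"
proof -
  let ?A' = "Src (Top D)" and ?A = "Src (Right D)" and ?B' = "Src (Bottom D)" and ?B = "Tgt (Right D)"
  let ?v = "Top D" and ?w = "Bottom D" and ?u' = "Left D" and ?u = "Right D"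
  let ?v' = "Top D'" and ?w' = "Bottom D'" and ?u'' = "Left D'"
  let ?A'' = "Src ?v'"
  have B: "small_category ?B" using square_small_categories[OF D] by simp
  note [simp] = square_functors[OF D] square_cats[OF D] square_functors[OF D'] square_cats[OF D'] hcomp_cats
  note c' = hcomp_Cell'_hom and c = hcomp_Cell_hom
  have cell: "Cell (D \<circ>\<^sub>h D') x \<in> hom ?B (FOb ?u (FOb ?v (FOb ?v' x))) (FOb ?w (FOb ?w' (FOb ?u'' x)))"
    if "x \<in> Ob ?A''" for x
    using Cmp_hom[OF B c[OF that] Bottom_hom[OF D c'[OF that]]] that by simp
  have nat: "Cmp ?B (Cell (D \<circ>\<^sub>h D') y) (FAr ?u (FAr ?v (FAr ?v' f))) =
      Cmp ?B (FAr ?w (FAr ?w' (FAr ?u'' f))) (Cell (D \<circ>\<^sub>h D') x)"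
    if f: "f \<in> hom ?A'' x y" for f x y
  proof -
    have xy: "x \<in> Ob ?A''" "y \<in> Ob ?A''"
      using hom_Ob[OF square_small_categories(1)[OF D'] f] by auto
    note vf = hcomp_Top'_hom[OF f]
    note uvf = Right_hom[OF D Top_hom[OF D vf]]
    note wwf = Bottom_hom[OF D hcomp_Bottom'_hom[OF Left_hom[OF D' f]]]
    \<comment> \<open>Naturality of the pasted cell: the arrow is moved across \<open>D\<close> by
      naturality at v'(f), then across the image under \<open>?w\<close> of the naturality square of
      \<open>D'\<close>.\<close>
    have "Cmp ?B (Cell (D \<circ>\<^sub>h D') y) (FAr ?u (FAr ?v (FAr ?v' f))) =
        Cmp ?B (FAr ?w (Cell D' y)) (Cmp ?B (Cell D (FOb ?v' y)) (FAr ?u (FAr ?v (FAr ?v' f))))"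
      using Cmp_assoc[OF B uvf c[OF xy(2)] Bottom_hom[OF D c'[OF xy(2)]]] xy by simp
    also have "\<dots> = Cmp ?B (Cmp ?B (FAr ?w (Cell D' y)) (FAr ?w (FAr ?u' (FAr ?v' f)))) (Cell D (FOb ?v' x))"
      using Cmp_assoc[OF B c[OF xy(1)] Bottom_hom[OF D Left_hom[OF D vf]] Bottom_hom[OF D c'[OF xy(2)]]]
      by (simp add: Cell_natural[OF D vf])
    also have "Cmp ?B (FAr ?w (Cell D' y)) (FAr ?w (FAr ?u' (FAr ?v' f))) =
        Cmp ?B (FAr ?w (FAr ?w' (FAr ?u'' f))) (FAr ?w (Cell D' x))"
      using Cell_natural[OF D' f] Bottom_Cmp[OF D Left_hom[OF D vf] c'[OF xy(2)]]
        Bottom_Cmp[OF D c'[OF xy(1)] hcomp_Bottom'_hom[OF Left_hom[OF D' f]]]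
      by (simp add: R)
    also have "Cmp ?B \<dots> (Cell D (FOb ?v' x)) = Cmp ?B (FAr ?w (FAr ?w' (FAr ?u'' f))) (Cell (D \<circ>\<^sub>h D') x)"
      using Cmp_assoc[OF B c[OF xy(1)] Bottom_hom[OF D c'[OF xy(1)]] wwf] xy by simp
    finally show ?thesis .
  qed
  have "FAr (?v \<circ>\<^sub>F ?v') f = FAr ?v (FAr ?v' f)" if "f \<in> Ar ?A''" for f
    using that by simp
  moreover have "FAr (?w \<circ>\<^sub>F ?w') (FAr ?u'' f) = FAr ?w (FAr ?w' (FAr ?u'' f))" if "f \<in> Ar ?A''" for f
    using Left_hom[OF D' homI[OF that]] by simp
  moreover have "Cell (D \<circ>\<^sub>h D') \<in> extensional (Ob ?A'')"
    by (simp add: hcomp_def)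
  ultimately show ?thesis
    unfolding is_square_def Let_def
    using cell nat[OF homI] Left_Ob[OF D'] comp_is_functor[OF _ _ hcomp_cats(1)]
      comp_is_functor[OF _ _ hcomp_cats(2)] by simp
qed

text \<open>Collecting w'(k) and the cell of \<open>D'\<close> into one arrow of the lower left
  category of \<open>D\<close> turns the condition for the composite into the condition for
  \<open>D\<close>.\<close>

lemma hcomp_exact_cell:
  assumes x: "x \<in> Ob (Src (Top D'))" and f: "f \<in> hom (Src (Right D)) a (FOb (Top D) (FOb (Top D') x))"
    and k: "k \<in> hom (Src (Bottom D')) (FOb (Left D') x) b"
  shows "Cmp (Tgt (Right D)) (FAr (Bottom D \<circ>\<^sub>F Bottom D') k)
      (Cmp (Tgt (Right D)) (Cell (D \<circ>\<^sub>h D') x) (FAr (Right D) f)) =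
    Cmp (Tgt (Right D)) (FAr (Bottom D) (Cmp (Src (Bottom D)) (FAr (Bottom D') k) (Cell D' x)))
      (Cmp (Tgt (Right D)) (Cell D (FOb (Top D') x)) (FAr (Right D) f))"
proof -
  have B: "small_category (Tgt (Right D))" using square_small_categories[OF D] by simp
  note c' = hcomp_Cell'_hom[OF x] and c = hcomp_Cell_hom[OF x]
  note uf = Right_hom[OF D f] and wk = hcomp_Bottom'_hom[OF k]
  show ?thesis
    using x k Cmp_assoc[OF B uf c Bottom_hom[OF D c']] Bottom_Cmp[OF D c' wk]
      Cmp_assoc[OF B Cmp_hom[OF B uf c] Bottom_hom[OF D c'] Bottom_hom[OF D wk]]
    by simp
qed

text \<open>The cell of \<open>D'\<close> provides the last component: an arrow from u'(v'(a'')) to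
  w'(b), as the indexing category of \<open>D\<close> requires.\<close>

definition hcomp_fo :: "'u \<Rightarrow> 'u" where
  "hcomp_fo y = pair (FOb (Top D') (pfst y)) (pair (pfst (psnd y))
     (Cmp (Src (Bottom D)) (FAr (Bottom D') (psnd (psnd y))) (Cell D' (pfst y))))"

text \<open>The coslices of this functor are the indexing categories of \<open>D'\<close>.\<close>

definition hcomp_comparison :: "'u \<Rightarrow> 'u \<Rightarrow> 'u \<Rightarrow> 'u cat_functor" where
  "hcomp_comparison a b g = mk_functor (exact_cat (D \<circ>\<^sub>h D') a b g)
     (exact_cat D a (FOb (Bottom D') b) g) hcomp_fo (hom_map hcomp_fo (FAr (Top D')))"

lemma hcomp_fo_Ob:
  assumes y: "y \<in> Ob (exact_cat (D \<circ>\<^sub>h D') a b g)"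
  shows "hcomp_fo y \<in> Ob (exact_cat D a (FOb (Bottom D') b) g)"
proof -
  from y obtain x f k where [simp]: "y = pair x (pair f k)" and x: "x \<in> Ob (Src (Top D'))" and
    f: "f \<in> hom (Src (Right D)) a (FOb (Top D) (FOb (Top D') x))" and
    k: "k \<in> hom (Src (Bottom D')) (FOb (Left D') x) b" and
    g: "Cmp (Tgt (Right D)) (FAr (Bottom D \<circ>\<^sub>F Bottom D') k)
      (Cmp (Tgt (Right D)) (Cell (D \<circ>\<^sub>h D') x) (FAr (Right D) f)) = g"
    by (rule exact_catE) simp
  show ?thesis
    using g[unfolded hcomp_exact_cell[OF x f k]] x f Top_Ob[OF D' x] hcomp_cats
      Cmp_hom[OF square_small_categories(2)[OF D] hcomp_Cell'_hom[OF x] hcomp_Bottom'_hom[OF k]]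
    by (simp add: hcomp_fo_def Ob_exact_cat square_cats[OF D'])
qed

text \<open>The condition on the first arrow carries over unchanged; the one on the last arrow is
  naturality of the cell of \<open>D'\<close>.\<close>

lemma hcomp_hom_map:
  assumes "m \<in> hom (exact_cat (D \<circ>\<^sub>h D') a b g) y z"
  shows "hom_map hcomp_fo (FAr (Top D')) m \<in>
    hom (exact_cat D a (FOb (Bottom D') b) g) (hcomp_fo y) (hcomp_fo z)"
proof -
  let ?B' = "Src (Bottom D)"
  have B': "small_category ?B'" using square_small_categories[OF D] by simp
  from assms obtain f where [simp]: "m = pair (pair y z) f" and f: "f \<in> hom (Src (Top D')) (pfst y) (pfst z)" and
      f1: "Cmp (Src (Right D)) (FAr (Top D) (FAr (Top D') f)) (pfst (psnd y)) = pfst (psnd z)" and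
      f2: "Cmp (Src (Bottom D')) (psnd (psnd z)) (FAr (Left D') f) = psnd (psnd y)" and
      y: "y \<in> Ob (exact_cat (D \<circ>\<^sub>h D') a b g)" and z: "z \<in> Ob (exact_cat (D \<circ>\<^sub>h D') a b g)"
    by (rule exact_homE) simp
  have yo: "pfst y \<in> Ob (Src (Top D'))" using y by (auto simp: Ob_exact_cat)
  have zo: "pfst z \<in> Ob (Src (Top D'))" "psnd (psnd z) \<in> hom (Src (Bottom D')) (FOb (Left D') (pfst z)) b"
    using z by (auto simp: Ob_exact_cat)
  note uf = Left_hom[OF D' f] and w'z = hcomp_Bottom'_hom[OF zo(2)]
  have "Cmp ?B' (Cmp ?B' (FAr (Bottom D') (psnd (psnd z))) (Cell D' (pfst z)))
      (FAr (Left D) (FAr (Top D') f)) =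
      Cmp ?B' (FAr (Bottom D') (psnd (psnd z))) (Cmp ?B' (FAr (Bottom D') (FAr (Left D') f)) (Cell D' (pfst y)))"
    using Cmp_assoc[OF B' Left_hom[OF D hcomp_Top'_hom[OF f]] hcomp_Cell'_hom[OF zo(1)] w'z]
      Cell_natural[OF D' f] square_cats[OF D] by (simp add: R)
  also have "\<dots> = Cmp ?B' (FAr (Bottom D') (psnd (psnd y))) (Cell D' (pfst y))"
    using Cmp_assoc[OF B' hcomp_Cell'_hom[OF yo] hcomp_Bottom'_hom[OF uf] w'z]
      Bottom_Cmp[OF D' uf zo(2)] f2 square_cats[OF D] by (simp add: R)
  finally show ?thesis
    using hcomp_fo_Ob[OF y] hcomp_fo_Ob[OF z] hcomp_Top'_hom[OF f] f1
    by (simp add: hom_exact_cat) (simp add: hcomp_fo_def)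
qed

lemma hcomp_comparison_is_functor: "is_functor (hcomp_comparison a b g)"
  unfolding hcomp_comparison_def
proof (rule is_functor_mkI)
  let ?E = "exact_cat (D \<circ>\<^sub>h D') a b g"
  have [simp]: "pfst (hcomp_fo y) = FOb (Top D') (pfst y)" for y
    by (simp add: hcomp_fo_def)
  fix y assume y: "y \<in> Ob ?E"
  then have "pfst y \<in> Ob (Src (Top D'))" by (auto simp: Ob_exact_cat)
  then show "hom_map hcomp_fo (FAr (Top D')) (Idn ?E y) =
      Idn (exact_cat D a (FOb (Bottom D') b) g) (hcomp_fo y)"
    using y hcomp_fo_Ob[OF y] hcomp_cats Top_Idn[OF D'] square_cats[OF D']
    by (simp add: Idn_exact_cat)
next
  let ?E = "exact_cat (D \<circ>\<^sub>h D') a b g"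
  fix x y z m n assume m: "m \<in> hom ?E x y" and n: "n \<in> hom ?E y z"
  from m obtain f where [simp]: "m = pair (pair x y) f" and f: "f \<in> hom (Src (Top D')) (pfst x) (pfst y)"
    by (rule exact_homE) simp
  from n obtain f' where [simp]: "n = pair (pair y z) f'" and f': "f' \<in> hom (Src (Top D')) (pfst y) (pfst z)"
    by (rule exact_homE) simp
  show "hom_map hcomp_fo (FAr (Top D')) (Cmp ?E n m) =
      Cmp (exact_cat D a (FOb (Bottom D') b) g)
        (hom_map hcomp_fo (FAr (Top D')) n) (hom_map hcomp_fo (FAr (Top D')) m)"
    using m n hcomp_hom_map[OF m] hcomp_hom_map[OF n] Top_Cmp[OF D' f f'] hcomp_cats square_cats[OF D']
    by (simp add: Cmp_exact_cat)
qed (use hcomp_fo_Ob hcomp_hom_map hcomp_is_square D in auto)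

lemma hcomp_comparison_sel [simp]:
  "Src (hcomp_comparison a b g) = exact_cat (D \<circ>\<^sub>h D') a b g"
  "Tgt (hcomp_comparison a b g) = exact_cat D a (FOb (Bottom D') b) g"
  "y \<in> Ob (exact_cat (D \<circ>\<^sub>h D') a b g) \<Longrightarrow> FOb (hcomp_comparison a b g) y = hcomp_fo y"
  "m \<in> hom (exact_cat (D \<circ>\<^sub>h D') a b g) y z \<Longrightarrow>
    FAr (hcomp_comparison a b g) m = hom_map hcomp_fo (FAr (Top D')) m"
  by (simp_all add: hcomp_comparison_def)

end

section \<open>Horizontal composition with an exact square\<close>

context
  fixes W :: "'u::universe cat_functor set"
  assumes W: "weak_fundamental_localizer W"
begin

context
  fixes D D' :: "'u square"
  assumes D: "is_square D" and D': "is_square D'" and R: "Right D' = Left D"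
begin

text \<open>With x = (a', f, g'), an object under \<open>x\<close> consists of (a'', f2, k) and an
  arrow h : a' -> v'(a'') with v(h) f = f2. So f2 is redundant, and what is left is (a'', h, k) with
  the remaining compatibility, namely that w'(k) after the cell of \<open>D'\<close> after u'(h) is
  g'. This is an object of the indexing category of \<open>D'\<close>.\<close>

lemma under_hcomp_comparison_aspherical_iff:
  assumes x: "x \<in> Ob (exact_cat D a (FOb (Bottom D') b) g)"
  shows "aspherical W (under_cat (hcomp_comparison D D' a b g) x) \<longleftrightarrow>
    aspherical W (exact_cat D' (pfst x) b (psnd (psnd x)))"
proof -
  let ?A = "Src (Right D)" and ?A' = "Src (Top D)" and ?A'' = "Src (Top D')"
  let ?B = "Tgt (Right D)" and ?B' = "Src (Bottom D)" and ?B'' = "Src (Bottom D')"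
  let ?v = "Top D" and ?w = "Bottom D" and ?u' = "Left D" and ?u = "Right D"
  let ?v' = "Top D'" and ?w' = "Bottom D'" and ?u'' = "Left D'"
  let ?\<Phi> = "hcomp_comparison D D' a b g" and ?E = "exact_cat (D \<circ>\<^sub>h D') a b g"
  let ?U = "under_cat ?\<Phi> x" and ?E' = "exact_cat D' (pfst x) b (psnd (psnd x))"
  let ?T = "exact_cat D a (FOb ?w' b) g"
  have A: "small_category ?A" and B: "small_category ?B" and B': "small_category ?B'"
    using square_small_categories[OF D] by auto
  note \<Phi> = hcomp_comparison_is_functor[OF D D' R, of a b g]
  have cats' [simp]: "Src (Right D') = ?A'" "Tgt (Right D') = ?B'"
    using R square_cats[OF D] by simp_all
  have [simp]: "is_square (D \<circ>\<^sub>h D')" by (rule hcomp_is_square[OF D D' R])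
  note sel [simp] = hcomp_comparison_sel[OF D D' R] hcomp_sel[OF D D' R]
  from x obtain a' f g' where x': "x = pair a' (pair f g')" and a': "a' \<in> Ob ?A'" and
    f: "f \<in> hom ?A a (FOb ?v a')" and g': "g' \<in> hom ?B' (FOb ?u' a') (FOb ?w' b)" and
    gx: "Cmp ?B (FAr ?w g') (Cmp ?B (Cell D a') (FAr ?u f)) = g"
    by (rule exact_catE)
  \<comment> \<open>Recovers the object for the composite from (a'', h, k), its middle arrow being
    v(h) f.\<close>
  define e where
    "e y = pair (pfst y) (pair (Cmp ?A (FAr ?v (pfst (psnd y))) f) (psnd (psnd y)))" for y
  define fo where "fo y = pair (e y) (pair (pair x (hcomp_fo D D' (e y))) (pfst (psnd y)))" for y
  define fa where
    "fa m = pair (pair (fo (pfst (pfst m))) (fo (psnd (pfst m)))) (hom_map e (\<lambda>n. n) m)" for m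
  have [simp]: "pfst (fo y) = e y" "psnd (fo y) = pair (pair x (hcomp_fo D D' (e y))) (pfst (psnd y))"
      "pfst (e y) = pfst y" "pfst (psnd (e y)) = Cmp ?A (FAr ?v (pfst (psnd y))) f"
      "psnd (psnd (e y)) = psnd (psnd y)" for y
    by (simp_all add: fo_def e_def)
  have fa_pair [simp]: "fa (pair (pair y z) n) = pair (pair (fo y) (fo z)) (pair (pair (e y) (e z)) n)" for y z n
    by (simp add: fa_def)
  \<comment> \<open>Membership with the composition regrouped: \<open>hcomp_fo\<close> produces the
    composite of w'(k) and the cell as a single arrow.\<close>
  have E'_iff: "pair a'' (pair h k) \<in> Ob ?E' \<longleftrightarrow> a'' \<in> Ob ?A'' \<and> h \<in> hom ?A' a' (FOb ?v' a'') \<and>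
      k \<in> hom ?B'' (FOb ?u'' a'') b \<and>
      Cmp ?B' (Cmp ?B' (FAr ?w' k) (Cell D' a'')) (FAr ?u' h) = g'" for a'' h k
  proof -
    have "Cmp ?B' (FAr ?w' k) (Cmp ?B' (Cell D' a'') (FAr ?u' h)) =
        Cmp ?B' (Cmp ?B' (FAr ?w' k) (Cell D' a'')) (FAr ?u' h)"
      if "a'' \<in> Ob ?A''" "h \<in> hom ?A' a' (FOb ?v' a'')" "k \<in> hom ?B'' (FOb ?u'' a'') b"
      by (rule Cmp_assoc[OF B' Left_hom[OF D that(2)] hcomp_Cell'_hom[OF D D' R that(1)]
            hcomp_Bottom'_hom[OF D D' R that(3)]])
    then show ?thesis
      by (auto simp: x' Ob_exact_cat R square_cats[OF D])
  qed
  \<comment> \<open>Naturality of the cell of \<open>D\<close> at \<open>h\<close> trades u(v(h))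
    for w(u'(h)), and the equation for g' then reduces the claim to the equation satisfied by
    \<open>x\<close>.\<close>
  have eE: "e (pair a'' (pair h k)) \<in> Ob ?E"
    if a'': "a'' \<in> Ob ?A''" and h: "h \<in> hom ?A' a' (FOb ?v' a'')" and k: "k \<in> hom ?B'' (FOb ?u'' a'') b"
      and eq: "Cmp ?B' (Cmp ?B' (FAr ?w' k) (Cell D' a'')) (FAr ?u' h) = g'" for a'' h k
  proof -
    note vh = Top_hom[OF D h] and kc = Cmp_hom[OF B' hcomp_Cell'_hom[OF D D' R a''] hcomp_Bottom'_hom[OF D D' R k]]
    have hf: "Cmp ?A (FAr ?v h) f \<in> hom ?A a (FOb ?v (FOb ?v' a''))"
      by (rule Cmp_hom[OF A f vh])
    let ?kc = "Cmp ?B' (FAr ?w' k) (Cell D' a'')"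
    note uf = Right_hom[OF D f] and uvh = Right_hom[OF D vh] and c = hcomp_Cell_hom[OF D D' R a'']
      and c' = Cell_hom[OF D a'] and wkc = Bottom_hom[OF D kc] and wuh = Bottom_hom[OF D Left_hom[OF D h]]
    have "Cmp ?B (FAr ?w ?kc) (Cmp ?B (Cell D (FOb ?v' a'')) (FAr ?u (Cmp ?A (FAr ?v h) f))) =
        Cmp ?B (FAr ?w ?kc) (Cmp ?B (Cmp ?B (Cell D (FOb ?v' a'')) (FAr ?u (FAr ?v h))) (FAr ?u f))"
      using Cmp_assoc[OF B uf uvh c] by (simp add: Right_Cmp[OF D f vh])
    also have "\<dots> = Cmp ?B (FAr ?w ?kc) (Cmp ?B (FAr ?w (FAr ?u' h)) (Cmp ?B (Cell D a') (FAr ?u f)))"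
      using Cmp_assoc[OF B uf c' wuh] by (simp add: Cell_natural[OF D h])
    also have "\<dots> = Cmp ?B (FAr ?w g') (Cmp ?B (Cell D a') (FAr ?u f))"
      using Cmp_assoc[OF B Cmp_hom[OF B uf c'] wuh wkc] Bottom_Cmp[OF D Left_hom[OF D h] kc]
      by (simp add: eq)
    finally show ?thesis
      using a'' k hf hcomp_exact_cell[OF D D' R a'' hf k] gx
      by (simp add: e_def Ob_exact_cat)
  qed
  have fo: "fo y \<in> Ob ?U" if y: "y \<in> Ob ?E'" for y
  proof -
    obtain a'' h k where y': "y = pair a'' (pair h k)"
      using y by (auto simp: Ob_exact_cat)
    note * = y[unfolded y' E'_iff]
    have ey: "e y \<in> Ob ?E" using eE * unfolding y' by blast
    have "pair (pair x (hcomp_fo D D' (e y))) h \<in> hom ?T x (hcomp_fo D D' (e y))"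
      using x hcomp_fo_Ob[OF D D' R ey] * 
      by (simp add: hom_exact_cat y' x') (simp add: hcomp_fo_def[OF D D' R])
    then show ?thesis
      using ey by (simp add: Ob_under_cat fo_def y')
  qed
  have hom_iff: "pair (pair (fo y) (fo z)) (pair (pair (e y) (e z)) n) \<in> hom ?U (fo y) (fo z) \<longleftrightarrow>
      pair (pair y z) n \<in> hom ?E' y z"
    if y: "y \<in> Ob ?E'" and z: "z \<in> Ob ?E'" for y z n
  proof -
    obtain a1 h1 k1 where y': "y = pair a1 (pair h1 k1)"
      using y by (auto simp: Ob_exact_cat)
    obtain a2 h2 k2 where z': "z = pair a2 (pair h2 k2)"
      using z by (auto simp: Ob_exact_cat)
    note y1 = y[unfolded y' E'_iff] and z1 = z[unfolded z' E'_iff]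
    have ey: "e y \<in> Ob ?E" and ez: "e z \<in> Ob ?E"
      using eE y1 z1 unfolding y' z' by blast+
    let ?n = "pair (pair (e y) (e z)) n"
    have hy: "pair (pair x (hcomp_fo D D' (e y))) h1 \<in> hom ?T x (hcomp_fo D D' (e y))"
      using fo[OF y] ey by (auto simp: Ob_under_cat fo_def y')
    have E_iff: "?n \<in> hom ?E (e y) (e z) \<longleftrightarrow> n \<in> hom ?A'' a1 a2 \<and>
        Cmp ?A (FAr ?v (FAr ?v' n)) (Cmp ?A (FAr ?v h1) f) = Cmp ?A (FAr ?v h2) f \<and>
        Cmp ?B'' k2 (FAr ?u'' n) = k1"
      using ey ez by (auto simp: hom_exact_cat y' z')
    \<comment> \<open>Applying v to v'(n) h1 = h2 thus yields the equation in \<open>?A\<close> of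
      \<open>E_iff\<close>, so this equation imposes no further restriction on n.\<close>
    have comp: "Cmp ?A (FAr ?v (FAr ?v' n)) (Cmp ?A (FAr ?v h1) f) =
        Cmp ?A (FAr ?v (Cmp ?A' (FAr ?v' n) h1)) f"
      if n: "n \<in> hom ?A'' a1 a2"
      using Cmp_assoc[OF A f Top_hom[OF D, of h1] Top_hom[OF D hcomp_Top'_hom[OF D D' R n]]] y1
        Top_Cmp[OF D _ hcomp_Top'_hom[OF D D' R n]] by auto
    \<comment> \<open>The coslice condition compares tagged arrows whose tags already agree; only
      their raw parts give an equation.\<close>
    have U_iff: "Cmp ?T (FAr ?\<Phi> ?n) (psnd (fo y)) = psnd (fo z) \<longleftrightarrow> Cmp ?A' (FAr ?v' n) h1 = h2"
      if n: "?n \<in> hom ?E (e y) (e z)"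
      using Cmp_exact_cat[OF hy hcomp_hom_map[OF D D' R n, unfolded hom_map_pair]] n
      by (simp add: y' z')
    have "pair (pair (fo y) (fo z)) ?n \<in> hom ?U (fo y) (fo z) \<longleftrightarrow>
        ?n \<in> hom ?E (e y) (e z) \<and> Cmp ?A' (FAr ?v' n) h1 = h2"
      using fo[OF y] fo[OF z] U_iff by (auto simp: hom_under_cat)
    also have "\<dots> \<longleftrightarrow> pair (pair y z) n \<in> hom ?E' y z"
      using y z comp unfolding E_iff by (auto simp: hom_exact_cat y' z')
    finally show ?thesis .
  qed
  have U_homE: "\<exists>n. m = pair (pair (fo y) (fo z)) (pair (pair (e y) (e z)) n)"
    if "m \<in> hom ?U (fo y) (fo z)" for m y z
    using that by (auto simp: hom_under_cat elim!: exact_homE)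
  let ?\<Psi> = "mk_functor ?E' ?U fo fa"
  have \<Psi>: "is_functor ?\<Psi>"
  proof (rule is_functor_mkI)
    show fa: "fa m \<in> hom ?U (fo y) (fo z)" if "m \<in> hom ?E' y z" for m y z
    proof -
      from that obtain n where "m = pair (pair y z) n" "y \<in> Ob ?E'" "z \<in> Ob ?E'"
        by (rule exact_homE)
      with that hom_iff show ?thesis by simp
    qed
    show "fa (Idn ?E' y) = Idn ?U (fo y)" if y: "y \<in> Ob ?E'" for y
    proof -
      obtain a'' h k where y': "y = pair a'' (pair h k)"
        using y by (auto simp: Ob_exact_cat)
      have "e y \<in> Ob ?E" using eE y[unfolded y' E'_iff] unfolding y' by blast
      then show ?thesis
        using y fo[OF y] by (simp add: Idn_exact_cat Idn_under_cat hcomp_cats[OF D D' R])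
    qed
    fix y z t m n assume m: "m \<in> hom ?E' y z" and n: "n \<in> hom ?E' z t"
    from m obtain m' where [simp]: "m = pair (pair y z) m'" by (rule exact_homE)
    from n obtain n' where [simp]: "n = pair (pair z t) n'" by (rule exact_homE)
    have *: "pair (pair (e y) (e z)) m' \<in> hom ?E (e y) (e z)" "pair (pair (e z) (e t)) n' \<in> hom ?E (e z) (e t)"
      using fa[OF m] fa[OF n] by (auto simp: hom_under_cat)
    show "fa (Cmp ?E' n m) = Cmp ?U (fa n) (fa m)"
      using m n fa[OF m] fa[OF n] Cmp_exact_cat[OF *]
      by (simp add: Cmp_exact_cat Cmp_under_cat hcomp_cats[OF D D' R])
  qed (use \<Phi> D' fo in auto)
  have "aspherical W (Src ?\<Psi>) \<longleftrightarrow> aspherical W (Tgt ?\<Psi>)"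
  proof (rule aspherical_iff_equivalence[OF W \<Psi>])
    fix X assume "X \<in> Ob (Tgt ?\<Psi>)"
    then obtain Y m where X: "X = pair Y m" and Y: "Y \<in> Ob ?E" and m: "m \<in> hom ?T x (hcomp_fo D D' Y)"
      by (auto simp: Ob_under_cat)
    from Y obtain a'' f2 k where Y': "Y = pair a'' (pair f2 k)" and a'': "a'' \<in> Ob ?A''" and
      k: "k \<in> hom ?B'' (FOb ?u'' a'') b"
      by (rule exact_catE) simp
    from m obtain h where m': "m = pair (pair x (hcomp_fo D D' Y)) h" and
      h: "h \<in> hom ?A' a' (FOb ?v' a'')" and f2: "Cmp ?A (FAr ?v h) f = f2" and
      eq: "Cmp ?B' (Cmp ?B' (FAr ?w' k) (Cell D' a'')) (FAr ?u' h) = g'"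
      by (rule exact_homE) (simp add: x' Y' hcomp_fo_def[OF D D' R])
    let ?y = "pair a'' (pair h k)"
    have "?y \<in> Ob ?E'" using a'' k h eq by (simp add: E'_iff)
    moreover have "fo ?y = X" by (simp add: fo_def e_def X m' Y' f2)
    ultimately show "\<exists>y\<in>Ob (Src ?\<Psi>). FOb ?\<Psi> y = X"
      by (intro bexI[of _ ?y]) auto
  next
    fix y z m assume "y \<in> Ob (Src ?\<Psi>)" "z \<in> Ob (Src ?\<Psi>)" "m \<in> hom (Tgt ?\<Psi>) (FOb ?\<Psi> y) (FOb ?\<Psi> z)"
    then have y: "y \<in> Ob ?E'" and z: "z \<in> Ob ?E'" and m: "m \<in> hom ?U (fo y) (fo z)" by auto
    from U_homE[OF m] obtain n where m': "m = pair (pair (fo y) (fo z)) (pair (pair (e y) (e z)) n)" by blast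
    have n: "pair (pair y z) n \<in> hom ?E' y z" using m unfolding m' hom_iff[OF y z] .
    have "k = pair (pair y z) n" if "k \<in> hom ?E' y z" "FAr ?\<Psi> k = m" for k
    proof -
      from that(1) obtain l where "k = pair (pair y z) l" by (rule exact_homE)
      then show ?thesis
        using that(2) unfolding FAr_mk_hom[OF that(1)] by (simp add: m')
    qed
    then show "\<exists>!f. f \<in> hom (Src ?\<Psi>) y z \<and> FAr ?\<Psi> f = m"
      unfolding mk_functor_sel
    proof (intro ex1I[of _ "pair (pair y z) n"] conjI n)
      show "FAr ?\<Psi> (pair (pair y z) n) = m" unfolding FAr_mk_hom[OF n] by (simp add: m')
    qed blast
  qed
  then show ?thesis by simp
qed

text \<open>Exactness of \<open>D'\<close> is used at the triples (a', b, g') read off from the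
  objects (a', f, g') of the target of the comparison functor.\<close>

lemma hcomp_exact_cat_aspherical_iff:
  assumes E: "exact_square W D'" and b: "b \<in> Ob (Src (Bottom D'))"
  shows "aspherical W (exact_cat (D \<circ>\<^sub>h D') a b g) \<longleftrightarrow>
    aspherical W (exact_cat D a (FOb (Bottom D') b) g)"
proof -
  note sel [simp] = hcomp_comparison_sel[OF D D' R]
  have "aspherical W (Src (hcomp_comparison D D' a b g)) \<longleftrightarrow>
      aspherical W (Tgt (hcomp_comparison D D' a b g))"
  proof (rule aspherical_iff_under_cat[OF W hcomp_comparison_is_functor[OF D D' R]])
    fix x assume "x \<in> Ob (Tgt (hcomp_comparison D D' a b g))"
    then have x: "x \<in> Ob (exact_cat D a (FOb (Bottom D') b) g)" by simp
    then have "pfst x \<in> Ob (Src (Right D'))"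
        "psnd (psnd x) \<in> hom (Tgt (Right D')) (FOb (Right D') (pfst x)) (FOb (Bottom D') b)"
      using square_cats[OF D] by (auto simp: Ob_exact_cat R)
    then have "aspherical W (exact_cat D' (pfst x) b (psnd (psnd x)))"
      using E b by (simp add: exact_square_def)
    then show "aspherical W (under_cat (hcomp_comparison D D' a b g) x)"
      using under_hcomp_comparison_aspherical_iff[OF x] by simp
  qed
  then show ?thesis by simp
qed

lemma hcomp_exact:
  assumes "exact_square W D" "exact_square W D'"
  shows "exact_square W (D \<circ>\<^sub>h D')"
  unfolding exact_square_def
proof (intro conjI ballI)
  note sel [simp] = hcomp_sel[OF D D' R]
  show "is_square (D \<circ>\<^sub>h D')" by (rule hcomp_is_square[OF D D' R])
  fix a b g assume "a \<in> Ob (Src (Right (D \<circ>\<^sub>h D')))" "b \<in> Ob (Src (Bottom (D \<circ>\<^sub>h D')))"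
    and "g \<in> hom (Tgt (Right (D \<circ>\<^sub>h D'))) (FOb (Right (D \<circ>\<^sub>h D')) a) (FOb (Bottom (D \<circ>\<^sub>h D')) b)"
  then have a: "a \<in> Ob (Src (Right D))" and b: "b \<in> Ob (Src (Bottom D'))" and
    g: "g \<in> hom (Tgt (Right D)) (FOb (Right D) a) (FOb (Bottom D) (FOb (Bottom D') b))" by simp_all
  have "FOb (Bottom D') b \<in> Ob (Src (Bottom D))"
    using Bottom_Ob[OF D' b] square_cats[OF D] by (simp add: R)
  then show "aspherical W (exact_cat (D \<circ>\<^sub>h D') a b g)"
    using assms(1) a g unfolding hcomp_exact_cat_aspherical_iff[OF assms(2) b]
    by (simp add: exact_square_def)
qed

end

end

section \<open>Isomorphisms\<close>

lemma is_iso_functorD: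
  assumes F: "is_iso_functor F"
  shows iso_is_functor: "is_functor F"
    and iso_Ob_surj: "\<And>b. b \<in> Ob (Tgt F) \<Longrightarrow> \<exists>a\<in>Ob (Src F). FOb F a = b"
    and iso_Ar_inj: "\<And>f f'. f \<in> Ar (Src F) \<Longrightarrow> f' \<in> Ar (Src F) \<Longrightarrow> FAr F f = FAr F f' \<Longrightarrow> f = f'"
    and iso_full: "\<And>a a' g. a \<in> Ob (Src F) \<Longrightarrow> a' \<in> Ob (Src F) \<Longrightarrow>
      g \<in> hom (Tgt F) (FOb F a) (FOb F a') \<Longrightarrow> \<exists>f\<in>hom (Src F) a a'. FAr F f = g"
proof -
  show F': "is_functor F" using F by (simp add: is_iso_functor_def)
  obtain G where G: "is_functor G" and [simp]: "Src G = Tgt F" "Tgt G = Src F" and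
    GF: "G \<circ>\<^sub>F F = id_functor (Src F)" and FG: "F \<circ>\<^sub>F G = id_functor (Tgt F)"
    using F by (auto simp: is_iso_functor_def)
  have GFo: "FOb G (FOb F a) = a" if "a \<in> Ob (Src F)" for a
    using that arg_cong[OF GF, of "\<lambda>H. FOb H a"] by simp
  have GFa: "FAr G (FAr F f) = f" if "f \<in> Ar (Src F)" for f
    using that arg_cong[OF GF, of "\<lambda>H. FAr H f"] by simp
  have FGo: "FOb F (FOb G b) = b" if "b \<in> Ob (Tgt F)" for b
    using that arg_cong[OF FG, of "\<lambda>H. FOb H b"] by simp
  have FGa: "FAr F (FAr G f) = f" if "f \<in> Ar (Tgt F)" for f
    using that arg_cong[OF FG, of "\<lambda>H. FAr H f"] by simp
  show "\<exists>a\<in>Ob (Src F). FOb F a = b" if "b \<in> Ob (Tgt F)" for b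
    by (rule bexI[of _ "FOb G b"]) (use FGo[OF that] FOb_Ob[OF G, of b] that in simp_all)
  show "f = f'" if "f \<in> Ar (Src F)" "f' \<in> Ar (Src F)" "FAr F f = FAr F f'" for f f'
    using GFa[OF that(1)] GFa[OF that(2)] that(3) by metis
  show "\<exists>f\<in>hom (Src F) a a'. FAr F f = g"
    if "a \<in> Ob (Src F)" "a' \<in> Ob (Src F)" "g \<in> hom (Tgt F) (FOb F a) (FOb F a')" for a a' g
  proof (rule bexI)
    show "FAr F (FAr G g) = g" by (rule FGa[OF hom_Ar[OF that(3)]])
    show "FAr G g \<in> hom (Src F) a a'"
      using FAr_hom[OF G, of g "FOb F a" "FOb F a'"] that(3) by (simp add: GFo[OF that(1)] GFo[OF that(2)])
  qed
qed

text \<open>The inverse on arrows respects endpoints because \<open>F\<close> does and is injective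
  on objects; its functor laws are then checked after applying \<open>F\<close>.
  \<open>mk_functor\<close> removes the values of \<open>inv_into\<close> off the target.\<close>

lemma is_iso_functorI:
  assumes F: "is_functor F"
    and o: "bij_betw (FOb F) (Ob (Src F)) (Ob (Tgt F))"
    and a: "bij_betw (FAr F) (Ar (Src F)) (Ar (Tgt F))"
  shows "is_iso_functor F"
proof -
  let ?A = "Src F" and ?B = "Tgt F"
  define go where "go = inv_into (Ob ?A) (FOb F)"
  define ga where "ga = inv_into (Ar ?A) (FAr F)"
  have A: "small_category ?A" and B: "small_category ?B" using F by auto
  have go: "go b \<in> Ob ?A" "FOb F (go b) = b" if "b \<in> Ob ?B" for b
    using that o by (auto simp: go_def bij_betw_def inv_into_into f_inv_into_f)
  have ga: "ga f \<in> Ar ?A" "FAr F (ga f) = f" if "f \<in> Ar ?B" for f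
    using that a by (auto simp: ga_def bij_betw_def inv_into_into f_inv_into_f)
  have inj_o: "x = y" if "x \<in> Ob ?A" "y \<in> Ob ?A" "FOb F x = FOb F y" for x y
    using that o by (auto simp: bij_betw_def inj_on_def)
  have inj_a: "x = y" if "x \<in> Ar ?A" "y \<in> Ar ?A" "FAr F x = FAr F y" for x y
    using that a by (auto simp: bij_betw_def inj_on_def)
  have ga_hom: "ga f \<in> hom ?A (go b) (go c)" if f: "f \<in> hom ?B b c" for f b c
  proof -
    note gf = ga[OF hom_Ar[OF f]]
    have e: "FOb F (Dom ?A (ga f)) = b" "FOb F (Cod ?A (ga f)) = c"
      using FAr_hom[OF F homI[OF gf(1)]] f unfolding gf(2) hom_def by auto
    note bc = hom_Ob[OF B f]
    have "Dom ?A (ga f) = go b"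
      by (rule inj_o) (simp_all add: e go bc gf Dom_Ob[OF A])
    moreover have "Cod ?A (ga f) = go c"
      by (rule inj_o) (simp_all add: e go bc gf Cod_Ob[OF A])
    ultimately show ?thesis using gf(1) by (simp add: hom_def)
  qed
  let ?G = "mk_functor ?B ?A go ga"
  have G: "is_functor ?G"
  proof (rule is_functor_mkI)
    show "ga (Idn ?B b) = Idn ?A (go b)" if b: "b \<in> Ob ?B" for b
      by (rule inj_a) (simp_all add: ga[OF hom_Ar[OF Idn_hom[OF B b]]] go[OF b]
        hom_Ar[OF Idn_hom[OF A go(1)[OF b]]] FAr_Idn[OF F])
    show "ga (Cmp ?B g f) = Cmp ?A (ga g) (ga f)" if f: "f \<in> hom ?B b c" and g: "g \<in> hom ?B c d" for b c d f g
      by (rule inj_a) (simp_all add: ga[OF hom_Ar[OF Cmp_hom[OF B f g]]] ga[OF hom_Ar[OF f]] ga[OF hom_Ar[OF g]]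
        hom_Ar[OF Cmp_hom[OF A ga_hom[OF f] ga_hom[OF g]]] FAr_Cmp[OF F ga_hom[OF f] ga_hom[OF g]])
  qed (use A B go ga_hom in auto)
  have "?G \<circ>\<^sub>F F = id_functor ?A"
  proof (rule functor_eqI)
    have "go (FOb F x) = x" if x: "x \<in> Ob ?A" for x
      by (rule inj_o) (use x F go[of "FOb F x"] in simp_all)
    then show "FOb (?G \<circ>\<^sub>F F) x = FOb (id_functor ?A) x" if "x \<in> Ob (Src (id_functor ?A))" for x
      using that F by simp
    have "ga (FAr F x) = x" "FAr F x \<in> Ar ?B" if x: "x \<in> Ar ?A" for x
    proof -
      show Fx: "FAr F x \<in> Ar ?B" using hom_Ar[OF FAr_hom[OF F homI[OF x]]] .
      show "ga (FAr F x) = x" by (rule inj_a) (use x ga[OF Fx] in simp_all)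
    qed
    then show "FAr (?G \<circ>\<^sub>F F) x = FAr (id_functor ?A) x" if "x \<in> Ar (Src (id_functor ?A))" for x
      using that by simp
  qed (use F G comp_is_functor[OF F G] in auto)
  moreover have "F \<circ>\<^sub>F ?G = id_functor ?B"
    by (rule functor_eqI) (use F G comp_is_functor[OF G F] go ga in auto)
  ultimately show ?thesis
    unfolding is_iso_functor_def using F G by (intro conjI exI[of _ ?G]) auto
qed

section \<open>Transport of exactness along isomorphisms of squares\<close>

context
  fixes W :: "'u::universe cat_functor set"
  assumes W: "weak_fundamental_localizer W"
begin

text \<open>All three components of an object are transported along the isomorphisms. The equations
  between the functors and the cells match the defining conditions, and bijectivity makes the
  resulting functor full, faithful and surjective on objects.\<close>

lemma iso_squares_exact_cat_iff:
  assumes D: "is_square D" and E: "is_square E"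
    and iA: "is_iso_functor iA" "Src iA = Src (Right D)" "Tgt iA = Src (Right E)"
    and iB: "is_iso_functor iB" "Src iB = Tgt (Right D)" "Tgt iB = Tgt (Right E)"
    and iA': "is_iso_functor iA'" "Src iA' = Src (Top D)" "Tgt iA' = Src (Top E)"
    and iB': "is_iso_functor iB'" "Src iB' = Src (Bottom D)" "Tgt iB' = Src (Bottom E)"
    and v: "iA \<circ>\<^sub>F Top D = Top E \<circ>\<^sub>F iA'" and w: "iB \<circ>\<^sub>F Bottom D = Bottom E \<circ>\<^sub>F iB'"
    and u': "iB' \<circ>\<^sub>F Left D = Left E \<circ>\<^sub>F iA'" and u: "iB \<circ>\<^sub>F Right D = Right E \<circ>\<^sub>F iA"
    and \<alpha>: "\<And>x. x \<in> Ob (Src (Top D)) \<Longrightarrow> FAr iB (Cell D x) = Cell E (FOb iA' x)"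
    and a: "a \<in> Ob (Src (Right D))" and b: "b \<in> Ob (Src (Bottom D))"
    and g: "g \<in> hom (Tgt (Right D)) (FOb (Right D) a) (FOb (Bottom D) b)"
  shows "aspherical W (exact_cat D a b g) \<longleftrightarrow> aspherical W (exact_cat E (FOb iA a) (FOb iB' b) (FAr iB g))"
proof -
  let ?A = "Src (Right D)" and ?A' = "Src (Top D)" and ?B = "Tgt (Right D)" and ?B' = "Src (Bottom D)"
  let ?C = "exact_cat D a b g" and ?C' = "exact_cat E (FOb iA a) (FOb iB' b) (FAr iB g)"
  note cats = square_small_categories[OF D]
  note fA = iso_is_functor[OF iA(1)] and fB = iso_is_functor[OF iB(1)]
    and fA' = iso_is_functor[OF iA'(1)] and fB' = iso_is_functor[OF iB'(1)]
  note [simp] = square_functors[OF D] square_cats[OF D] square_functors[OF E] square_cats[OF E]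
    iA(2,3) iB(2,3) iA'(2,3) iB'(2,3)
  have vo: "FOb (Top E) (FOb iA' x) = FOb iA (FOb (Top D) x)" if "x \<in> Ob ?A'" for x
    using that arg_cong[OF v, of "\<lambda>F. FOb F x"] by simp
  have va: "FAr (Top E) (FAr iA' f) = FAr iA (FAr (Top D) f)" if "f \<in> hom ?A' x y" for f x y
    using hom_Ar[OF that] arg_cong[OF v, of "\<lambda>F. FAr F f"] by simp
  have u'o: "FOb (Left E) (FOb iA' x) = FOb iB' (FOb (Left D) x)" if "x \<in> Ob ?A'" for x
    using that arg_cong[OF u', of "\<lambda>F. FOb F x"] by simp
  have u'a: "FAr (Left E) (FAr iA' f) = FAr iB' (FAr (Left D) f)" if "f \<in> hom ?A' x y" for f x y
    using hom_Ar[OF that] arg_cong[OF u', of "\<lambda>F. FAr F f"] by simp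
  have ua: "FAr (Right E) (FAr iA f) = FAr iB (FAr (Right D) f)" if "f \<in> hom ?A x y" for f x y
    using hom_Ar[OF that] arg_cong[OF u, of "\<lambda>F. FAr F f"] by simp
  have wa: "FAr (Bottom E) (FAr iB' f) = FAr iB (FAr (Bottom D) f)" if "f \<in> hom ?B' x y" for f x y
    using hom_Ar[OF that] arg_cong[OF w, of "\<lambda>F. FAr F f"] by simp
  have A_hom: "FAr iA f \<in> hom (Src (Right E)) (FOb iA x) (FOb iA y)" if "f \<in> hom ?A x y" for f x y
    using FAr_hom[OF fA, of f x y] that by simp
  have B'_hom: "FAr iB' f \<in> hom (Src (Bottom E)) (FOb iB' x) (FOb iB' y)" if "f \<in> hom ?B' x y" for f x y
    using FAr_hom[OF fB', of f x y] that by simp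
  have A'_hom: "FAr iA' f \<in> hom (Src (Top E)) (FOb iA' x) (FOb iA' y)" if "f \<in> hom ?A' x y" for f x y
    using FAr_hom[OF fA', of f x y] that by simp
  have A_cmp: "Cmp (Src (Right E)) (FAr iA f') (FAr iA f) = FAr iA (Cmp ?A f' f)"
    if "f \<in> hom ?A x y" "f' \<in> hom ?A y z" for f f' x y z
    using FAr_Cmp[OF fA, of f x y f' z] that by simp
  have A'_cmp: "FAr iA' (Cmp ?A' f' f) = Cmp (Src (Top E)) (FAr iA' f') (FAr iA' f)"
    if "f \<in> hom ?A' x y" "f' \<in> hom ?A' y z" for f f' x y z
    using FAr_Cmp[OF fA', of f x y f' z] that by simp
  have B'_cmp: "Cmp (Src (Bottom E)) (FAr iB' f') (FAr iB' f) = FAr iB' (Cmp ?B' f' f)"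
    if "f \<in> hom ?B' x y" "f' \<in> hom ?B' y z" for f f' x y z
    using FAr_Cmp[OF fB', of f x y f' z] that by simp
  have B_cmp: "Cmp (Tgt (Right E)) (FAr iB f') (FAr iB f) = FAr iB (Cmp ?B f' f)"
    if "f \<in> hom ?B x y" "f' \<in> hom ?B y z" for f f' x y z
    using FAr_Cmp[OF fB, of f x y f' z] that by simp
  define fo where "fo x = pair (FOb iA' (pfst x)) (pair (FAr iA (pfst (psnd x))) (FAr iB' (psnd (psnd x))))" for x
  have fo_pair [simp]: "fo (pair x (pair f k)) = pair (FOb iA' x) (pair (FAr iA f) (FAr iB' k))" for x f k
    by (simp add: fo_def)
  have Ob_iff: "fo (pair x (pair f k)) \<in> Ob ?C' \<longleftrightarrow> pair x (pair f k) \<in> Ob ?C"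
    if x: "x \<in> Ob ?A'" and f: "f \<in> hom ?A a (FOb (Top D) x)" and k: "k \<in> hom ?B' (FOb (Left D) x) b" for x f k
  proof -
    note uf = Right_hom[OF D f] and c = Cell_hom[OF D x] and wk = Bottom_hom[OF D k]
    let ?g = "Cmp ?B (FAr (Bottom D) k) (Cmp ?B (Cell D x) (FAr (Right D) f))"
    have h: "?g \<in> hom ?B (FOb (Right D) a) (FOb (Bottom D) b)"
      by (rule Cmp_hom[OF cats(4) Cmp_hom[OF cats(4) uf c] wk])
    have "Cmp (Tgt (Right E)) (FAr (Bottom E) (FAr iB' k)) (Cmp (Tgt (Right E)) (Cell E (FOb iA' x))
        (FAr (Right E) (FAr iA f))) = FAr iB ?g"
      using B_cmp[OF uf c] B_cmp[OF Cmp_hom[OF cats(4) uf c] wk] \<alpha>[OF x] ua[OF f] wa[OF k] by simp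
    \<comment> \<open>Injectivity of \<open>iB\<close> is what makes the defining equation reflected
      and not merely preserved.\<close>
    moreover have "FAr iB ?g = FAr iB g \<longleftrightarrow> ?g = g"
      using iso_Ar_inj[OF iB(1), of ?g g] hom_Ar[OF h] hom_Ar[OF g] by auto
    moreover have "FOb iA' x \<in> Ob (Src (Top E))"
      using FOb_Ob[OF fA'] x by simp
    ultimately show ?thesis
      using x f k A_hom[OF f] B'_hom[OF k] by (simp add: Ob_exact_cat vo u'o)
  qed
  have fo: "fo x \<in> Ob ?C'" if x: "x \<in> Ob ?C" for x
    using x Ob_iff by (elim exact_catE) (use x in blast)
  have hom_iff: "pair (pair (fo x) (fo y)) (FAr iA' n) \<in> hom ?C' (fo x) (fo y) \<longleftrightarrow>
      pair (pair x y) n \<in> hom ?C x y"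
    if x: "x \<in> Ob ?C" and y: "y \<in> Ob ?C" and n: "n \<in> hom ?A' (pfst x) (pfst y)" for x y n
  proof -
    from x obtain x1 f k where [simp]: "x = pair x1 (pair f k)" and x1: "x1 \<in> Ob ?A'" and
      f: "f \<in> hom ?A a (FOb (Top D) x1)" and k: "k \<in> hom ?B' (FOb (Left D) x1) b"
      by (rule exact_catE)
    from y obtain y1 f' k' where [simp]: "y = pair y1 (pair f' k')" and y1: "y1 \<in> Ob ?A'" and
      f': "f' \<in> hom ?A a (FOb (Top D) y1)" and k': "k' \<in> hom ?B' (FOb (Left D) y1) b"
      by (rule exact_catE)
    have n': "n \<in> hom ?A' x1 y1" using n by simp
    note vn = Top_hom[OF D n'] and un = Left_hom[OF D n']
    have "FAr iA (Cmp ?A (FAr (Top D) n) f) = FAr iA f' \<longleftrightarrow> Cmp ?A (FAr (Top D) n) f = f'"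
      using iso_Ar_inj[OF iA(1), of "Cmp ?A (FAr (Top D) n) f" f']
        hom_Ar[OF Cmp_hom[OF cats(3) f vn]] hom_Ar[OF f'] by auto
    moreover have "FAr iB' (Cmp ?B' k' (FAr (Left D) n)) = FAr iB' k \<longleftrightarrow> Cmp ?B' k' (FAr (Left D) n) = k"
      using iso_Ar_inj[OF iB'(1), of "Cmp ?B' k' (FAr (Left D) n)" k]
        hom_Ar[OF Cmp_hom[OF cats(2) un k']] hom_Ar[OF k] by auto
    ultimately show ?thesis
      using fo[OF x] fo[OF y] x y n' A'_hom[OF n'] A_cmp[OF f vn] B'_cmp[OF un k']
      by (simp add: hom_exact_cat va[OF n'] u'a[OF n'])
  qed
  let ?F = "mk_functor ?C ?C' fo (hom_map fo (FAr iA'))"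
  have pfst_fo [simp]: "pfst (fo x) = FOb iA' (pfst x)" for x by (simp add: fo_def)
  have F: "is_functor ?F"
  proof (rule is_functor_mkI)
    show fa: "hom_map fo (FAr iA') m \<in> hom ?C' (fo x) (fo y)" if m: "m \<in> hom ?C x y" for m x y
    proof -
      from m obtain n where "m = pair (pair x y) n" "n \<in> hom ?A' (pfst x) (pfst y)" "x \<in> Ob ?C" "y \<in> Ob ?C"
        by (rule exact_homE)
      with m hom_iff show ?thesis by simp
    qed
    show "hom_map fo (FAr iA') (Idn ?C x) = Idn ?C' (fo x)" if x: "x \<in> Ob ?C" for x
    proof -
      have "pfst x \<in> Ob ?A'" using x by (auto simp: Ob_exact_cat)
      then show ?thesis
        using x fo[OF x] FAr_Idn[OF fA', of "pfst x"] by (simp add: Idn_exact_cat)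
    qed
    fix x y z m n assume m: "m \<in> hom ?C x y" and n: "n \<in> hom ?C y z"
    from m obtain m' where [simp]: "m = pair (pair x y) m'" and m': "m' \<in> hom ?A' (pfst x) (pfst y)"
      by (rule exact_homE)
    from n obtain n' where [simp]: "n = pair (pair y z) n'" and n': "n' \<in> hom ?A' (pfst y) (pfst z)"
      by (rule exact_homE)
    show "hom_map fo (FAr iA') (Cmp ?C n m) = Cmp ?C' (hom_map fo (FAr iA') n) (hom_map fo (FAr iA') m)"
      using m n fa[OF m] fa[OF n] A'_cmp[OF m' n'] by (simp add: Cmp_exact_cat)
  qed (use D E fo in auto)
  have "aspherical W (Src ?F) \<longleftrightarrow> aspherical W (Tgt ?F)"
  proof (rule aspherical_iff_equivalence[OF W F])
    fix Y assume "Y \<in> Ob (Tgt ?F)"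
    then have Y: "Y \<in> Ob ?C'" by simp
    then obtain y f k where Y': "Y = pair y (pair f k)" and y: "y \<in> Ob (Src (Top E))" and
      f: "f \<in> hom (Src (Right E)) (FOb iA a) (FOb (Top E) y)" and
      k: "k \<in> hom (Src (Bottom E)) (FOb (Left E) y) (FOb iB' b)"
      by (rule exact_catE)
    \<comment> \<open>The first component is lifted before the arrows, since their endpoints depend
      on it.\<close>
    obtain x where x: "x \<in> Ob ?A'" and xy: "y = FOb iA' x"
      using iso_Ob_surj[OF iA'(1), of y] y by auto
    obtain f0 where f0: "f0 \<in> hom ?A a (FOb (Top D) x)" "FAr iA f0 = f"
      using iso_full[OF iA(1), of a "FOb (Top D) x" f] f a Top_Ob[OF D x] by (auto simp: xy vo[OF x])
    obtain k0 where k0: "k0 \<in> hom ?B' (FOb (Left D) x) b" "FAr iB' k0 = k"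
      using iso_full[OF iB'(1), of "FOb (Left D) x" b k] k b Left_Ob[OF D x] by (auto simp: xy u'o[OF x])
    have "fo (pair x (pair f0 k0)) = Y" by (simp add: Y' xy f0 k0)
    then show "\<exists>X\<in>Ob (Src ?F). FOb ?F X = Y"
      using Ob_iff[OF x f0(1) k0(1)] Y by (intro bexI[of _ "pair x (pair f0 k0)"]) auto
  next
    fix x y m assume "x \<in> Ob (Src ?F)" "y \<in> Ob (Src ?F)" "m \<in> hom (Tgt ?F) (FOb ?F x) (FOb ?F y)"
    then have x: "x \<in> Ob ?C" and y: "y \<in> Ob ?C" and m: "m \<in> hom ?C' (fo x) (fo y)" by auto
    from m obtain n' where m': "m = pair (pair (fo x) (fo y)) n'" and
        n': "n' \<in> hom (Src (Top E)) (FOb iA' (pfst x)) (FOb iA' (pfst y))"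
      by (rule exact_homE) simp
    obtain n where n: "n \<in> hom ?A' (pfst x) (pfst y)" and nn: "FAr iA' n = n'"
      using iso_full[OF iA'(1), of "pfst x" "pfst y" n'] n' x y by (auto simp: Ob_exact_cat)
    have h: "pair (pair x y) n \<in> hom ?C x y"
      using hom_iff[OF x y n] m by (simp add: m' nn)
    have "k = pair (pair x y) n" if k: "k \<in> hom ?C x y" "FAr ?F k = m" for k
    proof -
      from k(1) obtain l where l: "k = pair (pair x y) l" "l \<in> hom ?A' (pfst x) (pfst y)"
        by (rule exact_homE)
      then have "FAr iA' l = FAr iA' n"
        using k(2) unfolding FAr_mk_hom[OF k(1)] by (simp add: m' nn)
      then show ?thesis
        using iso_Ar_inj[OF iA'(1), of l n] hom_Ar[OF l(2)] hom_Ar[OF n] l by simp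
    qed
    then show "\<exists>!f. f \<in> hom (Src ?F) x y \<and> FAr ?F f = m"
      unfolding mk_functor_sel
    proof (intro ex1I[of _ "pair (pair x y) n"] conjI h)
      show "FAr ?F (pair (pair x y) n) = m" unfolding FAr_mk_hom[OF h] by (simp add: m' nn)
    qed blast
  qed
  then show ?thesis by simp
qed

text \<open>Every triple (a, b, g) for \<open>E\<close> is the image of one for \<open>D\<close>:
  objects lift by surjectivity, and g lifts by fullness of \<open>iB\<close>.\<close>

lemma iso_squares_exact:
  assumes D: "exact_square W D" and DE: "iso_squares D E"
  shows "exact_square W E"
proof -
  have sD: "is_square D" and sE: "is_square E" using DE by (auto simp: iso_squares_def)
  note cats = square_cats[OF sD] square_cats[OF sE]
  from DE[unfolded iso_squares_def cats] obtain iA iB iA' iB' where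
    iA: "is_iso_functor iA" "Src iA = Src (Right D)" "Tgt iA = Src (Right E)"
    and iB: "is_iso_functor iB" "Src iB = Tgt (Right D)" "Tgt iB = Tgt (Right E)"
    and iA': "is_iso_functor iA'" "Src iA' = Src (Top D)" "Tgt iA' = Src (Top E)"
    and iB': "is_iso_functor iB'" "Src iB' = Src (Bottom D)" "Tgt iB' = Src (Bottom E)"
    and v: "iA \<circ>\<^sub>F Top D = Top E \<circ>\<^sub>F iA'" and w: "iB \<circ>\<^sub>F Bottom D = Bottom E \<circ>\<^sub>F iB'"
    and u': "iB' \<circ>\<^sub>F Left D = Left E \<circ>\<^sub>F iA'" and u: "iB \<circ>\<^sub>F Right D = Right E \<circ>\<^sub>F iA"
    and \<alpha>: "\<And>x. x \<in> Ob (Src (Top D)) \<Longrightarrow> FAr iB (Cell D x) = Cell E (FOb iA' x)"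
    by blast
  show ?thesis
    unfolding exact_square_def
  proof (intro conjI ballI sE)
    fix a b g assume a: "a \<in> Ob (Src (Right E))" and b: "b \<in> Ob (Src (Bottom E))" and
      g: "g \<in> hom (Tgt (Right E)) (FOb (Right E) a) (FOb (Bottom E) b)"
    obtain a0 where a0: "a0 \<in> Ob (Src (Right D))" "FOb iA a0 = a"
      using iso_Ob_surj[OF iA(1), of a] a iA by auto
    obtain b0 where b0: "b0 \<in> Ob (Src (Bottom D))" "FOb iB' b0 = b"
      using iso_Ob_surj[OF iB'(1), of b] b iB' by auto
    have "FOb (Right E) a = FOb iB (FOb (Right D) a0)" "FOb (Bottom E) b = FOb iB (FOb (Bottom D) b0)"
      using a0 b0 arg_cong[OF u, of "\<lambda>F. FOb F a0"] arg_cong[OF w, of "\<lambda>F. FOb F b0"] iA iB' by auto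
    then obtain g0 where g0: "g0 \<in> hom (Tgt (Right D)) (FOb (Right D) a0) (FOb (Bottom D) b0)" "FAr iB g0 = g"
      using iso_full[OF iB(1), of "FOb (Right D) a0" "FOb (Bottom D) b0" g] g iB
        FOb_Ob[OF square_functors(4)[OF sD] a0(1)] Bottom_Ob[OF sD b0(1)] by auto
    have "aspherical W (exact_cat D a0 b0 g0)"
      using D a0 b0 g0 by (simp add: exact_square_def)
    then show "aspherical W (exact_cat E a b g)"
      using iso_squares_exact_cat_iff[OF sD sE iA iB iA' iB' v w u' u \<alpha> a0(1) b0(1) g0(1)] a0 b0 g0
      by simp
  qed
qed

end

section \<open>Comma squares\<close>

lemma Ob_comma_cat:
  "Ob (comma_cat u w) = {pair a (pair b' g) | a b' g. a \<in> Ob (Src u) \<and> b' \<in> Ob (Src w) \<and>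
    g \<in> hom (Tgt u) (FOb u a) (FOb w b')}"
  by (simp add: comma_cat_def Let_def)

lemma hom_comma_cat:
  "hom (comma_cat u w) x y = {m. x \<in> Ob (comma_cat u w) \<and> y \<in> Ob (comma_cat u w) \<and>
    (\<exists>f g'. m = pair (pair x y) (pair f g') \<and> f \<in> hom (Src u) (pfst x) (pfst y) \<and>
      g' \<in> hom (Src w) (pfst (psnd x)) (pfst (psnd y)) \<and>
      Cmp (Tgt u) (psnd (psnd y)) (FAr u f) = Cmp (Tgt u) (FAr w g') (psnd (psnd x)))}"
  by (auto simp: comma_cat_def Let_def hom_hom_cat)

lemma Idn_comma_cat:
  "x \<in> Ob (comma_cat u w) \<Longrightarrow> Idn (comma_cat u w) x =
    pair (pair x x) (pair (Idn (Src u) (pfst x)) (Idn (Src w) (pfst (psnd x))))"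
  by (simp add: comma_cat_def Let_def)

lemma Cmp_comma_cat:
  assumes "pair (pair x y) (pair f g) \<in> hom (comma_cat u w) x y"
    and "pair (pair y z) (pair f' g') \<in> hom (comma_cat u w) y z"
  shows "Cmp (comma_cat u w) (pair (pair y z) (pair f' g')) (pair (pair x y) (pair f g)) =
    pair (pair x z) (pair (Cmp (Src u) f' f) (Cmp (Src w) g' g))"
  using Cmp_hom_cat_hom[OF assms[unfolded comma_cat_def Let_def]]
  by (simp add: comma_cat_def Let_def)

lemma small_category_comma_cat:
  assumes u: "is_functor u" and w: "is_functor w" and uw: "Tgt w = Tgt u"
  shows "small_category (comma_cat u w)"
  unfolding comma_cat_def Let_def
proof (rule hom_cat_small_category)
  let ?A = "Src u" and ?B' = "Src w" and ?B = "Tgt u"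
  have A: "small_category ?A" and B: "small_category ?B" and B': "small_category ?B'"
    using u w by auto
  let ?X = "{pair a (pair b' g) | a b' g. a \<in> Ob ?A \<and> b' \<in> Ob ?B' \<and> g \<in> hom ?B (FOb u a) (FOb w b')}"
  let ?H = "\<lambda>x y. {pair f g' | f g'. f \<in> hom ?A (pfst x) (pfst y) \<and>
      g' \<in> hom ?B' (pfst (psnd x)) (pfst (psnd y)) \<and>
      Cmp ?B (psnd (psnd y)) (FAr u f) = Cmp ?B (FAr w g') (psnd (psnd x))}"
  have w_hom: "FAr w f \<in> hom ?B (FOb w a) (FOb w b)" if "f \<in> hom ?B' a b" for f a b
    using FAr_hom[OF w that] uw by simp
  show "small ?X"
    by (rule small_subset[OF small_pairs[OF small_Ob[OF A] small_pairs[OF small_Ob[OF B'] small_Ar[OF B]]]])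
      (auto simp: hom_Ar)
  show "small {pair p q | p q. p \<in> Ar ?A \<and> q \<in> Ar ?B'}"
    by (rule small_pairs[OF small_Ar[OF A] small_Ar[OF B']])
  show "?H x y \<subseteq> {pair p q | p q. p \<in> Ar ?A \<and> q \<in> Ar ?B'}" for x y
    by (auto simp: hom_def)
  show "pair (Idn ?A (pfst x)) (Idn ?B' (pfst (psnd x))) \<in> ?H x x" if x: "x \<in> ?X" for x
  proof -
    from x obtain a b g where [simp]: "x = pair a (pair b g)" and
      a: "a \<in> Ob ?A" and b: "b \<in> Ob ?B'" and g: "g \<in> hom ?B (FOb u a) (FOb w b)" by auto
    show ?thesis
      using a b A B' FAr_Idn[OF w b] by (simp add: FAr_Idn[OF u] Cmp_Idn_right[OF B g] Cmp_Idn_left[OF B g] uw)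
  qed
  fix x y z m n assume x: "x \<in> ?X" and z: "z \<in> ?X" and y: "y \<in> ?X" and m: "m \<in> ?H x y"
  from m obtain f g where [simp]: "m = pair f g" and f: "f \<in> hom ?A (pfst x) (pfst y)" and
      g: "g \<in> hom ?B' (pfst (psnd x)) (pfst (psnd y))" and
      fg: "Cmp ?B (psnd (psnd y)) (FAr u f) = Cmp ?B (FAr w g) (psnd (psnd x))"
    by blast
  let ?i = "\<lambda>x. pair (Idn ?A (pfst x)) (Idn ?B' (pfst (psnd x)))"
  show "pair (Cmp ?A (pfst m) (pfst (?i x))) (Cmp ?B' (psnd m) (psnd (?i x))) = m"
    using Cmp_Idn_right[OF A f] Cmp_Idn_right[OF B' g] by simp
  show "pair (Cmp ?A (pfst (?i y)) (pfst m)) (Cmp ?B' (psnd (?i y)) (psnd m)) = m"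
    using Cmp_Idn_left[OF A f] Cmp_Idn_left[OF B' g] by simp
  assume n: "n \<in> ?H y z"
  from n obtain f' g' where [simp]: "n = pair f' g'" and f': "f' \<in> hom ?A (pfst y) (pfst z)" and
      g': "g' \<in> hom ?B' (pfst (psnd y)) (pfst (psnd z))" and
      fg': "Cmp ?B (psnd (psnd z)) (FAr u f') = Cmp ?B (FAr w g') (psnd (psnd y))"
    by blast
  have x2: "psnd (psnd x) \<in> hom ?B (FOb u (pfst x)) (FOb w (pfst (psnd x)))" using x by auto
  have y2: "psnd (psnd y) \<in> hom ?B (FOb u (pfst y)) (FOb w (pfst (psnd y)))" using y by auto
  have z2: "psnd (psnd z) \<in> hom ?B (FOb u (pfst z)) (FOb w (pfst (psnd z)))" using z by auto
  have "Cmp ?B (psnd (psnd z)) (FAr u (Cmp ?A f' f)) =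
      Cmp ?B (FAr w g') (Cmp ?B (psnd (psnd y)) (FAr u f))"
    using Cmp_assoc[OF B FAr_hom[OF u f] FAr_hom[OF u f'] z2]
      Cmp_assoc[OF B FAr_hom[OF u f] y2 w_hom[OF g']] fg'
    by (simp add: FAr_Cmp[OF u f f'])
  also have "\<dots> = Cmp ?B (FAr w (Cmp ?B' g' g)) (psnd (psnd x))"
    using Cmp_assoc[OF B x2 w_hom[OF g] w_hom[OF g']] fg FAr_Cmp[OF w g g'] uw by simp
  finally show "pair (Cmp ?A (pfst n) (pfst m)) (Cmp ?B' (psnd n) (psnd m)) \<in> ?H x z"
    using Cmp_hom[OF A f f'] Cmp_hom[OF B' g g'] by simp
  fix t k assume "k \<in> ?H z t"
  then obtain f'' g'' where [simp]: "k = pair f'' g''" and f'': "f'' \<in> hom ?A (pfst z) (pfst t)" and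
      g'': "g'' \<in> hom ?B' (pfst (psnd z)) (pfst (psnd t))"
    by blast
  let ?c = "\<lambda>n m. pair (Cmp ?A (pfst n) (pfst m)) (Cmp ?B' (psnd n) (psnd m))"
  show "?c k (?c n m) = ?c (?c k n) m"
    using Cmp_assoc[OF A f f' f''] Cmp_assoc[OF B' g g' g''] by simp
qed

section \<open>The comma functor and lifting along it\<close>

context
  fixes D :: "'u::universe square"
  assumes D: "is_square D"
begin

definition comma_fo :: "'u \<Rightarrow> 'u" where
  "comma_fo x = pair (FOb (Top D) x) (pair (FOb (Left D) x) (Cell D x))"

lemma comma_fo_Ob: "x \<in> Ob (Src (Top D)) \<Longrightarrow> comma_fo x \<in> Ob (comma_cat (Right D) (Bottom D))"
  using Top_Ob[OF D] Left_Ob[OF D] Cell_hom[OF D] by (simp add: comma_fo_def Ob_comma_cat)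

lemma comma_functor_sel [simp]:
  "Src (comma_functor D) = Src (Top D)" "Tgt (comma_functor D) = comma_cat (Right D) (Bottom D)"
  "x \<in> Ob (Src (Top D)) \<Longrightarrow> FOb (comma_functor D) x = comma_fo x"
  "f \<in> hom (Src (Top D)) x y \<Longrightarrow> FAr (comma_functor D) f =
    pair (pair (comma_fo x) (comma_fo y)) (pair (FAr (Top D) f) (FAr (Left D) f))"
  by (auto simp: comma_functor_def Let_def comma_fo_def hom_def)

text \<open>The compatibility required of a morphism of the comma category is naturality of the
  cell.\<close>

lemma comma_functor_hom:
  assumes "f \<in> hom (Src (Top D)) x y"
  shows "pair (pair (comma_fo x) (comma_fo y)) (pair (FAr (Top D) f) (FAr (Left D) f))
    \<in> hom (comma_cat (Right D) (Bottom D)) (comma_fo x) (comma_fo y)"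
  using assms hom_Ob[OF square_small_categories(1)[OF D] assms] comma_fo_Ob Top_hom[OF D assms]
    Left_hom[OF D assms] Cell_natural[OF D assms]
  by (simp add: hom_comma_cat) (simp add: comma_fo_def)

lemma comma_functor_is_functor: "is_functor (comma_functor D)"
proof -
  let ?A' = "Src (Top D)" and ?C = "comma_cat (Right D) (Bottom D)"
  let ?fa = "\<lambda>f. pair (pair (comma_fo (Dom ?A' f)) (comma_fo (Cod ?A' f))) (pair (FAr (Top D) f) (FAr (Left D) f))"
  have A': "small_category ?A'" using square_small_categories[OF D] by simp
  have fa: "?fa f = pair (pair (comma_fo x) (comma_fo y)) (pair (FAr (Top D) f) (FAr (Left D) f))"
    if "f \<in> hom ?A' x y" for f x y
    using that by (auto simp: hom_def)
  have "is_functor (mk_functor ?A' ?C comma_fo ?fa)"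
  proof (rule is_functor_mkI)
    show "small_category ?C"
      by (rule small_category_comma_cat) (use D square_cats[OF D] in auto)
    show "?fa f \<in> hom ?C (comma_fo x) (comma_fo y)" if "f \<in> hom ?A' x y" for f x y
      unfolding fa[OF that] by (rule comma_functor_hom[OF that])
    show "?fa (Idn ?A' x) = Idn ?C (comma_fo x)" if x: "x \<in> Ob ?A'" for x
      unfolding fa[OF Idn_hom[OF A' x]] using x comma_fo_Ob[OF x] Top_Idn[OF D x] Left_Idn[OF D x]
      by (simp add: Idn_comma_cat) (simp add: comma_fo_def)
    fix x y z f g assume f: "f \<in> hom ?A' x y" and g: "g \<in> hom ?A' y z"
    show "?fa (Cmp ?A' g f) = Cmp ?C (?fa g) (?fa f)"
      unfolding fa[OF f] fa[OF g] fa[OF Cmp_hom[OF A' f g]]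
      using comma_functor_hom[OF f] comma_functor_hom[OF g] Top_Cmp[OF D f g] Left_Cmp[OF D f g]
      by (simp add: Cmp_comma_cat)
  qed (use A' comma_fo_Ob in auto)
  then show ?thesis by (simp add: comma_functor_def Let_def comma_fo_def[abs_def])
qed

text \<open>Surjectivity on objects of the comma functor. With lifting and uniqueness of morphisms
  it allows the upper left category to be treated as a category of triples without transport along
  the isomorphism.\<close>

lemma comma_square_Ob:
  assumes "comma_square D" and "a \<in> Ob (Src (Right D))" "b \<in> Ob (Src (Bottom D))"
    and "g \<in> hom (Tgt (Right D)) (FOb (Right D) a) (FOb (Bottom D) b)"
  obtains x where "x \<in> Ob (Src (Top D))" "FOb (Top D) x = a" "FOb (Left D) x = b" "Cell D x = g"
proof -
  have "pair a (pair b g) \<in> Ob (Tgt (comma_functor D))"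
    using assms by (simp add: Ob_comma_cat)
  from iso_Ob_surj[OF _ this] obtain x where "x \<in> Ob (Src (Top D))" "comma_fo x = pair a (pair b g)"
    using assms(1) by (auto simp: comma_square_def)
  then show ?thesis using that by (simp add: comma_fo_def)
qed

lemma comma_square_hom:
  assumes "comma_square D" and x: "x \<in> Ob (Src (Top D))" and y: "y \<in> Ob (Src (Top D))"
    and "f \<in> hom (Src (Right D)) (FOb (Top D) x) (FOb (Top D) y)"
    and "k \<in> hom (Src (Bottom D)) (FOb (Left D) x) (FOb (Left D) y)"
    and "Cmp (Tgt (Right D)) (Cell D y) (FAr (Right D) f) = Cmp (Tgt (Right D)) (FAr (Bottom D) k) (Cell D x)"
  obtains n where "n \<in> hom (Src (Top D)) x y" "FAr (Top D) n = f" "FAr (Left D) n = k"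
proof -
  have iso: "is_iso_functor (comma_functor D)" using assms(1) by (simp add: comma_square_def)
  have "pair (pair (comma_fo x) (comma_fo y)) (pair f k)
      \<in> hom (comma_cat (Right D) (Bottom D)) (comma_fo x) (comma_fo y)"
    using comma_fo_Ob[OF x] comma_fo_Ob[OF y] assms by (simp add: hom_comma_cat) (simp add: comma_fo_def)
  then have "\<exists>n\<in>hom (Src (Top D)) x y.
      FAr (comma_functor D) n = pair (pair (comma_fo x) (comma_fo y)) (pair f k)"
    using iso_full[OF iso, of x y "pair (pair (comma_fo x) (comma_fo y)) (pair f k)"] x y by simp
  then obtain n where n: "n \<in> hom (Src (Top D)) x y"
      "FAr (comma_functor D) n = pair (pair (comma_fo x) (comma_fo y)) (pair f k)"
    by (rule bexE)
  show ?thesis using n(2) unfolding comma_functor_sel(4)[OF n(1)] by (intro that[OF n(1)]) simp_all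
qed

lemma comma_square_hom_unique:
  assumes "comma_square D" and n: "n \<in> hom (Src (Top D)) x y" "n' \<in> hom (Src (Top D)) x y"
    and "FAr (Top D) n = FAr (Top D) n'" "FAr (Left D) n = FAr (Left D) n'"
  shows "n = n'"
proof (rule iso_Ar_inj)
  show "is_iso_functor (comma_functor D)" using assms(1) by (simp add: comma_square_def)
  show "FAr (comma_functor D) n = FAr (comma_functor D) n'"
    using comma_functor_sel(4)[OF n(1)] comma_functor_sel(4)[OF n(2)] assms by simp
qed (use n in \<open>simp_all add: hom_Ar\<close>)

end

text \<open>For an object (x, f, k) the last component \<open>k\<close> can be absorbed into the
  comma object, replacing x by the triple (v(x), b, w(k) \<alpha>_x). This is the reflection onto
  the objects with identity last component; among these the triple (a, b, g) itself, with
  identities, is initial.\<close>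

lemma comma_square_exact:
  assumes W: "weak_fundamental_localizer W" and CD: "comma_square D"
  shows "exact_square W D"
  unfolding exact_square_def
proof (intro conjI ballI)
  show D: "is_square D" using CD by (simp add: comma_square_def)
  let ?A = "Src (Right D)" and ?A' = "Src (Top D)" and ?B = "Tgt (Right D)" and ?B' = "Src (Bottom D)"
  let ?v = "Top D" and ?w = "Bottom D" and ?u' = "Left D" and ?u = "Right D"
  note cats = square_small_categories[OF D]
  fix a b g assume a: "a \<in> Ob ?A" and b: "b \<in> Ob ?B'" and g: "g \<in> hom ?B (FOb ?u a) (FOb ?w b)"
  let ?C = "exact_cat D a b g"
  have wb: "FOb ?w b \<in> Ob ?B" by (rule Bottom_Ob[OF D b])
  \<comment> \<open>The equality u'(x) = b is required on the nose, so that the identity of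
    \<open>b\<close> is an admissible last component.\<close>
  define R where "R = {pair x (pair f k) | x f k. pair x (pair f k) \<in> Ob ?C \<and> FOb ?u' x = b \<and> k = Idn ?B' b}"
  have wId: "FAr ?w (Idn ?B' b) = Idn ?B (FOb ?w b)" by (rule Bottom_Idn[OF D b])
  have R_iff: "pair x (pair f k) \<in> R \<longleftrightarrow> x \<in> Ob ?A' \<and> f \<in> hom ?A a (FOb ?v x) \<and> FOb ?u' x = b \<and>
      k = Idn ?B' b \<and> Cmp ?B (Cell D x) (FAr ?u f) = g" for x f k
  proof -
    have "Cmp ?B (Idn ?B (FOb ?w b)) (Cmp ?B (Cell D x) (FAr ?u f)) = Cmp ?B (Cell D x) (FAr ?u f)"
      if "x \<in> Ob ?A'" "f \<in> hom ?A a (FOb ?v x)" "FOb ?u' x = b"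
      using Cmp_hom[OF cats(4) Right_hom[OF D that(2)] Cell_hom[OF D that(1)]] that
      by (intro Cmp_Idn_left[OF cats(4)]) auto
    then show ?thesis
      using Idn_hom[OF cats(2) b] by (auto simp: R_def Ob_exact_cat wId)
  qed
  obtain x0 where x0: "x0 \<in> Ob ?A'" "FOb ?v x0 = a" "FOb ?u' x0 = b" "Cell D x0 = g"
    using comma_square_Ob[OF D CD a b g] by blast
  show "aspherical W ?C"
  proof (rule aspherical_if_reflective_initial[OF W])
    show "small_category ?C" using D by simp
    show RC: "R \<subseteq> Ob ?C" by (auto simp: R_def)
    fix X assume X: "X \<in> Ob ?C"
    then obtain x f k where X': "X = pair x (pair f k)" and x: "x \<in> Ob ?A'" and
      f: "f \<in> hom ?A a (FOb ?v x)" and k: "k \<in> hom ?B' (FOb ?u' x) b" and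
      eq: "Cmp ?B (FAr ?w k) (Cmp ?B (Cell D x) (FAr ?u f)) = g"
      by (rule exact_catE)
    note vx = Top_Ob[OF D x] and cx = Cell_hom[OF D x] and wk = Bottom_hom[OF D k] and uf = Right_hom[OF D f]
    note wkc = Cmp_hom[OF cats(4) cx wk]
    \<comment> \<open>The pushforward of \<open>x\<close> along \<open>k\<close>, which keeps the
      upper component.\<close>
    obtain x' where x': "x' \<in> Ob ?A'" "FOb ?v x' = FOb ?v x" "FOb ?u' x' = b" "Cell D x' = Cmp ?B (FAr ?w k) (Cell D x)"
      using comma_square_Ob[OF D CD vx b wkc] by blast
    \<comment> \<open>The reflection arrow, with components an identity and
      \<open>k\<close>.\<close>
    obtain n where n: "n \<in> hom ?A' x x'" "FAr ?v n = Idn ?A (FOb ?v x)" "FAr ?u' n = k"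
    proof (rule comma_square_hom[OF D CD x x'(1)])
      show "Idn ?A (FOb ?v x) \<in> hom ?A (FOb ?v x) (FOb ?v x')" using vx x' cats by simp
      show "k \<in> hom ?B' (FOb ?u' x) (FOb ?u' x')" using k x' by simp
      show "Cmp ?B (Cell D x') (FAr ?u (Idn ?A (FOb ?v x))) = Cmp ?B (FAr ?w k) (Cell D x)"
        using Cmp_Idn_right[OF cats(4) wkc] by (simp add: Right_Idn[OF D vx] x')
    qed
    let ?r = "pair x' (pair f (Idn ?B' b))"
    have r: "?r \<in> R"
      using f x' eq Cmp_assoc[OF cats(4) uf cx wk] by (simp add: R_iff)
    then have rC: "?r \<in> Ob ?C" using RC by blast
    have \<eta>: "pair (pair X ?r) n \<in> hom ?C X ?r"
      using X rC n Cmp_Idn_left[OF cats(3) f] Cmp_Idn_left[OF cats(2) k] by (simp add: X' hom_exact_cat)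
    have "\<exists>!h. h \<in> hom ?C ?r Y \<and> Cmp ?C h (pair (pair X ?r) n) = m"
      if Y: "Y \<in> R" and m: "m \<in> hom ?C X Y" for Y m
    proof -
      from Y obtain y f' where Y': "Y = pair y (pair f' (Idn ?B' b))"
        by (auto simp: R_def)
      from Y have y: "y \<in> Ob ?A'" and f': "f' \<in> hom ?A a (FOb ?v y)" and u'y: "FOb ?u' y = b"
        by (auto simp: Y' R_iff)
      from m obtain l where m': "m = pair (pair X Y) l" and l: "l \<in> hom ?A' x y" and
        l1: "Cmp ?A (FAr ?v l) f = f'" and "Cmp ?B' (Idn ?B' b) (FAr ?u' l) = k"
        by (rule exact_homE) (simp add: X' Y')
      then have l2: "FAr ?u' l = k"
        using Left_hom[OF D l] Cmp_Idn_left[OF cats(2), of "FAr ?u' l" "FOb ?u' x" b] by (simp add: u'y)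
      note vl = Top_hom[OF D l]
      \<comment> \<open>The factorization keeps the upper component of \<open>l\<close>; its lower
        component must be an identity, since both objects lie in \<open>R\<close>.\<close>
      obtain h where h: "h \<in> hom ?A' x' y" "FAr ?v h = FAr ?v l" "FAr ?u' h = Idn ?B' b"
      proof (rule comma_square_hom[OF D CD x'(1) y])
        show "FAr ?v l \<in> hom ?A (FOb ?v x') (FOb ?v y)" using vl x' by simp
        show "Idn ?B' b \<in> hom ?B' (FOb ?u' x') (FOb ?u' y)" using x' u'y b cats by simp
        show "Cmp ?B (Cell D y) (FAr ?u (FAr ?v l)) = Cmp ?B (FAr ?w (Idn ?B' b)) (Cell D x')"
          using Cell_natural[OF D l] Cmp_Idn_left[OF cats(4) wkc] by (simp add: wId x' l2)
      qed
      have homs: "p \<in> hom ?C ?r Y \<longleftrightarrow> (\<exists>h'. p = pair (pair ?r Y) h' \<and> h' \<in> hom ?A' x' y \<and>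
          Cmp ?A (FAr ?v h') f = f' \<and> Cmp ?B' (Idn ?B' b) (FAr ?u' h') = Idn ?B' b)" for p
        using rC Y RC by (auto simp: hom_exact_cat Y')
      show ?thesis
      proof (rule ex1I)
        have hC: "pair (pair ?r Y) h \<in> hom ?C ?r Y"
          using h l1 Cmp_Idn_left[OF cats(2) Idn_hom[OF cats(2) b]] by (simp add: homs)
        \<comment> \<open>Arrows into a comma object are equal as soon as both projections agree:
          one projection of n and one of h is an identity.\<close>
        have "Cmp ?A' h n = l"
        proof (rule comma_square_hom_unique[OF D CD Cmp_hom[OF cats(1) n(1) h(1)] l])
          show "FAr ?v (Cmp ?A' h n) = FAr ?v l"
            using Top_Cmp[OF D n(1) h(1)] Cmp_Idn_right[OF cats(3) vl] n h by simp
          show "FAr ?u' (Cmp ?A' h n) = FAr ?u' l"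
            using Left_Cmp[OF D n(1) h(1)] Cmp_Idn_left[OF cats(2) k] n h l2 by simp
        qed
        then show "pair (pair ?r Y) h \<in> hom ?C ?r Y \<and> Cmp ?C (pair (pair ?r Y) h) (pair (pair X ?r) n) = m"
          using hC Cmp_exact_cat[OF \<eta> hC] by (simp add: m')
        fix p assume p: "p \<in> hom ?C ?r Y \<and> Cmp ?C p (pair (pair X ?r) n) = m"
        then obtain h' where p': "p = pair (pair ?r Y) h'" and h': "h' \<in> hom ?A' x' y" and
          h'2: "Cmp ?B' (Idn ?B' b) (FAr ?u' h') = Idn ?B' b"
          unfolding homs by blast
        have hn: "Cmp ?A' h' n = l"
          using p Cmp_exact_cat[OF \<eta>, of Y h'] by (simp add: p' m')
        have "FAr ?v h' = FAr ?v l"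
          using Top_Cmp[OF D n(1) h'] Top_hom[OF D h'] Cmp_Idn_right[OF cats(3), of "FAr ?v h'" "FOb ?v x" "FOb ?v y"]
          by (simp add: hn n x')
        moreover have "FAr ?u' h' = Idn ?B' b"
          using h'2 Left_hom[OF D h'] Cmp_Idn_left[OF cats(2), of "FAr ?u' h'" b b] by (simp add: x' u'y)
        ultimately have "h' = h"
          by (intro comma_square_hom_unique[OF D CD h' h(1)]) (simp_all add: h)
        then show "p = pair (pair ?r Y) h" by (simp add: p')
      qed
    qed
    with r \<eta> show "\<exists>r\<in>R. \<exists>e\<in>hom ?C X r. \<forall>y\<in>R. \<forall>g\<in>hom ?C X y.
        \<exists>!h. h \<in> hom ?C r y \<and> Cmp ?C h e = g" by blast
  next
    let ?c = "pair x0 (pair (Idn ?A a) (Idn ?B' b))"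
    show c: "?c \<in> R"
      using x0 a cats Cmp_Idn_right[OF cats(4) g] by (simp add: R_iff Right_Idn[OF D a])
    have cC: "?c \<in> Ob ?C" using c by (simp add: R_def)
    fix Y assume Y: "Y \<in> R"
    then obtain y f' where Y': "Y = pair y (pair f' (Idn ?B' b))"
      by (auto simp: R_def)
    from Y have y: "y \<in> Ob ?A'" and f': "f' \<in> hom ?A a (FOb ?v y)" and u'y: "FOb ?u' y = b" and
      f'g: "Cmp ?B (Cell D y) (FAr ?u f') = g"
      by (auto simp: Y' R_iff)
    \<comment> \<open>The arrow with components \<open>f'\<close> and the identity of
      \<open>b\<close>; its compatibility condition is the equation \<open>f'g\<close> expressing
      membership of \<open>Y\<close> in \<open>R\<close>.\<close>
    obtain n where n: "n \<in> hom ?A' x0 y" "FAr ?v n = f'" "FAr ?u' n = Idn ?B' b"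
    proof (rule comma_square_hom[OF D CD x0(1) y])
      show "f' \<in> hom ?A (FOb ?v x0) (FOb ?v y)" using f' x0 by simp
      show "Idn ?B' b \<in> hom ?B' (FOb ?u' x0) (FOb ?u' y)" using x0 u'y b cats by simp
      show "Cmp ?B (Cell D y) (FAr ?u f') = Cmp ?B (FAr ?w (Idn ?B' b)) (Cell D x0)"
        using f'g Cmp_Idn_left[OF cats(4) g] by (simp add: wId x0)
    qed
    have "p \<in> hom ?C ?c Y \<longleftrightarrow> p = pair (pair ?c Y) n" for p
    proof
      assume "p = pair (pair ?c Y) n"
      then show "p \<in> hom ?C ?c Y"
        using cC Y n Cmp_Idn_right[OF cats(3) f'] Cmp_Idn_left[OF cats(2) Idn_hom[OF cats(2) b]]
        by (simp add: hom_exact_cat Y' R_def)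
    next
      assume "p \<in> hom ?C ?c Y"
      then obtain n' where p: "p = pair (pair ?c Y) n'" and n': "n' \<in> hom ?A' x0 y" and
        n'1: "Cmp ?A (FAr ?v n') (Idn ?A a) = f'" and n'2: "Cmp ?B' (Idn ?B' b) (FAr ?u' n') = Idn ?B' b"
        by (rule exact_homE) (simp add: Y')
      have "n' = n"
      proof (rule comma_square_hom_unique[OF D CD n' n(1)])
        show "FAr ?v n' = FAr ?v n"
          using n'1 Cmp_Idn_right[OF cats(3) Top_hom[OF D n']] by (simp add: n x0)
        show "FAr ?u' n' = FAr ?u' n"
          using n'2 Cmp_Idn_left[OF cats(2) Left_hom[OF D n']] by (simp add: n x0 u'y)
      qed
      with p show "p = pair (pair ?c Y) n" by simp
    qed
    then show "\<exists>!p. p \<in> hom ?C ?c Y" by simp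
  qed
qed

section \<open>Slice squares\<close>

lemma point_sel [simp]: "Src (point B b) = e_cat" "Tgt (point B b) = B" "FOb (point B b) pt = b"
    "FAr (point B b) pt = Idn B b"
  by (simp_all add: point_def)

lemma point_is_functor: "small_category B \<Longrightarrow> b \<in> Ob B \<Longrightarrow> is_functor (point B b)"
  unfolding point_def
  by (rule is_functor_mkI) (auto simp: Cmp_Idn_left[OF _ Idn_hom])

lemma over_homD:
  assumes "f \<in> hom (over_cat u b) x y"
  shows "f = pair (pair x y) (psnd f)" "psnd f \<in> hom (Src u) (pfst x) (pfst y)"
    "Cmp (Tgt u) (psnd y) (FAr u (psnd f)) = psnd x" "x \<in> Ob (over_cat u b)" "y \<in> Ob (over_cat u b)"
  using assms by (auto simp: hom_over_cat)

context
  fixes u :: "'u::universe cat_functor" and b :: 'u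
  assumes u: "is_functor u" and b: "b \<in> Ob (Tgt u)"
begin

lemma over_square_sel [simp]:
  "Src (Top (over_square u b)) = over_cat u b" "Tgt (Top (over_square u b)) = Src u"
  "x \<in> Ob (over_cat u b) \<Longrightarrow> FOb (Top (over_square u b)) x = pfst x"
  "f \<in> hom (over_cat u b) x y \<Longrightarrow> FAr (Top (over_square u b)) f = psnd f"
  "Bottom (over_square u b) = point (Tgt u) b" "Left (over_square u b) = to_e (over_cat u b)"
  "Right (over_square u b) = u"
  "x \<in> Ob (over_cat u b) \<Longrightarrow> Cell (over_square u b) x = psnd x"
  by (simp_all add: over_square_def)

text \<open>Naturality of the cell is the defining equation of slice morphisms, the lower path
  contributing the identity of \<open>b\<close>.\<close>

lemma over_square_is_square: "is_square (over_square u b)"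
proof -
  let ?C = "over_cat u b" and ?S = "over_square u b"
  have B: "small_category (Tgt u)" using u by simp
  have "is_functor (mk_functor ?C (Src u) pfst psnd)"
  proof (rule is_functor_mkI)
    fix x y z f g assume f: "f \<in> hom ?C x y" and g: "g \<in> hom ?C y z"
    from f g obtain f' g' where "f = pair (pair x y) f'" "g = pair (pair y z) g'"
      by (auto simp: hom_over_cat)
    then show "psnd (Cmp ?C g f) = Cmp (Src u) (psnd g) (psnd f)"
      using f g by (simp add: Cmp_over_cat)
  qed (use u in \<open>auto simp: hom_over_cat Ob_over_cat Idn_over_cat\<close>)
  then have T: "is_functor (Top ?S)" by (simp add: over_square_def)
  have "Cmp (Tgt u) (Cell ?S (Cod ?C f)) (FAr u (FAr (Top ?S) f)) =
      Cmp (Tgt u) (FAr (Bottom ?S) (FAr (Left ?S) f)) (Cell ?S (Dom ?C f))" if "f \<in> Ar ?C" for f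
  proof -
    let ?x = "Dom ?C f" and ?y = "Cod ?C f"
    have f: "f \<in> hom ?C ?x ?y" by (rule homI[OF that])
    note fe = over_homD(3)[OF f] and x = over_homD(4)[OF f] and y = over_homD(5)[OF f]
    have "psnd ?x \<in> hom (Tgt u) (FOb u (pfst ?x)) b" using x by (auto simp: Ob_over_cat)
    then show ?thesis
      using x y fe that over_square_sel(4)[OF f] Cmp_Idn_left[OF B] by simp
  qed
  moreover have "Cell ?S x \<in> hom (Tgt u) (FOb u (FOb (Top ?S) x)) (FOb (Bottom ?S) (FOb (Left ?S) x))"
    if "x \<in> Ob ?C" for x
    using that by (auto simp: Ob_over_cat)
  moreover have "Cell ?S \<in> extensional (Ob ?C)" by (simp add: over_square_def)
  ultimately show ?thesis
    unfolding is_square_def Let_def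
    using T u b point_is_functor[OF B b] by simp
qed

text \<open>The comma category of \<open>u\<close> along a point differs from the slice only by a
  constant component \<open>pt\<close> in objects and arrows, which the comma functor
  inserts.\<close>

lemma over_square_comma: "comma_square (over_square u b)"
proof -
  let ?S = "over_square u b" and ?C = "over_cat u b"
  let ?K = "comma_cat u (point (Tgt u) b)" and ?F = "comma_functor ?S"
  note S = over_square_is_square
  have C: "small_category ?C" using u by simp
  note fK = comma_functor_is_functor[OF S]
  have K: "small_category ?K" using Tgt_small[OF fK] by (simp add: comma_functor_sel[OF S])
  have fo: "comma_fo ?S x = pair (pfst x) (pair pt (psnd x))" if "x \<in> Ob ?C" for x
    using that by (simp add: comma_fo_def[OF S])
  have fo_inj: "x = y" if "x \<in> Ob ?C" "y \<in> Ob ?C" "comma_fo ?S x = comma_fo ?S y" for x y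
    using that by (auto simp: fo Ob_over_cat)
  have fo_surj: "\<exists>x\<in>Ob ?C. comma_fo ?S x = y" if "y \<in> Ob ?K" for y
  proof -
    from that obtain a g where y: "y = pair a (pair pt g)" and "a \<in> Ob (Src u)" "g \<in> hom (Tgt u) (FOb u a) b"
      by (auto simp: Ob_comma_cat)
    then have "pair a g \<in> Ob ?C" by (simp add: Ob_over_cat)
    with y show ?thesis by (intro bexI[of _ "pair a g"]) (simp_all add: fo)
  qed
  have fa: "FAr ?F f = pair (pair (comma_fo ?S x) (comma_fo ?S y)) (pair (psnd f) pt)"
    if "f \<in> hom ?C x y" for f x y
    using comma_functor_sel(4)[OF S, of f x y] that over_square_sel(4)[OF that] by simp
  have o: "bij_betw (FOb ?F) (Ob ?C) (Ob ?K)"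
  proof (rule bij_betw_imageI)
    show "inj_on (FOb ?F) (Ob ?C)"
      using fo_inj by (intro inj_onI) (simp add: comma_functor_sel[OF S])
    show "FOb ?F ` Ob ?C = Ob ?K"
      using fo_surj comma_fo_Ob[OF S] by (force simp: comma_functor_sel[OF S] image_iff)
  qed
  have a: "bij_betw (FAr ?F) (Ar ?C) (Ar ?K)"
  proof (rule bij_betw_imageI)
    show "inj_on (FAr ?F) (Ar ?C)"
    proof (rule inj_onI)
      fix f f' assume f: "f \<in> Ar ?C" and f': "f' \<in> Ar ?C" and eq: "FAr ?F f = FAr ?F f'"
      note hf = homI[OF f] and hf' = homI[OF f']
      \<comment> \<open>The raw part does not determine an arrow, so its endpoints are recovered
        from the tags by injectivity on objects.\<close>
      have "Dom ?C f = Dom ?C f'" "Cod ?C f = Cod ?C f'" "psnd f = psnd f'"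
        using eq fa[OF hf] fa[OF hf'] f f' C by (auto intro: fo_inj)
      moreover have "f = pair (pair (Dom ?C f) (Cod ?C f)) (psnd f)" "f' = pair (pair (Dom ?C f') (Cod ?C f')) (psnd f')"
        using over_homD(1)[OF hf] over_homD(1)[OF hf'] .
      ultimately show "f = f'" by simp
    qed
    show "FAr ?F ` Ar ?C = Ar ?K"
    proof
      show "FAr ?F ` Ar ?C \<subseteq> Ar ?K"
        using hom_Ar[OF FAr_hom[OF fK homI]] by (auto simp: comma_functor_sel[OF S])
      show "Ar ?K \<subseteq> FAr ?F ` Ar ?C"
      proof
        fix m assume "m \<in> Ar ?K"
        then have m: "m \<in> hom ?K (Dom ?K m) (Cod ?K m)" by (rule homI)
        then have "Dom ?K m \<in> Ob ?K" "Cod ?K m \<in> Ob ?K" using hom_Ob[OF K] by auto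
        then obtain x y where x: "x \<in> Ob ?C" "comma_fo ?S x = Dom ?K m" and y: "y \<in> Ob ?C" "comma_fo ?S y = Cod ?K m"
          using fo_surj by metis
        have x2: "psnd x \<in> hom (Tgt u) (FOb u (pfst x)) b" using x by (auto simp: Ob_over_cat)
        \<comment> \<open>The lower component is \<open>pt\<close>, sent by \<open>point\<close> to
          the identity of \<open>b\<close>; the comma condition thus collapses to the slice
          condition.\<close>
        from m obtain f where m': "m = pair (pair (Dom ?K m) (Cod ?K m)) (pair f pt)" and
          f: "f \<in> hom (Src u) (pfst x) (pfst y)" and fe: "Cmp (Tgt u) (psnd y) (FAr u f) = psnd x"
          using Cmp_Idn_left[OF Tgt_small[OF u] x2] unfolding hom_comma_cat
          by (auto simp: x(2)[symmetric] y(2)[symmetric] fo[OF x(1)] fo[OF y(1)])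
        let ?n = "pair (pair x y) f"
        have n: "?n \<in> hom ?C x y" using x y f fe by (simp add: hom_over_cat)
        have "FAr ?F ?n = m" using fa[OF n] x y m' by simp
        with hom_Ar[OF n] show "m \<in> FAr ?F ` Ar ?C" by blast
      qed
    qed
  qed
  have "is_iso_functor ?F"
    by (rule is_iso_functorI[OF fK]) (use o a in \<open>simp_all add: comma_functor_sel[OF S]\<close>)
  with S show ?thesis by (simp add: comma_square_def)
qed

end

section \<open>Closure properties of the class of exact squares\<close>

context
  fixes W :: "'u::universe cat_functor set"
  assumes W: "weak_fundamental_localizer W"
begin

lemma over_square_exact:
  "is_functor u \<Longrightarrow> b \<in> Ob (Tgt u) \<Longrightarrow> exact_square W (over_square u b)"
  by (rule comma_square_exact[OF W over_square_comma])

text \<open>The bottom side of the slice square sends \<open>pt\<close> to \<open>b\<close>, so the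
  comparison at \<open>pt\<close> links the composite at (a, pt, g) with \<open>D\<close> at (a, b,
  g).\<close>

lemma exact_local_descent:
  assumes D: "is_square D"
    and E: "\<And>b. b \<in> Ob (Tgt (Left D)) \<Longrightarrow> exact_square W (D \<circ>\<^sub>h over_square (Left D) b)"
  shows "exact_square W D"
  unfolding exact_square_def
proof (intro conjI ballI D)
  fix a b g assume a: "a \<in> Ob (Src (Right D))" and b: "b \<in> Ob (Src (Bottom D))" and
    g: "g \<in> hom (Tgt (Right D)) (FOb (Right D) a) (FOb (Bottom D) b)"
  have L: "is_functor (Left D)" and b': "b \<in> Ob (Tgt (Left D))" using D b by (simp_all add: square_functors square_cats)
  let ?S = "over_square (Left D) b"
  note sel = over_square_sel[OF L b']
  note S = over_square_is_square[OF L b'] and R = sel(7)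
  note hsel = hcomp_sel[OF D S R]
  have "aspherical W (exact_cat (D \<circ>\<^sub>h ?S) a pt g)"
    using E[OF b'] a g unfolding exact_square_def hsel by (simp add: sel)
  moreover have "aspherical W (exact_cat (D \<circ>\<^sub>h ?S) a pt g) \<longleftrightarrow> aspherical W (exact_cat D a b g)"
    using hcomp_exact_cat_aspherical_iff[OF W D S R over_square_exact[OF L b'], of pt a g] by (simp add: sel)
  ultimately show "aspherical W (exact_cat D a b g)" by simp
qed

text \<open>Over the terminal category b and g carry no information, and (a', f, g') shrinks to (a',
  f : a -> v(a')): the indexing category is the coslice of the top side under a.\<close>

lemma coaspherical_square_exact:
  assumes D: "commutative_square D" and T: "coaspherical W (Top D)"
    and L: "Left D = to_e (Src (Top D))" and R: "Right D = to_e (Tgt (Top D))"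
    and Bo: "Bottom D = id_functor e_cat"
  shows "exact_square W D"
  unfolding exact_square_def
proof (intro conjI ballI)
  show sq: "is_square D" using D by (simp add: commutative_square_def)
  let ?T = "Top D"
  have fT: "is_functor ?T" using sq by (simp add: square_functors)
  fix a b g assume "a \<in> Ob (Src (Right D))" "b \<in> Ob (Src (Bottom D))"
    "g \<in> hom (Tgt (Right D)) (FOb (Right D) a) (FOb (Bottom D) b)"
  then have a: "a \<in> Ob (Tgt ?T)" and [simp]: "b = pt" "g = pt"
    by (auto simp: R Bo split: if_splits)
  let ?U = "under_cat ?T a" and ?E = "exact_cat D a pt pt"
  have E_iff: "pair x (pair f k) \<in> Ob ?E \<longleftrightarrow> x \<in> Ob (Src ?T) \<and> f \<in> hom (Tgt ?T) a (FOb ?T x) \<and> k = pt" for x f k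
  proof -
    have "Cell D x = pt" if "x \<in> Ob (Src ?T)"
      using Cell_hom[OF sq that] that fT by (simp add: R Bo L)
    then show ?thesis
      by (auto simp: Ob_exact_cat R Bo L)
  qed
  have hE: "m \<in> hom ?E x y \<longleftrightarrow> x \<in> Ob ?E \<and> y \<in> Ob ?E \<and> (\<exists>f. m = pair (pair x y) f \<and>
      f \<in> hom (Src ?T) (pfst x) (pfst y) \<and> Cmp (Tgt ?T) (FAr ?T f) (pfst (psnd x)) = pfst (psnd y))" for m x y
  proof -
    have "psnd (psnd x) = pt" if "x \<in> Ob ?E" for x
      using that E_iff by (auto simp: Ob_exact_cat)
    then show ?thesis by (auto simp: hom_exact_cat R Bo L)
  qed
  \<comment> \<open>Appends the only possible last component.\<close>
  let ?fo = "\<lambda>x. pair (pfst x) (pair (psnd x) pt)"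
  let ?F = "mk_functor ?U ?E ?fo (hom_map ?fo (\<lambda>f. f))"
  have fo: "?fo x \<in> Ob ?E" if "x \<in> Ob ?U" for x
    using that by (auto simp: E_iff Ob_under_cat)
  have fa: "hom_map ?fo (\<lambda>f. f) m \<in> hom ?E (?fo x) (?fo y)" if "m \<in> hom ?U x y" for m x y
    using that fo by (auto simp: hE hom_under_cat)
  have F: "is_functor ?F"
  proof (rule is_functor_mkI)
    show "hom_map ?fo (\<lambda>f. f) (Idn ?U x) = Idn ?E (?fo x)" if "x \<in> Ob ?U" for x
      using that fo[OF that] by (simp add: Idn_under_cat Idn_exact_cat)
    fix x y z m n assume m: "m \<in> hom ?U x y" and n: "n \<in> hom ?U y z"
    from m n obtain m' n' where [simp]: "m = pair (pair x y) m'" "n = pair (pair y z) n'"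
      by (auto simp: hom_under_cat)
    show "hom_map ?fo (\<lambda>f. f) (Cmp ?U n m) = Cmp ?E (hom_map ?fo (\<lambda>f. f) n) (hom_map ?fo (\<lambda>f. f) m)"
      using m n fa[OF m] fa[OF n] by (simp add: Cmp_under_cat Cmp_exact_cat)
  qed (use fT sq fo fa in auto)
  have "aspherical W (Src ?F) \<longleftrightarrow> aspherical W (Tgt ?F)"
  proof (rule aspherical_iff_equivalence[OF W F])
    fix y assume "y \<in> Ob (Tgt ?F)"
    then have y: "y \<in> Ob ?E" by simp
    then obtain x f k where y': "y = pair x (pair f k)" by (rule exact_catE)
    from y[unfolded y' E_iff] have "y = pair x (pair f pt)" "pair x f \<in> Ob ?U"
      by (simp_all add: y' Ob_under_cat)
    then show "\<exists>x\<in>Ob (Src ?F). FOb ?F x = y"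
      by (intro bexI[of _ "pair x f"]) auto
  next
    fix x y m assume "x \<in> Ob (Src ?F)" "y \<in> Ob (Src ?F)" "m \<in> hom (Tgt ?F) (FOb ?F x) (FOb ?F y)"
    then have x: "x \<in> Ob ?U" and y: "y \<in> Ob ?U" and m: "m \<in> hom ?E (?fo x) (?fo y)" by auto
    then obtain f where m': "m = pair (pair (?fo x) (?fo y)) f" and n: "pair (pair x y) f \<in> hom ?U x y"
      by (auto simp: hE hom_under_cat)
    have "k = pair (pair x y) f" if k: "k \<in> hom ?U x y" "FAr ?F k = m" for k
    proof -
      from k(1) obtain l where "k = pair (pair x y) l" by (auto simp: hom_under_cat)
      then show ?thesis using k(2) unfolding FAr_mk_hom[OF k(1)] by (simp add: m')
    qed
    then show "\<exists>!f. f \<in> hom (Src ?F) x y \<and> FAr ?F f = m"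
      unfolding mk_functor_sel
    proof (intro ex1I[of _ "pair (pair x y) f"] conjI n)
      show "FAr ?F (pair (pair x y) f) = m" unfolding FAr_mk_hom[OF n] by (simp add: m')
    qed blast
  qed
  moreover have "aspherical W ?U"
    using T a by (simp add: coaspherical_iff[OF W])
  ultimately show "aspherical W (exact_cat D a b g)" by simp
qed

lemma exact_admissible: "admissible_class W {D. exact_square W D}"
  unfolding admissible_class_def
proof (intro conjI)
  show "{D. exact_square W D} \<subseteq> Collect is_square"
    by (auto simp: exact_square_def)
  show "iso_closed {D. exact_square W D}"
    using iso_squares_exact[OF W] unfolding iso_closed_def by blast
  show "hcomp_stable {D. exact_square W D}"
    using hcomp_exact[OF W] unfolding hcomp_stable_def by (auto simp: exact_square_def)
  show "local_descent {D. exact_square W D}"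
    using exact_local_descent unfolding local_descent_def by blast
  show "contains_comma_squares {D. exact_square W D}"
    using comma_square_exact[OF W] unfolding contains_comma_squares_def by blast
  show "contains_coaspherical_squares W {D. exact_square W D}"
    using coaspherical_square_exact unfolding contains_coaspherical_squares_def by blast
qed

end

section \<open>Factorization of squares with terminal lower left corner\<close>

context
  fixes E :: "'u::universe square"
  assumes E: "is_square E" and L: "Left E = to_e (Src (Top E))"
begin

text \<open>
  A square with terminal lower left corner is the composite of the slice square on its bottom
  side with the square on the functor \<open>a' \<mapsto> (v(a'), \<alpha>(a'))\<close> into the slice.
\<close>

abbreviation "corner \<equiv> FOb (Bottom E) pt"

definition lift_fo :: "'u \<Rightarrow> 'u" where
  "lift_fo x = pair (FOb (Top E) x) (Cell E x)"

definition slice_lift :: "'u cat_functor" where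
  "slice_lift = mk_functor (Src (Top E)) (over_cat (Right E) corner) lift_fo
     (\<lambda>f. pair (pair (lift_fo (Dom (Src (Top E)) f)) (lift_fo (Cod (Src (Top E)) f))) (FAr (Top E) f))"

definition lift_square :: "'u square" where
  "lift_square = \<lparr>Top = slice_lift, Bottom = id_functor e_cat, Left = to_e (Src (Top E)),
     Right = to_e (over_cat (Right E) corner), Cell = (\<lambda>_\<in>Ob (Src (Top E)). pt)\<rparr>"

lemma Src_Bottom: "Src (Bottom E) = e_cat"
  using square_cats(3)[OF E] by (simp add: L)

lemma corner_Ob: "corner \<in> Ob (Tgt (Right E))"
  using Bottom_Ob[OF E] by (simp add: Src_Bottom)

text \<open>The bottom side of a slice square is literally a \<open>point\<close>, so this equality
  is needed for the composite to be equal to \<open>E\<close> rather than isomorphic to it.\<close>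

lemma Bottom_eq_point: "Bottom E = point (Tgt (Right E)) corner"
proof (rule functor_eqI)
  show "is_functor (point (Tgt (Right E)) corner)"
    by (rule point_is_functor[OF square_small_categories(4)[OF E] corner_Ob])
  show "FAr (Bottom E) f = FAr (point (Tgt (Right E)) corner) f" if "f \<in> Ar (Src (point (Tgt (Right E)) corner))" for f
    using that Bottom_Idn[OF E, of pt] by (simp add: Src_Bottom)
qed (use E in \<open>simp_all add: square_functors square_cats Src_Bottom\<close>)

lemma corner_Cell_hom: "x \<in> Ob (Src (Top E)) \<Longrightarrow>
    Cell E x \<in> hom (Tgt (Right E)) (FOb (Right E) (FOb (Top E) x)) corner"
  using Cell_hom[OF E] by (simp add: L)

text \<open>The lower path of the naturality square passes through the terminal category and is an
  identity. What remains says that the image of \<open>f\<close> is a morphism of the slice.\<close>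

lemma corner_Cell_natural:
  assumes f: "f \<in> hom (Src (Top E)) x y"
  shows "Cmp (Tgt (Right E)) (Cell E y) (FAr (Right E) (FAr (Top E) f)) = Cell E x"
proof -
  have x: "x \<in> Ob (Src (Top E))" using hom_Ob[OF square_small_categories(1)[OF E] f] by simp
  have "FAr (Bottom E) (FAr (Left E) f) = Idn (Tgt (Right E)) corner"
    using f Bottom_Idn[OF E, of pt] by (simp add: L Src_Bottom)
  then show ?thesis
    using Cell_natural[OF E f] Cmp_Idn_left[OF square_small_categories(4)[OF E] corner_Cell_hom[OF x]] by simp
qed

lemma lift_fo_Ob: "x \<in> Ob (Src (Top E)) \<Longrightarrow> lift_fo x \<in> Ob (over_cat (Right E) corner)"
  using Top_Ob[OF E] corner_Cell_hom by (simp add: lift_fo_def Ob_over_cat)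

lemma slice_lift_sel [simp]:
  "Src slice_lift = Src (Top E)" "Tgt slice_lift = over_cat (Right E) corner"
  "x \<in> Ob (Src (Top E)) \<Longrightarrow> FOb slice_lift x = lift_fo x"
  "f \<in> hom (Src (Top E)) x y \<Longrightarrow>
    FAr slice_lift f = pair (pair (lift_fo x) (lift_fo y)) (FAr (Top E) f)"
  by (auto simp: slice_lift_def hom_def)

lemma slice_lift_hom:
  assumes "f \<in> hom (Src (Top E)) x y"
  shows "pair (pair (lift_fo x) (lift_fo y)) (FAr (Top E) f) \<in>
    hom (over_cat (Right E) corner) (lift_fo x) (lift_fo y)"
  using lift_fo_Ob hom_Ob[OF square_small_categories(1)[OF E] assms] Top_hom[OF E assms] corner_Cell_natural[OF assms]
  by (simp add: hom_over_cat) (simp add: lift_fo_def)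

lemma slice_lift_is_functor: "is_functor slice_lift"
  unfolding slice_lift_def
proof (rule is_functor_mkI)
  let ?P = "Src (Top E)" and ?O = "over_cat (Right E) corner"
  let ?fa = "\<lambda>f. pair (pair (lift_fo (Dom ?P f)) (lift_fo (Cod ?P f))) (FAr (Top E) f)"
  have P: "small_category ?P" using square_small_categories[OF E] by simp
  have fa: "?fa f = pair (pair (lift_fo x) (lift_fo y)) (FAr (Top E) f)" if "f \<in> hom ?P x y" for f x y
    using that by (auto simp: hom_def)
  show "?fa f \<in> hom ?O (lift_fo x) (lift_fo y)" if "f \<in> hom ?P x y" for f x y
    unfolding fa[OF that] by (rule slice_lift_hom[OF that])
  show "?fa (Idn ?P x) = Idn ?O (lift_fo x)" if x: "x \<in> Ob ?P" for x
    unfolding fa[OF Idn_hom[OF P x]]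
    using lift_fo_Ob[OF x] Top_Idn[OF E x] by (simp add: Idn_over_cat) (simp add: lift_fo_def)
  show "?fa (Cmp ?P g f) = Cmp ?O (?fa g) (?fa f)" if f: "f \<in> hom ?P x y" and g: "g \<in> hom ?P y z" for x y z f g
    unfolding fa[OF f] fa[OF g] fa[OF Cmp_hom[OF P f g]]
    using slice_lift_hom[OF f] slice_lift_hom[OF g] Top_Cmp[OF E f g] by (simp add: Cmp_over_cat)
qed (use E lift_fo_Ob in \<open>simp_all add: square_small_categories square_functors\<close>)

text \<open>Both paths end in \<open>e_cat\<close> and agree by uniqueness; the value
  \<open>pt\<close> of the cell is its only identity.\<close>

lemma lift_square_commutative: "commutative_square lift_square"
proof -
  let ?P = "Src (Top E)" and ?O = "over_cat (Right E) corner"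
  have P: "small_category ?P" and O: "small_category ?O"
    using E by (simp_all add: square_small_categories square_functors)
  have "FAr (to_e ?O) (FAr slice_lift f) = pt" if "f \<in> Ar ?P" for f
    using FAr_hom[OF slice_lift_is_functor, of f "Dom ?P f" "Cod ?P f"] homI[OF that] by simp
  then have sq: "is_square lift_square"
    unfolding is_square_def Let_def lift_square_def
    using P O slice_lift_is_functor lift_fo_Ob by simp
  have "to_e ?O \<circ>\<^sub>F slice_lift = to_e ?P"
    using to_e_unique[of "to_e ?O \<circ>\<^sub>F slice_lift"] comp_is_functor[OF slice_lift_is_functor, of "to_e ?O"] O by simp
  moreover have "id_functor e_cat \<circ>\<^sub>F to_e ?P = to_e ?P"
    using to_e_unique[of "id_functor e_cat \<circ>\<^sub>F to_e ?P"] comp_is_functor[of "to_e ?P" "id_functor e_cat"] P by simp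
  ultimately show ?thesis
    unfolding commutative_square_def using sq lift_fo_Ob by (simp add: lift_square_def)
qed

text \<open>The first projection from the slice undoes \<open>slice_lift\<close>, and the pasted
  cell is the identity of the corner after the second component, which is the cell of
  \<open>E\<close>.\<close>

lemma over_square_hcomp_lift_square: "over_square (Right E) corner \<circ>\<^sub>h lift_square = E"
proof -
  let ?P = "Src (Top E)" and ?S = "over_square (Right E) corner"
  note sel = over_square_sel[OF square_functors(4)[OF E] corner_Ob]
  note S = over_square_is_square[OF square_functors(4)[OF E] corner_Ob]
  have B: "small_category (Tgt (Right E))" using square_small_categories[OF E] by simp
  have [simp]: "Top lift_square = slice_lift" "Bottom lift_square = id_functor e_cat"
      "Left lift_square = to_e ?P" "x \<in> Ob ?P \<Longrightarrow> Cell lift_square x = pt" for x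
    by (simp_all add: lift_square_def)
  have "Top ?S \<circ>\<^sub>F slice_lift = Top E"
  proof (rule functor_eqI)
    show "is_functor (Top ?S \<circ>\<^sub>F slice_lift)"
      by (rule comp_is_functor[OF slice_lift_is_functor square_functors(1)[OF S]]) (simp add: sel)
    show "FOb (Top ?S \<circ>\<^sub>F slice_lift) x = FOb (Top E) x" if "x \<in> Ob ?P" for x
      using that lift_fo_Ob[OF that] by (simp add: sel) (simp add: lift_fo_def)
    show "FAr (Top ?S \<circ>\<^sub>F slice_lift) f = FAr (Top E) f" if "f \<in> Ar ?P" for f
      using that homI[OF that] sel(4)[OF slice_lift_hom[OF homI[OF that]]] by simp
  qed (use E in \<open>simp_all add: sel square_functors square_cats\<close>)
  moreover have "Bottom ?S \<circ>\<^sub>F id_functor e_cat = Bottom E"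
  proof (rule trans[OF _ Bottom_eq_point[symmetric]])
    show "Bottom ?S \<circ>\<^sub>F id_functor e_cat = point (Tgt (Right E)) corner"
      unfolding sel
      by (rule functor_eqI) (use comp_is_functor[OF id_is_functor point_is_functor[OF B corner_Ob]]
        point_is_functor[OF B corner_Ob] in \<open>simp_all\<close>)
  qed
  moreover have "(\<lambda>x\<in>Ob ?P. Cmp (Tgt (Right ?S)) (FAr (Bottom ?S) (Cell lift_square x))
      (Cell ?S (FOb slice_lift x))) = Cell E"
  \<comment> \<open>Both sides are \<open>undefined\<close> off the objects of \<open>?P\<close>, so
    agreement on objects suffices.\<close>
  proof (rule extensionalityI[OF restrict_extensional Cell_ext[OF E]])
    fix x assume x: "x \<in> Ob ?P"
    have "psnd (lift_fo x) = Cell E x" by (simp add: lift_fo_def)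
    then show "(\<lambda>x\<in>Ob ?P. Cmp (Tgt (Right ?S)) (FAr (Bottom ?S) (Cell lift_square x))
        (Cell ?S (FOb slice_lift x))) x = Cell E x"
      using x lift_fo_Ob[OF x] Cmp_Idn_left[OF B corner_Cell_hom[OF x]] by (simp add: sel)
  qed
  ultimately show ?thesis
    unfolding hcomp_def by (simp add: sel(7) L)
qed

text \<open>A slice arrow from (a, g) to (v(x), \<alpha>_x) is an f with \<alpha>_x u(f) = g, which
  is the condition on an object (x, f, pt) of the indexing category. The two categories differ by
  the tag on f and the component \<open>pt\<close>.\<close>

lemma under_slice_lift_aspherical_iff:
  assumes W: "weak_fundamental_localizer W" and a: "a \<in> Ob (Src (Right E))"
    and g: "g \<in> hom (Tgt (Right E)) (FOb (Right E) a) corner"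
  shows "aspherical W (exact_cat E a pt g) \<longleftrightarrow> aspherical W (under_cat slice_lift (pair a g))"
proof -
  let ?P = "Src (Top E)" and ?A = "Src (Right E)" and ?B = "Tgt (Right E)"
  let ?O = "over_cat (Right E) corner" and ?C = "exact_cat E a pt g" and ?U = "under_cat slice_lift (pair a g)"
  note cats = square_small_categories[OF E]
  have z: "pair a g \<in> Ob ?O" using a g by (simp add: Ob_over_cat)
  have C_iff: "pair x (pair f k) \<in> Ob ?C \<longleftrightarrow> x \<in> Ob ?P \<and> f \<in> hom ?A a (FOb (Top E) x) \<and> k = pt \<and>
      Cmp ?B (Cell E x) (FAr (Right E) f) = g" for x f k
  proof -
    have "FAr (Bottom E) pt = Idn ?B corner" using Bottom_Idn[OF E, of pt] by (simp add: Src_Bottom)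
    moreover have "Cmp ?B (Idn ?B corner) (Cmp ?B (Cell E x) (FAr (Right E) f)) = Cmp ?B (Cell E x) (FAr (Right E) f)"
      if "x \<in> Ob ?P" "f \<in> hom ?A a (FOb (Top E) x)"
      by (rule Cmp_Idn_left[OF cats(4) Cmp_hom[OF cats(4) Right_hom[OF E that(2)] corner_Cell_hom[OF that(1)]]])
    ultimately show ?thesis
      by (auto simp: Ob_exact_cat L Src_Bottom)
  qed
  have hC: "pair (pair x y) n \<in> hom ?C x y \<longleftrightarrow> n \<in> hom ?P (pfst x) (pfst y) \<and>
      Cmp ?A (FAr (Top E) n) (pfst (psnd x)) = pfst (psnd y)" if "x \<in> Ob ?C" "y \<in> Ob ?C" for n x y
  proof -
    have "psnd (psnd x) = pt" if "x \<in> Ob ?C" for x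
      using that C_iff by (auto simp: Ob_exact_cat)
    then show ?thesis using that by (auto simp: hom_exact_cat L Src_Bottom)
  qed
  \<comment> \<open>Drops \<open>pt\<close> and tags the middle arrow as a morphism of the
    slice.\<close>
  define fo where "fo x = pair (pfst x) (pair (pair (pair a g) (lift_fo (pfst x))) (pfst (psnd x)))" for x
  have pfst_fo [simp]: "pfst (fo x) = pfst x" for x by (simp add: fo_def)
  have lift_iff: "pair (pair (pair a g) (lift_fo x)) f \<in> hom ?O (pair a g) (lift_fo x) \<longleftrightarrow>
      f \<in> hom ?A a (FOb (Top E) x) \<and> Cmp ?B (Cell E x) (FAr (Right E) f) = g" if "x \<in> Ob ?P" for x f
    using z lift_fo_Ob[OF that] by (simp add: hom_over_cat) (simp add: lift_fo_def)
  have fo: "fo x \<in> Ob ?U" if "x \<in> Ob ?C" for x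
  proof -
    from that obtain y f k where [simp]: "x = pair y (pair f k)" by (rule exact_catE)
    from that have "y \<in> Ob ?P" "f \<in> hom ?A a (FOb (Top E) y)" "Cmp ?B (Cell E y) (FAr (Right E) f) = g"
      by (simp_all add: C_iff)
    then show ?thesis using lift_iff by (simp add: Ob_under_cat fo_def)
  qed
  have hom_iff: "pair (pair (fo x) (fo y)) n \<in> hom ?U (fo x) (fo y) \<longleftrightarrow> pair (pair x y) n \<in> hom ?C x y"
    if x: "x \<in> Ob ?C" and y: "y \<in> Ob ?C" for x y n
  proof -
    from x obtain x1 f k where x': "x = pair x1 (pair f k)" by (rule exact_catE)
    from y obtain y1 f' k' where y': "y = pair y1 (pair f' k')" by (rule exact_catE)
    from x have x1: "x1 \<in> Ob ?P" "pair (pair (pair a g) (lift_fo x1)) f \<in> hom ?O (pair a g) (lift_fo x1)"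
      using lift_iff by (simp_all add: x' C_iff)
    have 1: "Cmp ?O (FAr slice_lift n) (psnd (fo x)) = psnd (fo y) \<longleftrightarrow>
        Cmp ?A (FAr (Top E) n) (pfst (psnd x)) = pfst (psnd y)"
      if n: "n \<in> hom ?P (pfst x) (pfst y)"
    proof -
      have n': "n \<in> hom ?P x1 y1" using n by (simp add: x' y')
      show ?thesis
        using Cmp_over_cat[OF x1(2) slice_lift_hom[OF n']] slice_lift_sel(4)[OF n'] by (simp add: x' y' fo_def)
    qed
    have "pair (pair (fo x) (fo y)) n \<in> hom ?U (fo x) (fo y) \<longleftrightarrow> n \<in> hom ?P (pfst x) (pfst y) \<and>
        Cmp ?O (FAr slice_lift n) (psnd (fo x)) = psnd (fo y)"
      using fo[OF x] fo[OF y] by (simp add: hom_under_cat)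
    then show ?thesis
      using 1 hC[OF x y] by blast
  qed
  let ?F = "mk_functor ?C ?U fo (hom_map fo (\<lambda>n. n))"
  have F: "is_functor ?F"
  proof (rule is_functor_mkI)
    show fa: "hom_map fo (\<lambda>n. n) m \<in> hom ?U (fo x) (fo y)" if m: "m \<in> hom ?C x y" for m x y
    proof -
      from m obtain n where "m = pair (pair x y) n" "x \<in> Ob ?C" "y \<in> Ob ?C" by (rule exact_homE)
      with m hom_iff show ?thesis by simp
    qed
    show "hom_map fo (\<lambda>n. n) (Idn ?C x) = Idn ?U (fo x)" if "x \<in> Ob ?C" for x
      using that fo[OF that] by (simp add: Idn_exact_cat Idn_under_cat)
    fix x y t m n assume m: "m \<in> hom ?C x y" and n: "n \<in> hom ?C y t"
    from m obtain m' where [simp]: "m = pair (pair x y) m'" by (rule exact_homE)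
    from n obtain n' where [simp]: "n = pair (pair y t) n'" by (rule exact_homE)
    show "hom_map fo (\<lambda>n. n) (Cmp ?C n m) = Cmp ?U (hom_map fo (\<lambda>n. n) n) (hom_map fo (\<lambda>n. n) m)"
      using m n fa[OF m] fa[OF n] by (simp add: Cmp_exact_cat Cmp_under_cat)
  qed (use E slice_lift_is_functor fo in auto)
  have "aspherical W (Src ?F) \<longleftrightarrow> aspherical W (Tgt ?F)"
  proof (rule aspherical_iff_equivalence[OF W F])
    fix X assume "X \<in> Ob (Tgt ?F)"
    then obtain x m where X: "X = pair x m" and x: "x \<in> Ob ?P" and m: "m \<in> hom ?O (pair a g) (lift_fo x)"
      by (auto simp: Ob_under_cat)
    note m' = over_homD(1)[OF m]
    have "pair x (pair (psnd m) pt) \<in> Ob ?C"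
      using lift_iff[OF x, of "psnd m"] m x unfolding m'[symmetric] by (simp add: C_iff)
    moreover have "fo (pair x (pair (psnd m) pt)) = X"
      using m' by (simp add: fo_def X)
    ultimately show "\<exists>y\<in>Ob (Src ?F). FOb ?F y = X"
      by (intro bexI[of _ "pair x (pair (psnd m) pt)"]) auto
  next
    fix x y m assume "x \<in> Ob (Src ?F)" "y \<in> Ob (Src ?F)" "m \<in> hom (Tgt ?F) (FOb ?F x) (FOb ?F y)"
    then have x: "x \<in> Ob ?C" and y: "y \<in> Ob ?C" and m: "m \<in> hom ?U (fo x) (fo y)" by auto
    then obtain n where m': "m = pair (pair (fo x) (fo y)) n"
      by (auto simp: hom_under_cat)
    have n: "pair (pair x y) n \<in> hom ?C x y" using m unfolding m' hom_iff[OF x y] .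
    have "k = pair (pair x y) n" if k: "k \<in> hom ?C x y" "FAr ?F k = m" for k
    proof -
      from k(1) obtain l where "k = pair (pair x y) l" by (rule exact_homE)
      then show ?thesis using k(2) unfolding FAr_mk_hom[OF k(1)] by (simp add: m')
    qed
    then show "\<exists>!f. f \<in> hom (Src ?F) x y \<and> FAr ?F f = m"
      unfolding mk_functor_sel
    proof (intro ex1I[of _ "pair (pair x y) n"] conjI n)
      show "FAr ?F (pair (pair x y) n) = m" unfolding FAr_mk_hom[OF n] by (simp add: m')
    qed blast
  qed
  then show ?thesis by simp
qed

text \<open>Triples (a, pt, g) and objects (a, g) of the slice are the same data, so exactness of
  \<open>E\<close> at all triples is coasphericity of \<open>slice_lift\<close>.\<close>

lemma exact_mem_admissible_if_terminal_corner:
  assumes W: "weak_fundamental_localizer W" and Q: "admissible_class W Q" and ex: "exact_square W E"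
  shows "E \<in> Q"
proof -
  have "coaspherical W slice_lift"
    unfolding coaspherical_iff[OF W] slice_lift_sel
  proof (intro conjI ballI slice_lift_is_functor)
    fix z assume "z \<in> Ob (over_cat (Right E) corner)"
    then obtain a g where z: "z = pair a g" and a: "a \<in> Ob (Src (Right E))" and
      g: "g \<in> hom (Tgt (Right E)) (FOb (Right E) a) corner"
      by (auto simp: Ob_over_cat)
    have "aspherical W (exact_cat E a pt g)"
      using ex a g by (simp add: exact_square_def Src_Bottom)
    then show "aspherical W (under_cat slice_lift z)"
      using under_slice_lift_aspherical_iff[OF W a g] z by simp
  qed
  moreover have "Top lift_square = slice_lift" "Bottom lift_square = id_functor e_cat"
      "Left lift_square = to_e (Src slice_lift)" "Right lift_square = to_e (Tgt slice_lift)"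
    by (simp_all add: lift_square_def)
  ultimately have 1: "lift_square \<in> Q"
    using Q lift_square_commutative unfolding admissible_class_def contains_coaspherical_squares_def by auto
  have 2: "over_square (Right E) corner \<in> Q"
    using Q over_square_comma[OF square_functors(4)[OF E] corner_Ob]
    unfolding admissible_class_def contains_comma_squares_def by blast
  have "Right lift_square = Left (over_square (Right E) corner)"
    by (simp add: lift_square_def over_square_def)
  then have "over_square (Right E) corner \<circ>\<^sub>h lift_square \<in> Q"
    using Q 1 2 unfolding admissible_class_def hcomp_stable_def by blast
  then show ?thesis by (simp add: over_square_hcomp_lift_square)
qed

end

theorem mainTheorem2:
  fixes W :: "'u::universe cat_functor set"
  assumes "weak_fundamental_localizer W"
  shows "admissible_class W {D. exact_square W D} \<and>
    (\<forall>Q. admissible_class W Q \<longrightarrow> {D. exact_square W D} \<subseteq> Q)"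
proof (intro conjI allI impI subsetI)
  show "admissible_class W {D. exact_square W D}" by (rule exact_admissible[OF assms])
  fix Q D assume Q: "admissible_class W Q" and "D \<in> {D. exact_square W D}"
  then have ex: "exact_square W D" and D: "is_square D" by (simp_all add: exact_square_def)
  \<comment> \<open>The composite has terminal lower left corner, and it is again exact by stability
    under composition, since slice squares are exact as comma squares.\<close>
  have "D \<circ>\<^sub>h over_square (Left D) b \<in> Q" if b: "b \<in> Ob (Tgt (Left D))" for b
  proof -
    let ?S = "over_square (Left D) b"
    note L = square_functors(3)[OF D]
    note sel = over_square_sel[OF L b]
    note S = over_square_is_square[OF L b]
    note hsel = hcomp_sel[OF D S sel(7)]
    show ?thesis
    proof (rule exact_mem_admissible_if_terminal_corner[OF _ _ assms Q])
      show "is_square (D \<circ>\<^sub>h ?S)" by (rule hcomp_is_square[OF D S sel(7)])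
      show "Left (D \<circ>\<^sub>h ?S) = to_e (Src (Top (D \<circ>\<^sub>h ?S)))" by (simp add: hsel sel)
      show "exact_square W (D \<circ>\<^sub>h ?S)"
        by (rule hcomp_exact[OF assms D S sel(7) ex over_square_exact[OF assms L b]])
    qed
  qed
  with Q D show "D \<in> Q"
    unfolding admissible_class_def local_descent_def by blast
qed

end
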